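(* Let $\Omega=B(0,1)\subset\mathbb R^3$ be the unit ball and write $r=|x|$. Define \[ q_1(r)=\frac{56/9}{\left(1-\frac79 r^2\right)^2},\qquad q(r)=\frac{600}{13}\,\frac{r^8}{\left(1-\frac3{13}r^{10}\right)^2},\qquad q_2(r)=\frac{392}{15}\,\frac{r^{12}}{\left(1-\frac1{15}r^{14}\right)^2}. \] Then $q,q_1,q_2$ (as functions of $x$ with $r=|x|$) are nonnegative real analytic functions in a neighborhood of $\overline{B(0,1)}$, they are pairwise distinct, and \[ \Lambda_q=\tfrac12\Lambda_{q_1}+\tfrac12\Lambda_{q_2}. \]
   Context: For a bounded domain $\Omega\subset\mathbb R^n$ with smooth boundary and a nonnegative real potential $q\in C^\infty(\overline\Omega)$, the Schrödinger Dirichlet-to-Neumann (DN) map is $\Lambda_q f=\partial_\nu u_f|_{\partial\Omega}$, where $u_f$ is the unique solution of $(-\Delta+q)u_f=0$ in $\Omega$, $u_f|_{\partial\Omega}=f$, and $\nu$ is the outer unit normal. $\Lambda_q$ is regarded as a bounded operator $H^{1/2}(\partial\Omega)\to H^{-1/2}(\partial\Omega)$, equivalently as the bounded symmetric bilinear form $\langle\Lambda_q f,g\rangle$ on $H^{1/2}(\partial\Omega)$. *)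

theory Defs
  imports "HOL-Analysis.Analysis"
begin

section \<open>Real analytic and smooth functions of several variables\<close>

text \<open>
  A multi-index is a function \<open>\<alpha> :: 'n \<Rightarrow> nat\<close>; the power series is summed
  unconditionally over all multi-indices.
\<close>

definition real_analytic_on :: "(real^'n \<Rightarrow> real) \<Rightarrow> (real^'n) set \<Rightarrow> bool"
    (infixl \<open>real'_analytic'_on\<close> 50) where
  "f real_analytic_on U \<longleftrightarrow>
     (\<forall>p\<in>U. \<exists>r>0. \<exists>a :: ('n \<Rightarrow> nat) \<Rightarrow> real. \<forall>x\<in>ball p r.
        ((\<lambda>\<alpha>. a \<alpha> * (\<Prod>i\<in>UNIV. (x $ i - p $ i) ^ \<alpha> i)) has_sum f x) UNIV)"

definition partial :: "'n \<Rightarrow> (real^'n \<Rightarrow> real) \<Rightarrow> real^'n \<Rightarrow> real" where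
  "partial i f x = frechet_derivative f (at x) (axis i 1)"

definition grad :: "(real^'n \<Rightarrow> real) \<Rightarrow> real^'n \<Rightarrow> real^'n" where
  "grad f x = (\<chi> i. partial i f x)"

primrec k_times_differentiable :: "nat \<Rightarrow> (real^'n \<Rightarrow> real) \<Rightarrow> bool" where
  "k_times_differentiable 0 f \<longleftrightarrow> True"
| "k_times_differentiable (Suc k) f \<longleftrightarrow>
     (\<forall>x. f differentiable (at x)) \<and> (\<forall>i. k_times_differentiable k (partial i f))"

definition smooth :: "(real^'n \<Rightarrow> real) \<Rightarrow> bool" where
  "smooth f \<longleftrightarrow> (\<forall>k. k_times_differentiable k f)"

definition test_function :: "(real^'n) set \<Rightarrow> (real^'n \<Rightarrow> real) \<Rightarrow> bool" where
  "test_function \<Omega> \<phi> \<longleftrightarrow>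
     smooth \<phi> \<and> compact (closure {x. \<phi> x \<noteq> 0}) \<and> closure {x. \<phi> x \<noteq> 0} \<subseteq> \<Omega>"

section \<open>Sobolev spaces\<close>

text \<open>
  Elements of \<open>L\<^sup>2\<close> are represented by Borel functions, which are not identified when they
  agree almost everywhere.  Only the values on the space of the measure matter.
\<close>

abbreviation volume_on :: "(real^'n) set \<Rightarrow> (real^'n) measure" where
  "volume_on \<Omega> \<equiv> restrict_space lborel \<Omega>"

definition L2 :: "'a measure \<Rightarrow> ('a \<Rightarrow> 'b::real_normed_vector) set" where
  "L2 M = {f \<in> borel_measurable M. integrable M (\<lambda>x. (norm (f x))\<^sup>2)}"

definition has_weak_grad ::
    "(real^'n) set \<Rightarrow> (real^'n \<Rightarrow> real) \<Rightarrow> (real^'n \<Rightarrow> real^'n) \<Rightarrow> bool" where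
  "has_weak_grad \<Omega> u G \<longleftrightarrow>
     (\<forall>\<phi>. test_function \<Omega> \<phi> \<longrightarrow>
        (\<forall>i. (\<integral>x. u x * partial i \<phi> x \<partial>volume_on \<Omega>)
               = - (\<integral>x. G x $ i * \<phi> x \<partial>volume_on \<Omega>)))"

definition H1 :: "(real^'n) set \<Rightarrow> (real^'n \<Rightarrow> real) set" where
  "H1 \<Omega> = {u \<in> L2 (volume_on \<Omega>). \<exists>G \<in> L2 (volume_on \<Omega>). has_weak_grad \<Omega> u G}"

text \<open>For \<open>u \<in> H1 \<Omega>\<close> with \<open>\<Omega>\<close> open the weak gradient is determined up to a null set.\<close>

definition weak_grad :: "(real^'n) set \<Rightarrow> (real^'n \<Rightarrow> real) \<Rightarrow> real^'n \<Rightarrow> real^'n" where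
  "weak_grad \<Omega> u = (SOME G. G \<in> L2 (volume_on \<Omega>) \<and> has_weak_grad \<Omega> u G)"

section \<open>Traces on the unit sphere\<close>

text \<open>
  Surface measure as cone measure: the area of \<open>A\<close> is \<open>n\<close> times the volume of
  the cone \<open>{t *\<^sub>R a | t a. 0 < t \<and> t < 1 \<and> a \<in> A}\<close>.  Note \<open>sgn x = x /\<^sub>R norm x\<close>.
\<close>

definition sphere_measure :: "(real^'n) measure" where
  "sphere_measure =
     scale_measure (of_nat CARD('n))
       (distr (volume_on (ball 0 1 - {0})) (restrict_space borel (sphere 0 1)) sgn)"

text \<open>
  The trace is the continuous extension of \<open>\<phi> \<mapsto> \<phi>|\<^sub>\<partial>\<^sub>\<Omega>\<close> from smooth functions, which are
  dense in \<open>H\<^sup>1\<close> of the unit ball; traces are determined up to null sets.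
\<close>

definition has_trace :: "(real^'n \<Rightarrow> real) \<Rightarrow> (real^'n \<Rightarrow> real) \<Rightarrow> bool" where
  "has_trace u f \<longleftrightarrow>
     u \<in> H1 (ball 0 1) \<and> f \<in> L2 sphere_measure \<and>
     (\<exists>\<phi> :: nat \<Rightarrow> real^'n \<Rightarrow> real.
        (\<forall>k. smooth (\<phi> k)) \<and>
        (\<lambda>k. \<integral>x. (\<phi> k x - u x)\<^sup>2 + (norm (grad (\<phi> k) x - weak_grad (ball 0 1) u x))\<^sup>2
               \<partial>volume_on (ball 0 1)) \<longlonglongrightarrow> 0 \<and>
        (\<lambda>k. \<integral>x. (\<phi> k x - f x)\<^sup>2 \<partial>sphere_measure) \<longlonglongrightarrow> 0)"

text \<open>\<open>H\<^sup>1\<^sup>/\<^sup>2\<close> of the unit sphere, as the range of the trace map.\<close>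

definition H_half :: "(real^'n \<Rightarrow> real) set" where
  "H_half = {f. \<exists>u. has_trace u f}"

section \<open>The Dirichlet-to-Neumann map of the unit ball\<close>

definition schrodinger_form ::
    "(real^'n \<Rightarrow> real) \<Rightarrow> (real^'n \<Rightarrow> real) \<Rightarrow> (real^'n \<Rightarrow> real) \<Rightarrow> real" where
  "schrodinger_form q u v =
     (\<integral>x. weak_grad (ball 0 1) u x \<bullet> weak_grad (ball 0 1) v x + q x * u x * v x
        \<partial>volume_on (ball 0 1))"

text \<open>
  Weak solutions of \<open>(-\<Delta> + q) u = 0\<close> with boundary value \<open>f\<close>.  The functions \<open>v\<close> with
  trace zero form \<open>H\<^sup>1\<^sub>0\<close>.
\<close>

definition dirichlet_solution :: "(real^'n \<Rightarrow> real) \<Rightarrow> (real^'n \<Rightarrow> real) \<Rightarrow> (real^'n \<Rightarrow> real) \<Rightarrow> bool"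
  where "dirichlet_solution q f u \<longleftrightarrow>
     has_trace u f \<and> (\<forall>v. has_trace v (\<lambda>_. 0) \<longrightarrow> schrodinger_form q u v = 0)"

text \<open>
  The normal derivative of a weak solution \<open>u\<close> is the functional on \<open>H\<^sup>1\<^sup>/\<^sup>2\<close> given by
  Green's formula; the value does not depend on the chosen extension \<open>v\<close> of \<open>g\<close>.
\<close>

definition normal_derivative ::
    "(real^'n \<Rightarrow> real) \<Rightarrow> (real^'n \<Rightarrow> real) \<Rightarrow> (real^'n \<Rightarrow> real) \<Rightarrow> real" where
  "normal_derivative q u g = schrodinger_form q u (SOME v. has_trace v g)"

text \<open>
  \<open>DN q f g\<close> is the pairing of \<open>\<Lambda>\<^sub>q f\<close> with \<open>g\<close>.  For bounded nonnegative \<open>q\<close> the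
  solution selected by \<open>SOME\<close> exists and is unique up to null sets.
\<close>

definition DN :: "(real^'n \<Rightarrow> real) \<Rightarrow> (real^'n \<Rightarrow> real) \<Rightarrow> (real^'n \<Rightarrow> real) \<Rightarrow> real" where
  "DN q f = normal_derivative q (SOME u. dirichlet_solution q f u)"

end

theory Submission
  imports Defs "HOL-Real_Asymp.Real_Asymp"
begin

text \<open>
  With \<open>\<kappa> = 1, 5, 7\<close> and \<open>A = 7/9, 3/13, 1/15\<close> the potentials are
  \<open>8 \<kappa>\<^sup>2 A r\<^bsup>2\<kappa>-2\<^esup> / (1 - A r\<^bsup>2\<kappa>\<^esup>)\<^sup>2\<close>.  In the variable \<open>log r\<close> each of them is a
  Poeschl-Teller potential, so a Darboux transformation turns harmonic functions into solutions:
  if \<open>h\<close> is harmonic, then \<open>u = x \<bullet> \<nabla>h + (1/2 + w) h\<close> with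
  \<open>w = \<kappa> (1 + A r\<^bsup>2\<kappa>\<^esup>) / (1 - A r\<^bsup>2\<kappa>\<^esup>)\<close> solves the Schroedinger equation.  In all three cases
  \<open>w = 8\<close> on the sphere, so one \<open>h\<close> serves all three potentials: writing \<open>H\<close> for the harmonic
  extension of \<open>f\<close>, it is the solution \<open>h(x) = \<integral>\<^sub>0\<^sup>1 t\<^bsup>15/2\<^esup> H(t x) dt\<close> of
  \<open>x \<bullet> \<nabla>h + 17/2 h = H\<close>, and \<open>u = H + (w - 8) h\<close>.  Green's formula then gives
  \<open>\<langle>\<Lambda> f, g\<rangle> = \<langle>\<Lambda>\<^sub>0 f, g\<rangle> + c \<integral> h g\<close> over the sphere with \<open>c = \<kappa>\<^sup>2 4 A / (1 - A)\<^sup>2 = 63, 39, 15\<close>, and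
  \<open>39\<close> is the mean of \<open>63\<close> and \<open>15\<close>.
\<close>

section \<open>The space \<open>L2\<close> over an arbitrary measure, without passing to classes
  modulo null sets\<close>

section \<open>Square-integrable functions\<close>

text \<open>The constants come from the single relation \<kappa> (1 + A) = 8 (1 - A), that is A = (8
  - \<kappa>) / (8 + \<kappa>). It gives c = 64 - \<kappa>^2, so the boundary constants average
  because 1, 25, 49 is an arithmetic progression. The obstacle is regularity. \<open>H\<close> is
  only a minimiser of the Dirichlet integral, so \<open>H\<close> and \<open>h\<close> are L2 limits
  of smooth functions that need not be harmonic. Every identity is therefore of first order, proved
  for smooth functions and passed to the limit; no Laplacian is evaluated. The delicate point is
  that \<open>h\<close> is weakly harmonic. A change of variables moves the average onto the test
  function, but the resulting potential is not smooth at the origin, and smooth approximations of a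
  function with trace zero need not vanish on the sphere. Orthogonality is therefore obtained
  through an estimate: the pairing of \<nabla>h with \<nabla>\<psi> is bounded by the boundary norm
  of \<psi> alone. The form of \<Lambda>_0 is carried along unevaluated, since it is the same for
  all three potentials.\<close>

definition L2_norm :: "'a measure \<Rightarrow> ('a \<Rightarrow> 'b::real_normed_vector) \<Rightarrow> real" where
  "L2_norm M f = sqrt (\<integral>x. (norm (f x))\<^sup>2 \<partial>M)"

text \<open>Membership in \<open>L2\<close> is part of the notion because the Bochner integral of a
  non-integrable function is 0 by default, so a small \<open>L2_norm\<close> alone says
  nothing.\<close>

definition L2_tendsto ::
    "'a measure \<Rightarrow> (nat \<Rightarrow> 'a \<Rightarrow> 'b::real_normed_vector) \<Rightarrow> ('a \<Rightarrow> 'b) \<Rightarrow> bool" where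
  "L2_tendsto M F f \<longleftrightarrow>
     (\<forall>k. F k \<in> L2 M) \<and> f \<in> L2 M \<and> (\<lambda>k. L2_norm M (\<lambda>x. F k x - f x)) \<longlonglongrightarrow> 0"

lemma L2_measurable: "f \<in> L2 M \<Longrightarrow> f \<in> borel_measurable M"
  by (simp add: L2_def)

lemma L2_integrable: "f \<in> L2 M \<Longrightarrow> integrable M (\<lambda>x. (norm (f x))\<^sup>2)"
  by (simp add: L2_def)

lemma L2_norm_nonneg [simp]: "0 \<le> L2_norm M f"
  by (simp add: L2_norm_def)

lemma L2_norm_power2: "(L2_norm M f)\<^sup>2 = (\<integral>x. (norm (f x))\<^sup>2 \<partial>M)"
  by (simp add: L2_norm_def)

lemma L2_dominated:
  fixes f :: "'a \<Rightarrow> 'b::euclidean_space" and g :: "'a \<Rightarrow> 'c::euclidean_space"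
  assumes "f \<in> L2 M" "g \<in> borel_measurable M" "\<And>x. x \<in> space M \<Longrightarrow> norm (g x) \<le> C * norm (f x)"
  shows "g \<in> L2 M"
proof -
  have "integrable M (\<lambda>x. (norm (g x))\<^sup>2)"
  proof (rule Bochner_Integration.integrable_bound)
    show "integrable M (\<lambda>x. C\<^sup>2 * (norm (f x))\<^sup>2)"
      using L2_integrable[OF assms(1)] by simp
    show "(\<lambda>x. (norm (g x))\<^sup>2) \<in> borel_measurable M"
      using assms(2) by measurable
    have "(norm (g x))\<^sup>2 \<le> C\<^sup>2 * (norm (f x))\<^sup>2" if "x \<in> space M" for x
      using power_mono[OF assms(3)[OF that], of 2] by (simp add: power_mult_distrib)
    then show "AE x in M. norm ((norm (g x))\<^sup>2) \<le> norm (C\<^sup>2 * (norm (f x))\<^sup>2)"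
      by (auto simp: abs_mult)
  qed
  with assms(2) show ?thesis by (simp add: L2_def)
qed

lemma L2_integrable_norm_mult:
  fixes f :: "'a \<Rightarrow> 'b::euclidean_space" and g :: "'a \<Rightarrow> 'c::euclidean_space"
  assumes "f \<in> L2 M" "g \<in> L2 M"
  shows "integrable M (\<lambda>x. norm (f x) * norm (g x))"
proof (rule Bochner_Integration.integrable_bound)
  show "integrable M (\<lambda>x. (norm (f x))\<^sup>2 + (norm (g x))\<^sup>2)"
    using L2_integrable[OF assms(1)] L2_integrable[OF assms(2)] by simp
  show "(\<lambda>x. norm (f x) * norm (g x)) \<in> borel_measurable M"
    using assms[THEN L2_measurable] by measurable
  have "a * b \<le> a\<^sup>2 + b\<^sup>2" if "0 \<le> a" "0 \<le> b" for a b :: real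
    using sum_squares_bound[of a b] that mult_nonneg_nonneg[OF that] by linarith
  then show "AE x in M. norm (norm (f x) * norm (g x)) \<le> norm ((norm (f x))\<^sup>2 + (norm (g x))\<^sup>2)"
    by (auto simp: abs_mult)
qed

lemma L2_integrable_inner:
  fixes f g :: "'a \<Rightarrow> 'b::euclidean_space"
  assumes "f \<in> L2 M" "g \<in> L2 M"
  shows "integrable M (\<lambda>x. f x \<bullet> g x)"
proof (rule Bochner_Integration.integrable_bound[OF L2_integrable_norm_mult[OF assms]])
  show "(\<lambda>x. f x \<bullet> g x) \<in> borel_measurable M"
    using assms[THEN L2_measurable] by measurable
qed (auto simp: Cauchy_Schwarz_ineq2)

lemma L2_integrable_mult:
  fixes f g :: "'a \<Rightarrow> real"
  assumes "f \<in> L2 M" "g \<in> L2 M"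
  shows "integrable M (\<lambda>x. f x * g x)"
  using L2_integrable_inner[OF assms] by simp

lemma L2_add:
  fixes f g :: "'a \<Rightarrow> 'b::euclidean_space"
  assumes "f \<in> L2 M" "g \<in> L2 M"
  shows "(\<lambda>x. f x + g x) \<in> L2 M"
proof -
  have [measurable]: "f \<in> borel_measurable M" "g \<in> borel_measurable M"
    using assms[THEN L2_measurable] by auto
  have "integrable M (\<lambda>x. (norm (f x + g x))\<^sup>2)"
    using L2_integrable[OF assms(1)] L2_integrable[OF assms(2)] L2_integrable_inner[OF assms]
    by (simp add: power2_norm_eq_inner inner_add_left inner_add_right inner_commute)
  then show ?thesis by (simp add: L2_def)
qed

lemma L2_scaleR:
  fixes f :: "'a \<Rightarrow> 'b::euclidean_space"
  assumes "f \<in> L2 M"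
  shows "(\<lambda>x. c *\<^sub>R f x) \<in> L2 M"
  using L2_measurable[OF assms] by (intro L2_dominated[OF assms, of _ "\<bar>c\<bar>"]) auto

lemma L2_diff:
  fixes f g :: "'a \<Rightarrow> 'b::euclidean_space"
  assumes "f \<in> L2 M" "g \<in> L2 M"
  shows "(\<lambda>x. f x - g x) \<in> L2 M"
  using L2_add[OF assms(1) L2_scaleR[OF assms(2), of "-1"]] by simp

lemma L2_bounded:
  fixes f :: "'a \<Rightarrow> 'b::euclidean_space"
  assumes "finite_measure M" "f \<in> borel_measurable M" "\<And>x. x \<in> space M \<Longrightarrow> norm (f x) \<le> C"
  shows "f \<in> L2 M"
proof -
  interpret finite_measure M by fact
  have "(\<lambda>x. 1::real) \<in> L2 M" by (simp add: L2_def)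
  then show ?thesis by (rule L2_dominated[where C=C]) (use assms in auto)
qed

text \<open>Integrating \<open>(s |f| - t |g|)^2\<close> gives a nonnegative quadratic form in
  \<open>s\<close> and \<open>t\<close>, whose discriminant cannot be positive. Only norms enter, so
  \<open>f\<close> and \<open>g\<close> may take values in different spaces.\<close>

lemma Cauchy_Schwarz_L2:
  fixes f :: "'a \<Rightarrow> 'b::euclidean_space" and g :: "'a \<Rightarrow> 'c::euclidean_space"
  assumes "f \<in> L2 M" "g \<in> L2 M"
  shows "(\<integral>x. norm (f x) * norm (g x) \<partial>M) \<le> L2_norm M f * L2_norm M g"
proof -
  define a b c where "a = (\<integral>x. (norm (f x))\<^sup>2 \<partial>M)" and "b = (\<integral>x. (norm (g x))\<^sup>2 \<partial>M)"
    and "c = (\<integral>x. norm (f x) * norm (g x) \<partial>M)"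
  note int = L2_integrable[OF assms(1)] L2_integrable[OF assms(2)] L2_integrable_norm_mult[OF assms]
  have quad: "0 \<le> s\<^sup>2 * a - 2 * (s * t) * c + t\<^sup>2 * b" for s t
  proof -
    have "s\<^sup>2 * a - 2 * (s * t) * c + t\<^sup>2 * b = (\<integral>x. s\<^sup>2 * (norm (f x))\<^sup>2
        - 2 * (s * t) * (norm (f x) * norm (g x)) + t\<^sup>2 * (norm (g x))\<^sup>2 \<partial>M)"
      using int by (simp add: a_def b_def c_def)
    also have "\<dots> = (\<integral>x. (s * norm (f x) - t * norm (g x))\<^sup>2 \<partial>M)"
      by (rule Bochner_Integration.integral_cong) (auto simp: power2_eq_square algebra_simps)
    also have "\<dots> \<ge> 0" by simp
    finally show ?thesis .
  qed
  have nn: "0 \<le> a" "0 \<le> b" "0 \<le> c" by (auto simp: a_def b_def c_def)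
  have "c\<^sup>2 \<le> a * b"
  proof (cases "b = 0")
    case True
    have "c = 0"
    proof (rule ccontr)
      assume "c \<noteq> 0"
      with nn have "c > 0" by simp
      \<comment> \<open>For \<open>b = 0\<close> the form is affine in \<open>t\<close>; this choice
        of \<open>t\<close> gives it the value -1.\<close>
      have "0 \<le> a - 2 * ((a+1)/(2*c)) * c" using quad[of 1 "(a+1)/(2*c)"] True by simp
      then show False using \<open>c > 0\<close> by (simp add: field_simps)
    qed
    then show ?thesis using True by simp
  next
    case False
    then have "b > 0" using nn by simp
    \<comment> \<open>For \<open>s = b\<close> the minimum over \<open>t\<close> is attained at
      \<open>t = c\<close>.\<close>
    have "0 \<le> b * (a * b - c\<^sup>2)" using quad[of b c] by (simp add: power2_eq_square algebra_simps)
    then show ?thesis using \<open>b > 0\<close> by (simp add: zero_le_mult_iff)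
  qed
  then have "c \<le> sqrt (a * b)" by (rule real_le_rsqrt)
  then show ?thesis unfolding real_sqrt_mult L2_norm_def a_def b_def c_def .
qed

lemma L2_inner_bound:
  fixes f g :: "'a \<Rightarrow> 'b::euclidean_space"
  assumes "f \<in> L2 M" "g \<in> L2 M"
  shows "\<bar>\<integral>x. f x \<bullet> g x \<partial>M\<bar> \<le> L2_norm M f * L2_norm M g"
proof -
  have "\<bar>\<integral>x. f x \<bullet> g x \<partial>M\<bar> \<le> (\<integral>x. \<bar>f x \<bullet> g x\<bar> \<partial>M)"
    by (rule integral_abs_bound)
  also have "\<dots> \<le> (\<integral>x. norm (f x) * norm (g x) \<partial>M)"
    using L2_integrable_inner[OF assms] L2_integrable_norm_mult[OF assms]
    by (intro integral_mono) (auto simp: Cauchy_Schwarz_ineq2)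
  also note Cauchy_Schwarz_L2[OF assms]
  finally show ?thesis .
qed

lemma L2_norm_cong: "(\<And>x. x \<in> space M \<Longrightarrow> norm (f x) = norm (g x)) \<Longrightarrow> L2_norm M f = L2_norm M g"
  unfolding L2_norm_def by (simp cong: Bochner_Integration.integral_cong)

lemma L2_norm_mono:
  fixes f :: "'a \<Rightarrow> 'b::euclidean_space" and g :: "'a \<Rightarrow> 'c::euclidean_space"
  assumes "f \<in> L2 M" "g \<in> L2 M" "\<And>x. x \<in> space M \<Longrightarrow> norm (g x) \<le> C * norm (f x)" "0 \<le> C"
  shows "L2_norm M g \<le> C * L2_norm M f"
proof -
  have "(\<integral>x. (norm (g x))\<^sup>2 \<partial>M) \<le> (\<integral>x. C\<^sup>2 * (norm (f x))\<^sup>2 \<partial>M)"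
  proof (intro integral_mono)
    show "(norm (g x))\<^sup>2 \<le> C\<^sup>2 * (norm (f x))\<^sup>2" if "x \<in> space M" for x
      using power_mono[OF assms(3)[OF that], of 2] by (simp add: power_mult_distrib)
  qed (use assms(1,2)[THEN L2_integrable] in auto)
  then have "L2_norm M g \<le> sqrt (C\<^sup>2 * (\<integral>x. (norm (f x))\<^sup>2 \<partial>M))"
    unfolding L2_norm_def by simp
  also have "\<dots> = C * L2_norm M f" using assms(4) by (simp add: L2_norm_def real_sqrt_mult)
  finally show ?thesis .
qed

lemma L2_norm_triangle:
  fixes f g :: "'a \<Rightarrow> 'b::euclidean_space"
  assumes "f \<in> L2 M" "g \<in> L2 M"
  shows "L2_norm M (\<lambda>x. f x + g x) \<le> L2_norm M f + L2_norm M g"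
proof (rule power2_le_imp_le)
  note int = L2_integrable[OF assms(1)] L2_integrable[OF assms(2)] L2_integrable_norm_mult[OF assms]
  have "(L2_norm M (\<lambda>x. f x + g x))\<^sup>2
      \<le> (\<integral>x. (norm (f x))\<^sup>2 + 2 * (norm (f x) * norm (g x)) + (norm (g x))\<^sup>2 \<partial>M)"
    unfolding L2_norm_power2
  proof (intro integral_mono)
    show "(norm (f x + g x))\<^sup>2 \<le> (norm (f x))\<^sup>2 + 2 * (norm (f x) * norm (g x)) + (norm (g x))\<^sup>2" for x
      using power_mono[OF norm_triangle_ineq[of "f x" "g x"], of 2] by (simp add: power2_sum)
  qed (use int L2_integrable[OF L2_add[OF assms]] in auto)
  also have "\<dots> = (L2_norm M f)\<^sup>2 + 2 * (\<integral>x. norm (f x) * norm (g x) \<partial>M) + (L2_norm M g)\<^sup>2"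
    using int by (simp add: L2_norm_power2)
  also have "\<dots> \<le> (L2_norm M f + L2_norm M g)\<^sup>2"
    using Cauchy_Schwarz_L2[OF assms] by (simp add: power2_sum)
  finally show "(L2_norm M (\<lambda>x. f x + g x))\<^sup>2 \<le> (L2_norm M f + L2_norm M g)\<^sup>2" .
qed simp

lemma L2_norm_triangle_diff:
  fixes f g h :: "'a \<Rightarrow> 'b::euclidean_space"
  assumes "f \<in> L2 M" "g \<in> L2 M" "h \<in> L2 M"
  shows "L2_norm M (\<lambda>x. f x - h x) \<le> L2_norm M (\<lambda>x. f x - g x) + L2_norm M (\<lambda>x. g x - h x)"
  using L2_norm_triangle[OF L2_diff[OF assms(1,2)] L2_diff[OF assms(2,3)]] by simp

lemma L2_norm_minus_commute:
  "L2_norm M (\<lambda>x. f x - g x) = L2_norm M (\<lambda>x. g x - f x)"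
  by (rule L2_norm_cong) (simp add: norm_minus_commute)

lemma L2_tendsto_L2: "L2_tendsto M F f \<Longrightarrow> F k \<in> L2 M" "L2_tendsto M F f \<Longrightarrow> f \<in> L2 M"
  by (auto simp: L2_tendsto_def)

lemma L2_tendstoI:
  assumes "\<And>k. F k \<in> L2 M" "f \<in> L2 M" "\<And>k. L2_norm M (\<lambda>x. F k x - f x) \<le> e k" "e \<longlonglongrightarrow> 0"
  shows "L2_tendsto M F f"
proof -
  have "(\<lambda>k. L2_norm M (\<lambda>x. F k x - f x)) \<longlonglongrightarrow> 0"
    by (rule tendsto_sandwich[OF _ _ tendsto_const assms(4)]) (use assms(3) in auto)
  with assms(1,2) show ?thesis by (simp add: L2_tendsto_def)
qed

lemma L2_tendsto_const: "f \<in> L2 M \<Longrightarrow> L2_tendsto M (\<lambda>_. f) f"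
  by (simp add: L2_tendsto_def L2_norm_def)

lemma L2_tendsto_add:
  fixes f g :: "'a \<Rightarrow> 'b::euclidean_space"
  assumes F: "L2_tendsto M F f" and G: "L2_tendsto M G g"
  shows "L2_tendsto M (\<lambda>k x. F k x + G k x) (\<lambda>x. f x + g x)"
proof (rule L2_tendstoI)
  fix k
  have "L2_norm M (\<lambda>x. (F k x + G k x) - (f x + g x)) = L2_norm M (\<lambda>x. (F k x - f x) + (G k x - g x))"
    by (rule L2_norm_cong) (simp add: algebra_simps)
  also have "\<dots> \<le> L2_norm M (\<lambda>x. F k x - f x) + L2_norm M (\<lambda>x. G k x - g x)"
    by (intro L2_norm_triangle L2_diff L2_tendsto_L2[OF F] L2_tendsto_L2[OF G])
  finally show "L2_norm M (\<lambda>x. (F k x + G k x) - (f x + g x))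
      \<le> L2_norm M (\<lambda>x. F k x - f x) + L2_norm M (\<lambda>x. G k x - g x)" .
  show "(\<lambda>k. L2_norm M (\<lambda>x. F k x - f x) + L2_norm M (\<lambda>x. G k x - g x)) \<longlonglongrightarrow> 0"
    using F G by (intro tendsto_add_zero) (simp_all add: L2_tendsto_def)
qed (intro L2_add L2_tendsto_L2[OF F] L2_tendsto_L2[OF G])+

text \<open>The source of the later limit rules for bounded scalar and vector coefficients: an
  operation that is pointwise Lipschitz, with one constant for all points, preserves L2
  limits.\<close>

lemma L2_tendsto_dominated:
  fixes f :: "'a \<Rightarrow> 'b::euclidean_space" and g :: "'a \<Rightarrow> 'c::euclidean_space"
  assumes F: "L2_tendsto M F f" and "\<And>k. G k \<in> borel_measurable M" "g \<in> L2 M" "0 \<le> C"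
    and bd: "\<And>k x. x \<in> space M \<Longrightarrow> norm (G k x - g x) \<le> C * norm (F k x - f x)"
  shows "L2_tendsto M G g"
proof -
  have d: "(\<lambda>x. G k x - g x) \<in> L2 M" for k
    using assms(2) L2_measurable[OF assms(3)] bd
    by (intro L2_dominated[OF L2_diff[OF L2_tendsto_L2[OF F]], where C=C]) auto
  show ?thesis
  proof (rule L2_tendstoI)
    show "G k \<in> L2 M" for k
      using L2_add[OF d assms(3)] by simp
    show "L2_norm M (\<lambda>x. G k x - g x) \<le> C * L2_norm M (\<lambda>x. F k x - f x)" for k
      using bd \<open>0 \<le> C\<close> by (intro L2_norm_mono L2_diff[OF L2_tendsto_L2[OF F]] d)
    show "(\<lambda>k. C * L2_norm M (\<lambda>x. F k x - f x)) \<longlonglongrightarrow> 0"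
      using tendsto_mult_right_zero F by (auto simp: L2_tendsto_def)
  qed fact
qed

lemma L2_tendsto_scaleR:
  fixes f :: "'a \<Rightarrow> 'b::euclidean_space"
  assumes "L2_tendsto M F f"
  shows "L2_tendsto M (\<lambda>k x. c *\<^sub>R F k x) (\<lambda>x. c *\<^sub>R f x)"
  using L2_measurable[OF L2_tendsto_L2(1)[OF assms]]
  by (intro L2_tendsto_dominated[OF assms, where C="\<bar>c\<bar>"] L2_scaleR L2_tendsto_L2[OF assms])
    (auto simp flip: scaleR_diff_right)

lemma L2_tendsto_norm:
  fixes f :: "'a \<Rightarrow> 'b::euclidean_space"
  assumes F: "L2_tendsto M F f"
  shows "(\<lambda>k. L2_norm M (F k)) \<longlonglongrightarrow> L2_norm M f"
proof -
  have "\<bar>L2_norm M (F k) - L2_norm M f\<bar> \<le> L2_norm M (\<lambda>x. F k x - f x)" for k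
  proof -
    have "L2_norm M (F k) \<le> L2_norm M (\<lambda>x. F k x - f x) + L2_norm M f"
      using L2_norm_triangle[OF L2_diff[OF L2_tendsto_L2[OF F]] L2_tendsto_L2(2)[OF F]] by simp
    moreover have "L2_norm M f \<le> L2_norm M (\<lambda>x. f x - F k x) + L2_norm M (F k)"
      using L2_norm_triangle[OF L2_diff[OF L2_tendsto_L2(2)[OF F] L2_tendsto_L2(1)[OF F]]
          L2_tendsto_L2(1)[OF F], of k k] by simp
    ultimately show ?thesis using L2_norm_minus_commute[of M f "F k"] by linarith
  qed
  then have "\<forall>\<^sub>F k in sequentially. norm (L2_norm M (F k) - L2_norm M f) \<le> L2_norm M (\<lambda>x. F k x - f x)"
    by simp
  moreover have "(\<lambda>k. L2_norm M (\<lambda>x. F k x - f x)) \<longlonglongrightarrow> 0"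
    using F by (simp add: L2_tendsto_def)
  ultimately have "(\<lambda>k. L2_norm M (F k) - L2_norm M f) \<longlonglongrightarrow> 0"
    by (rule Lim_null_comparison)
  then show ?thesis by (rule LIM_zero_cancel)
qed

text \<open>Split the difference as \<open>(F - f) . G + f . (G - g)\<close> and apply
  Cauchy-Schwarz to both parts; the norms of \<open>G k\<close> stay bounded because they
  converge.\<close>

lemma L2_tendsto_inner:
  fixes f g :: "'a \<Rightarrow> 'b::euclidean_space"
  assumes F: "L2_tendsto M F f" and G: "L2_tendsto M G g"
  shows "(\<lambda>k. \<integral>x. F k x \<bullet> G k x \<partial>M) \<longlonglongrightarrow> (\<integral>x. f x \<bullet> g x \<partial>M)"
proof (rule LIM_zero_cancel, rule Lim_null_comparison)
  note L = L2_tendsto_L2[OF F] L2_tendsto_L2[OF G]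
  let ?e = "\<lambda>k. L2_norm M (\<lambda>x. F k x - f x) * L2_norm M (G k)
    + L2_norm M f * L2_norm M (\<lambda>x. G k x - g x)"
  show "\<forall>\<^sub>F k in sequentially. norm ((\<integral>x. F k x \<bullet> G k x \<partial>M) - (\<integral>x. f x \<bullet> g x \<partial>M)) \<le> ?e k"
  proof (intro always_eventually allI)
    fix k
    have "(\<integral>x. F k x \<bullet> G k x \<partial>M) - (\<integral>x. f x \<bullet> g x \<partial>M)
        = (\<integral>x. (F k x - f x) \<bullet> G k x \<partial>M) + (\<integral>x. f x \<bullet> (G k x - g x) \<partial>M)"
      using L2_integrable_inner[OF L(1) L(3), of k k] L2_integrable_inner[OF L(2) L(4)]
        L2_integrable_inner[OF L(2) L(3), of k]
      by (simp add: inner_diff_left inner_diff_right)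
    then show "norm ((\<integral>x. F k x \<bullet> G k x \<partial>M) - (\<integral>x. f x \<bullet> g x \<partial>M)) \<le> ?e k"
      using L2_inner_bound[OF L2_diff[OF L(1,2)] L(3), of k k]
        L2_inner_bound[OF L(2) L2_diff[OF L(3,4)], of k] by simp
  qed
  have "?e \<longlonglongrightarrow> 0 * L2_norm M g + L2_norm M f * 0"
    using F G by (intro tendsto_intros L2_tendsto_norm[OF G]) (auto simp: L2_tendsto_def)
  then show "?e \<longlonglongrightarrow> 0" by simp
qed

lemma L2_norm_eq_0_AE:
  fixes f :: "'a \<Rightarrow> 'b::euclidean_space"
  assumes "f \<in> L2 M" "L2_norm M f = 0"
  shows "AE x in M. f x = 0"
proof -
  have "(\<integral>x. (norm (f x))\<^sup>2 \<partial>M) = 0" using assms(2) by (simp add: L2_norm_def)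
  then show ?thesis
    using integral_nonneg_eq_0_iff_AE[OF L2_integrable[OF assms(1)]] by simp
qed

lemma L2_tendsto_unique:
  fixes f :: "'a \<Rightarrow> 'b::euclidean_space"
  assumes F: "L2_tendsto M F f" and G: "L2_tendsto M F g"
  shows "AE x in M. f x = g x"
proof -
  have "L2_tendsto M (\<lambda>k x. F k x + (-1) *\<^sub>R F k x) (\<lambda>x. f x + (-1) *\<^sub>R g x)"
    by (intro L2_tendsto_add L2_tendsto_scaleR F G)
  from L2_tendsto_norm[OF this] have "(\<lambda>k. 0) \<longlonglongrightarrow> L2_norm M (\<lambda>x. f x - g x)"
    by (simp add: L2_norm_def)
  then have "L2_norm M (\<lambda>x. f x - g x) = 0"
    by (simp add: LIMSEQ_const_iff)
  from L2_norm_eq_0_AE[OF L2_diff[OF L2_tendsto_L2(2)[OF F] L2_tendsto_L2(2)[OF G]] this]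
  show ?thesis by simp
qed

lemma L2_tendsto_cong_AE:
  fixes f :: "'a \<Rightarrow> 'b::euclidean_space"
  assumes F: "L2_tendsto M F f" and "AE x in M. f x = g x" "g \<in> borel_measurable M"
  shows "L2_tendsto M F g"
proof -
  have f: "f \<in> borel_measurable M" "\<And>k. F k \<in> borel_measurable M"
    using L2_tendsto_L2[OF F] by (auto intro: L2_measurable)
  have "integrable M (\<lambda>x. (norm (g x))\<^sup>2)"
    by (rule integrable_cong_AE_imp[OF L2_integrable[OF L2_tendsto_L2(2)[OF F]]])
      (use assms(2,3) in \<open>auto intro: borel_measurable_power\<close>)
  moreover have "L2_norm M (\<lambda>x. F k x - g x) = L2_norm M (\<lambda>x. F k x - f x)" for k
  proof -
    have "(\<integral>x. (norm (F k x - g x))\<^sup>2 \<partial>M) = (\<integral>x. (norm (F k x - f x))\<^sup>2 \<partial>M)"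
      using f assms(2,3) by (intro integral_cong_AE) auto
    then show ?thesis by (simp add: L2_norm_def)
  qed
  ultimately show ?thesis
    using F assms(3) by (simp add: L2_tendsto_def L2_def)
qed

text \<open>Riesz-Fischer for Euclidean values: a rapidly converging subsequence converges almost
  everywhere, and Fatou's lemma carries the Cauchy estimate over to the limit for the whole
  sequence.\<close>

lemma L2_complete:
  fixes F :: "nat \<Rightarrow> 'a \<Rightarrow> 'b::euclidean_space"
  assumes L: "\<And>k. F k \<in> L2 M"
    and Cauchy: "\<And>e. 0 < e \<Longrightarrow> \<exists>N. \<forall>m\<ge>N. \<forall>n\<ge>N. L2_norm M (\<lambda>x. F m x - F n x) < e"
  shows "\<exists>f. L2_tendsto M F f"
proof -
  have [measurable]: "F k \<in> borel_measurable M" for k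
    using L by (rule L2_measurable)
  define E where "E m n = (\<integral>x. (norm (F m x - F n x))\<^sup>2 \<partial>M)" for m n
  have E: "\<exists>N. \<forall>m\<ge>N. \<forall>n\<ge>N. E m n < e" if "0 < e" for e
    using Cauchy[of "sqrt e"] that by (simp add: L2_norm_def E_def)
  have nn: "(\<integral>\<^sup>+x. ennreal ((norm (F m x - F n x))\<^sup>2) \<partial>M) = ennreal (E m n)" for m n
    unfolding E_def using L2_integrable[OF L2_diff[OF L L, of m n]] by (simp add: nn_integral_eq_integral)
  \<comment> \<open>\<open>E\<close> is a squared distance. The rate 1/8 still leaves a factor 1/2
    after the weight \<open>4^k\<close> that the increments receive below.\<close>
  obtain N where N: "\<And>k m n. m \<ge> N k \<Longrightarrow> n \<ge> N k \<Longrightarrow> E m n < (1/8)^k"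
    using E[of "(1/8)^_"] by (metis zero_less_divide_1_iff zero_less_numeral zero_less_power)
  \<comment> \<open>The sum makes \<open>r k\<close> at least \<open>N j\<close> for every
    \<open>j \<le> k\<close>; the summand \<open>k\<close> makes it at least \<open>k\<close>, so
    that the subsequence eventually passes any threshold.\<close>
  define r where "r k = (\<Sum>i\<le>k. N i) + k" for k
  have rN: "N k \<le> r j" if "k \<le> j" for k j
    using that member_le_sum[of k "{..j}" N] by (simp add: r_def)
  have small: "E (r (Suc k)) (r k) < (1/8)^k" for k
    by (rule N) (auto intro: rN)
  define D where "D k x = norm (F (r (Suc k)) x - F (r k) x)" for k x
  have [measurable]: "D k \<in> borel_measurable M" for k unfolding D_def by measurable
  have "(\<integral>\<^sup>+x. (\<Sum>k. ennreal (4^k * (D k x)\<^sup>2)) \<partial>M) = (\<Sum>k. \<integral>\<^sup>+x. ennreal (4^k * (D k x)\<^sup>2) \<partial>M)"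
    by (rule nn_integral_suminf) measurable
  also have "\<dots> \<le> (\<Sum>k. ennreal ((1/2)^k))"
  proof (intro suminf_le)
    fix k
    have "(\<integral>\<^sup>+x. ennreal (4^k * (D k x)\<^sup>2) \<partial>M) = ennreal (4^k * E (r (Suc k)) (r k))"
      unfolding D_def by (simp add: ennreal_mult nn_integral_cmult nn E_def)
    also have "4^k * E (r (Suc k)) (r k) \<le> 4^k * (1/8)^k"
      using small[of k] by simp
    also have "\<dots> = (1/2)^k" by (simp flip: power_mult_distrib)
    finally show "(\<integral>\<^sup>+x. ennreal (4^k * (D k x)\<^sup>2) \<partial>M) \<le> ennreal ((1/2)^k)"
      by (simp add: ennreal_leI)
  qed auto
  also have "\<dots> < \<infinity>"
    using suminf_ennreal_eq[of "\<lambda>k. (1/2::real)^k" 2] power_half_series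
      sums_mult[OF power_half_series, of 2] by (simp add: ennreal_suminf_neq_top less_top summable_geometric)
  finally have "AE x in M. (\<Sum>k. ennreal (4^k * (D k x)\<^sup>2)) \<noteq> \<infinity>"
    by (intro nn_integral_noteq_infinite) auto
  then have conv: "AE x in M. convergent (\<lambda>k. F (r k) x)"
  proof eventually_elim
    case (elim x)
    \<comment> \<open>Finiteness of the weighted sum bounds its terms by some \<open>C\<close>, so
      the increments are at most \<open>sqrt C / 2^k\<close> and therefore summable.\<close>
    have summ: "summable (\<lambda>k. 4^k * (D k x)\<^sup>2)"
      using elim by (intro summable_suminf_not_top) auto
    then obtain C where C: "\<And>k. norm (4^k * (D k x)\<^sup>2) \<le> C"
      using summable_imp_Bseq[OF summ] by (auto simp: Bseq_def)
    have "D k x \<le> sqrt C * (1/2)^k" for k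
    proof (rule power2_le_imp_le)
      have "4 ^ k * (D k x)\<^sup>2 \<le> C" using C[of k] by simp
      moreover have C0: "0 \<le> C" using order_trans[OF norm_ge_zero C[of 0]] .
      moreover have p4: "(((1/2)^k)\<^sup>2 :: real) = 1 / 4^k"
      proof -
        have "((1/2 :: real)^k)\<^sup>2 = (1/2)^(k*2)" by (rule power_mult [symmetric])
        also have "\<dots> = ((1/2)\<^sup>2)^k" by (subst mult.commute) (rule power_mult)
        finally show ?thesis by (simp add: power_divide)
      qed
      ultimately show "(D k x)\<^sup>2 \<le> (sqrt C * (1/2)^k)\<^sup>2"
        unfolding power_mult_distrib p4 real_sqrt_pow2[OF C0]
        by (simp add: pos_le_divide_eq mult.commute)
      show "0 \<le> sqrt C * (1/2)^k" using C0 by simp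
    qed
    moreover have "summable (\<lambda>k. sqrt C * (1/2::real)^k)"
      by (intro summable_mult summable_geometric) simp
    ultimately have "summable (\<lambda>k. F (r (Suc k)) x - F (r k) x)"
      unfolding D_def by (metis (lifting) summable_comparison_test')
    then have "convergent (\<lambda>n. \<Sum>k<n. F (r (Suc k)) x - F (r k) x)"
      by (simp add: summable_iff_convergent)
    then have "convergent (\<lambda>n. F (r n) x - F (r 0) x)"
      unfolding sum_lessThan_telescope[of "\<lambda>n. F (r n) x"] .
    from convergent_add[OF this convergent_const[of "F (r 0) x"]] show ?case by simp
  qed
  define f where "f x = lim (\<lambda>k. F (r k) x)" for x
  have f[measurable]: "f \<in> borel_measurable M" unfolding f_def by measurable
  have lim: "AE x in M. (\<lambda>k. F (r k) x) \<longlonglongrightarrow> f x"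
    using conv by eventually_elim (simp add: f_def convergent_LIMSEQ_iff)
  \<comment> \<open>Fatou along the subsequence: an estimate of \<open>F n\<close> against all later
    terms survives when these are replaced by the limit.\<close>
  have bound: "(\<integral>\<^sup>+x. ennreal ((norm (F n x - f x))\<^sup>2) \<partial>M) \<le> ennreal e"
    if "0 < e" "\<And>m. m \<ge> K \<Longrightarrow> E n m < e" for n e K
  proof -
    have "(\<integral>\<^sup>+x. ennreal ((norm (F n x - f x))\<^sup>2) \<partial>M)
        = (\<integral>\<^sup>+x. liminf (\<lambda>k. ennreal ((norm (F n x - F (r k) x))\<^sup>2)) \<partial>M)"
    proof (rule nn_integral_cong_AE)
      show "AE x in M. ennreal ((norm (F n x - f x))\<^sup>2)
          = liminf (\<lambda>k. ennreal ((norm (F n x - F (r k) x))\<^sup>2))"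
        using lim
      proof eventually_elim
        case (elim x)
        have "(\<lambda>k. ennreal ((norm (F n x - F (r k) x))\<^sup>2)) \<longlonglongrightarrow> ennreal ((norm (F n x - f x))\<^sup>2)"
          by (intro tendsto_intros tendsto_ennrealI elim)
        then show ?case by (rule lim_imp_Liminf[symmetric, OF sequentially_bot])
      qed
    qed
    also have "\<dots> \<le> liminf (\<lambda>k. \<integral>\<^sup>+x. ennreal ((norm (F n x - F (r k) x))\<^sup>2) \<partial>M)"
      by (rule nn_integral_liminf) measurable
    also have "\<dots> \<le> liminf (\<lambda>k. ennreal e)"
    proof (rule Liminf_mono, rule eventually_sequentiallyI[of K])
      fix k assume "K \<le> k"
      then have "K \<le> r k" by (simp add: r_def)
      then show "(\<integral>\<^sup>+x. ennreal ((norm (F n x - F (r k) x))\<^sup>2) \<partial>M) \<le> ennreal e"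
        unfolding nn using that(2)[of "r k"] by (simp add: ennreal_leI)
    qed
    also have "\<dots> = ennreal e" by (simp add: Liminf_const)
    finally show ?thesis .
  qed
  have diffL: "(\<lambda>x. F n x - f x) \<in> L2 M"
    if "0 < e" "\<And>m. m \<ge> K \<Longrightarrow> E n m < e" for n e K
  proof -
    have "(\<integral>\<^sup>+x. ennreal ((norm (F n x - f x))\<^sup>2) \<partial>M) < \<infinity>"
      using le_less_trans[OF bound[of e K, OF that] ennreal_less_top] by simp
    then show ?thesis unfolding L2_def by (simp add: integrable_iff_bounded)
  qed
  obtain K where K: "\<forall>m\<ge>K. \<forall>n\<ge>K. E m n < 1" using E[of 1] by auto
  have fL: "f \<in> L2 M"
    using L2_diff[OF L[of K] diffL[of 1 K K]] K by simp
  have "(\<lambda>k. L2_norm M (\<lambda>x. F k x - f x)) \<longlonglongrightarrow> 0"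
  proof (rule LIMSEQ_I)
    fix e :: real assume "0 < e"
    then obtain K where K: "\<forall>m\<ge>K. \<forall>n\<ge>K. E m n < (e/2)\<^sup>2" using E[of "(e/2)\<^sup>2"] by auto
    have "norm (L2_norm M (\<lambda>x. F k x - f x) - 0) < e" if "k \<ge> K" for k
    proof -
      have "(\<integral>\<^sup>+x. ennreal ((norm (F k x - f x))\<^sup>2) \<partial>M) \<le> ennreal ((e/2)\<^sup>2)"
        using \<open>0 < e\<close> K that by (intro bound[of _ K]) auto
      then have "(\<integral>x. (norm (F k x - f x))\<^sup>2 \<partial>M) \<le> (e/2)\<^sup>2"
        using L2_integrable[OF L2_diff[OF L fL, of k]] by (simp add: nn_integral_eq_integral)
      then have "L2_norm M (\<lambda>x. F k x - f x) \<le> e/2"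
        unfolding L2_norm_def using \<open>0 < e\<close> by (intro real_le_lsqrt) auto
      then show ?thesis using \<open>0 < e\<close> by simp
    qed
    then show "\<exists>K. \<forall>k\<ge>K. norm (L2_norm M (\<lambda>x. F k x - f x) - 0) < e" by blast
  qed
  then show ?thesis using L fL by (auto simp: L2_tendsto_def)
qed

section \<open>Differential calculus of globally smooth functions, and cut-offs built from
  exp(-1/s)\<close>

section \<open>Smooth functions\<close>

lemma grad_nth [simp]: "grad f x $ i = partial i f x"
  by (simp add: grad_def)

lemma grad_eqI: "(f has_derivative (\<lambda>d. d \<bullet> g)) (at x) \<Longrightarrow> grad f x = g"
  by (simp add: vec_eq_iff partial_def frechet_derivative_at [symmetric] inner_axis')

lemma differentiable_has_derivative_grad:
  fixes f :: "real^'n \<Rightarrow> real"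
  assumes "f differentiable (at x)"
  shows "(f has_derivative (\<lambda>d. d \<bullet> grad f x)) (at x)"
proof -
  let ?D = "frechet_derivative f (at x)"
  have D: "(f has_derivative ?D) (at x)" using assms by (simp add: frechet_derivative_works)
  then interpret linear ?D by (simp add: has_derivative_linear)
  have "?D d = d \<bullet> grad f x" for d
  proof -
    have "?D d = ?D (\<Sum>i\<in>UNIV. (d $ i) *s axis i 1)" by (simp only: basis_expansion)
    also have "\<dots> = (\<Sum>i\<in>UNIV. d $ i * ?D (axis i 1))"
      by (simp add: sum scalar_mult_eq_scaleR scale)
    finally show ?thesis by (simp add: inner_vec_def partial_def)
  qed
  then have "?D = (\<lambda>d. d \<bullet> grad f x)" by auto
  with D show ?thesis by simp
qed

text \<open>The induction step behind every closure property below: exhibit the gradient as an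
  expression of the same kind as \<open>f\<close>, so that the induction hypothesis applies to its
  components.\<close>

lemma k_times_SucI:
  assumes "\<And>x. (f has_derivative (\<lambda>d. d \<bullet> g x)) (at x)"
    and "\<And>i. k_times_differentiable k (\<lambda>x. g x $ i)"
  shows "k_times_differentiable (Suc k) f"
proof -
  have "partial i f = (\<lambda>x. g x $ i)" for i
    using grad_eqI[OF assms(1)] by (metis grad_nth)
  moreover have "f differentiable (at x)" for x
    using assms(1) by (rule differentiableI)
  ultimately show ?thesis using assms(2) by simp
qed

lemma k_times_Suc_has_derivative:
  "k_times_differentiable (Suc k) f \<Longrightarrow> (f has_derivative (\<lambda>d. d \<bullet> grad f x)) (at x)"
  by (simp add: differentiable_has_derivative_grad)

lemma k_times_SucD: "k_times_differentiable (Suc k) f \<Longrightarrow> k_times_differentiable k f"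
  by (induction k arbitrary: f) auto

lemma k_times_const: "k_times_differentiable k (\<lambda>_::real^'n. c)"
proof (induction k arbitrary: c)
  case (Suc k)
  show ?case by (rule k_times_SucI[where g="\<lambda>_. 0"]) (auto simp: Suc)
qed simp

lemma k_times_add:
  "k_times_differentiable k f \<Longrightarrow> k_times_differentiable k g \<Longrightarrow>
   k_times_differentiable k (\<lambda>x. f x + g x)"
proof (induction k arbitrary: f g)
  case (Suc k)
  show ?case
  proof (rule k_times_SucI[where g="\<lambda>x. grad f x + grad g x"])
    show "((\<lambda>x. f x + g x) has_derivative (\<lambda>d. d \<bullet> (grad f x + grad g x))) (at x)" for x
      using Suc.prems[THEN k_times_Suc_has_derivative, of x]
      by (auto intro!: derivative_eq_intros simp: inner_add_right)
    show "k_times_differentiable k (\<lambda>x. (grad f x + grad g x) $ i)" for i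
      using Suc by simp
  qed
qed simp

lemma k_times_mult:
  "k_times_differentiable k f \<Longrightarrow> k_times_differentiable k g \<Longrightarrow>
   k_times_differentiable k (\<lambda>x. f x * g x)"
proof (induction k arbitrary: f g)
  case (Suc k)
  show ?case
  proof (rule k_times_SucI[where g="\<lambda>x. f x *\<^sub>R grad g x + g x *\<^sub>R grad f x"])
    show "((\<lambda>x. f x * g x) has_derivative (\<lambda>d. d \<bullet> (f x *\<^sub>R grad g x + g x *\<^sub>R grad f x))) (at x)" for x
      using Suc.prems[THEN k_times_Suc_has_derivative, of x]
      by (auto intro!: derivative_eq_intros simp: inner_add_right)
    show "k_times_differentiable k (\<lambda>x. (f x *\<^sub>R grad g x + g x *\<^sub>R grad f x) $ i)" for i
      using Suc.prems Suc.prems[THEN k_times_SucD] by (simp, intro k_times_add Suc.IH) auto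
  qed
qed simp

lemma k_times_inverse:
  assumes "\<And>x. f x \<noteq> 0"
  shows "k_times_differentiable k f \<Longrightarrow> k_times_differentiable k (\<lambda>x. inverse (f x))"
proof (induction k)
  case (Suc k)
  have 1: "k_times_differentiable k (\<lambda>x. inverse (f x))"
    using Suc.IH k_times_SucD[OF Suc.prems] .
  show ?case
  proof (rule k_times_SucI[where g="\<lambda>x. (- 1 * (inverse (f x) * inverse (f x))) *\<^sub>R grad f x"])
    show "((\<lambda>x. inverse (f x)) has_derivative
        (\<lambda>d. d \<bullet> (- 1 * (inverse (f x) * inverse (f x))) *\<^sub>R grad f x)) (at x)" for x
      using Suc.prems[THEN k_times_Suc_has_derivative, of x] assms
      by (auto intro!: derivative_eq_intros)
    show "k_times_differentiable k (\<lambda>x. ((- 1 * (inverse (f x) * inverse (f x))) *\<^sub>R grad f x) $ i)" for i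
      unfolding vector_scaleR_component real_scaleR_def grad_nth
      using Suc.prems by (intro k_times_mult k_times_const 1) auto
  qed
qed simp

lemma k_times_component: "k_times_differentiable k (\<lambda>x::real^'n. x $ i)"
proof (cases k)
  case (Suc m)
  have "k_times_differentiable (Suc m) (\<lambda>x. x $ i)"
  proof (rule k_times_SucI[where g="\<lambda>_. axis i 1"])
    show "((\<lambda>x. x $ i) has_derivative (\<lambda>d. d \<bullet> axis i 1)) (at x)" for x :: "real^'n"
      by (auto simp: inner_axis intro!: derivative_eq_intros bounded_linear_imp_has_derivative
          bounded_linear_vec_nth)
  qed (simp add: k_times_const)
  then show ?thesis using Suc by simp
qed simp

lemma smooth_const [intro]: "smooth (\<lambda>_. c)"
  by (simp add: smooth_def k_times_const)

lemma smooth_component [intro]: "smooth (\<lambda>x. x $ i)"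
  by (simp add: smooth_def k_times_component)

lemma smooth_add [intro]: "smooth f \<Longrightarrow> smooth g \<Longrightarrow> smooth (\<lambda>x. f x + g x)"
  by (simp add: smooth_def k_times_add)

lemma smooth_mult [intro]: "smooth f \<Longrightarrow> smooth g \<Longrightarrow> smooth (\<lambda>x. f x * g x)"
  by (simp add: smooth_def k_times_mult)

lemma smooth_inverse [intro]: "smooth f \<Longrightarrow> (\<And>x. f x \<noteq> 0) \<Longrightarrow> smooth (\<lambda>x. inverse (f x))"
  by (simp add: smooth_def k_times_inverse)

lemma smooth_minus [intro]: "smooth f \<Longrightarrow> smooth (\<lambda>x. - f x)"
  using smooth_mult[OF smooth_const[of "-1"]] by simp

lemma smooth_diff [intro]: "smooth f \<Longrightarrow> smooth g \<Longrightarrow> smooth (\<lambda>x. f x - g x)"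
  using smooth_add[OF _ smooth_minus] by simp

lemma smooth_divide [intro]:
  "smooth f \<Longrightarrow> smooth g \<Longrightarrow> (\<And>x. g x \<noteq> 0) \<Longrightarrow> smooth (\<lambda>x. f x / g x)"
  unfolding divide_inverse by (intro smooth_mult smooth_inverse)

lemma smooth_power [intro]: "smooth f \<Longrightarrow> smooth (\<lambda>x. f x ^ m)"
  by (induction m) (auto simp: intro!: smooth_mult)

lemma smooth_sum [intro]: "(\<And>i. i \<in> I \<Longrightarrow> smooth (f i)) \<Longrightarrow> smooth (\<lambda>x. \<Sum>i\<in>I. f i x)"
  by (induction I rule: infinite_finite_induct) (auto intro!: smooth_add)

lemma smooth_prod [intro]: "(\<And>i. i \<in> I \<Longrightarrow> smooth (f i)) \<Longrightarrow> smooth (\<lambda>x. \<Prod>i\<in>I. f i x)"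
  by (induction I rule: infinite_finite_induct) (auto intro!: smooth_mult)

lemma smooth_norm_power2 [intro]: "smooth (\<lambda>x::real^'n. (norm x)\<^sup>2)"
  unfolding power2_norm_eq_inner inner_vec_def inner_real_def
  by (intro smooth_sum smooth_mult smooth_component)

lemma smooth_partial [intro]: "smooth f \<Longrightarrow> smooth (partial i f)"
  unfolding smooth_def by (metis k_times_differentiable.simps(2))

lemma smooth_has_derivative: "smooth f \<Longrightarrow> (f has_derivative (\<lambda>d. d \<bullet> grad f x)) (at x)"
  unfolding smooth_def using k_times_Suc_has_derivative by blast

lemma smooth_continuous: "smooth f \<Longrightarrow> continuous_on S f"
  by (meson smooth_has_derivative has_derivative_continuous continuous_at_imp_continuous_on)

lemma smooth_continuous_grad: "smooth f \<Longrightarrow> continuous_on S (grad f)"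
  unfolding grad_def using smooth_continuous[OF smooth_partial] by (auto intro!: continuous_intros)

lemma smooth_measurable: "smooth f \<Longrightarrow> f \<in> borel_measurable borel"
  using smooth_continuous borel_measurable_continuous_onI by blast

lemma smooth_grad_measurable: "smooth f \<Longrightarrow> grad f \<in> borel_measurable borel"
  using smooth_continuous_grad borel_measurable_continuous_onI by blast

lemma grad_const [simp]: "grad (\<lambda>_. c) x = 0"
  by (rule grad_eqI) simp

lemma grad_add:
  assumes "smooth f" "smooth g" shows "grad (\<lambda>x. f x + g x) x = grad f x + grad g x"
  using assms[THEN smooth_has_derivative, of x]
  by (intro grad_eqI) (auto intro!: derivative_eq_intros simp: inner_add_right)

lemma grad_diff:
  assumes "smooth f" "smooth g" shows "grad (\<lambda>x. f x - g x) x = grad f x - grad g x"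
  using assms[THEN smooth_has_derivative, of x]
  by (intro grad_eqI) (auto intro!: derivative_eq_intros simp: inner_diff_right)

lemma grad_mult:
  assumes "smooth f" "smooth g"
  shows "grad (\<lambda>x. f x * g x) x = f x *\<^sub>R grad g x + g x *\<^sub>R grad f x"
  using assms[THEN smooth_has_derivative, of x]
  by (intro grad_eqI) (auto intro!: derivative_eq_intros simp: inner_add_right)

lemma partial_mult:
  assumes "smooth f" "smooth g"
  shows "partial i (\<lambda>x. f x * g x) x = f x * partial i g x + g x * partial i f x"
  using arg_cong[OF grad_mult[OF assms, of x], of "\<lambda>v. v $ i"] by simp

lemma grad_compose_real:
  assumes "smooth l" "(F has_real_derivative D) (at (l x))"
  shows "((\<lambda>x. F (l x)) has_derivative (\<lambda>d. d \<bullet> (D *\<^sub>R grad l x))) (at x)"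
proof -
  have "((\<lambda>x. F (l x)) has_derivative (\<lambda>d. (d \<bullet> grad l x) * D)) (at x)"
    using has_derivative_compose[OF smooth_has_derivative[OF assms(1)]
        assms(2)[unfolded has_field_derivative_def]] by (simp add: mult.commute)
  then show ?thesis by (simp add: mult.commute)
qed

text \<open>Differentiation lowers the exponent, so the induction runs over all \<open>b\<close> at
  once.\<close>

lemma smooth_powr:
  assumes l: "smooth l" "\<And>x. 0 < l x"
  shows "smooth (\<lambda>x. l x powr b)"
proof -
  have "k_times_differentiable k (\<lambda>x. l x powr b)" for k
  proof (induction k arbitrary: b)
    case (Suc k)
    show ?case
    proof (rule k_times_SucI[where g="\<lambda>x. (b * l x powr (b - 1)) *\<^sub>R grad l x"])
      show "((\<lambda>x. l x powr b) has_derivative (\<lambda>d. d \<bullet> (b * l x powr (b - 1)) *\<^sub>R grad l x)) (at x)" for x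
        by (intro grad_compose_real[OF l(1)] has_real_derivative_powr l(2))
      show "k_times_differentiable k (\<lambda>x. ((b * l x powr (b - 1)) *\<^sub>R grad l x) $ i)" for i
        unfolding vector_scaleR_component real_scaleR_def grad_nth
        using smooth_partial[OF l(1)] by (intro k_times_mult k_times_const Suc) (simp add: smooth_def)
    qed
  qed simp
  then show ?thesis by (simp add: smooth_def)
qed

lemma has_derivative_rescale:
  assumes "smooth l" "smooth \<psi>"
  shows "((\<lambda>x. \<psi> (l x *\<^sub>R x)) has_derivative
    (\<lambda>d. d \<bullet> (l x *\<^sub>R grad \<psi> (l x *\<^sub>R x) + (x \<bullet> grad \<psi> (l x *\<^sub>R x)) *\<^sub>R grad l x))) (at x)"
proof -
  have "((\<lambda>x. l x *\<^sub>R x) has_derivative (\<lambda>d. l x *\<^sub>R d + (d \<bullet> grad l x) *\<^sub>R x)) (at x)"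
    using smooth_has_derivative[OF assms(1), of x] by (auto intro!: derivative_eq_intros)
  from has_derivative_compose[OF this smooth_has_derivative[OF assms(2)]]
  show ?thesis by (simp add: inner_add_left inner_add_right mult.commute)
qed

text \<open>The gradient consists of rescaled derivatives of \<open>\<psi>\<close> multiplied by
  \<open>l\<close>, its derivatives and coordinates; hence the induction over all
  \<open>\<psi>\<close>. It serves for the endpoint term \<open>\<psi> (y / a y)\<close> of an
  integral with moving limit.\<close>

lemma smooth_rescale:
  fixes l \<psi> :: "real^'n \<Rightarrow> real"
  assumes l: "smooth l" and \<psi>: "smooth \<psi>"
  shows "smooth (\<lambda>x. \<psi> (l x *\<^sub>R x))"
proof -
  have "k_times_differentiable k (\<lambda>x. \<psi> (l x *\<^sub>R x))" if "smooth \<psi>" for k and \<psi> :: "real^'n \<Rightarrow> real"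
    using that
  proof (induction k arbitrary: \<psi>)
    case (Suc k)
    have [simp]: "k_times_differentiable k l" "k_times_differentiable k (partial i l)" for i
      using l smooth_partial[OF l] by (auto simp: smooth_def)
    have sum: "k_times_differentiable k (\<lambda>x. \<Sum>i\<in>I. f i x)" if "\<And>i. k_times_differentiable k (f i)"
      for I :: "'n set" and f :: "'n \<Rightarrow> real^'n \<Rightarrow> real"
      using that by (induction I rule: infinite_finite_induct) (auto intro!: k_times_add simp: k_times_const)
    show ?case
    proof (rule k_times_SucI[OF has_derivative_rescale[OF l Suc.prems]])
      show "k_times_differentiable k (\<lambda>x. (l x *\<^sub>R grad \<psi> (l x *\<^sub>R x)
          + (x \<bullet> grad \<psi> (l x *\<^sub>R x)) *\<^sub>R grad l x) $ i)" for i
        unfolding inner_vec_def vector_add_component vector_scaleR_component real_scaleR_def grad_nth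
          inner_real_def
        using Suc.prems
        by (intro k_times_add k_times_mult sum Suc.IH smooth_partial k_times_component) simp_all
    qed
  qed simp
  with \<psi> show ?thesis by (simp add: smooth_def)
qed

text \<open>The function s^(-m) exp(-1/s), extended by 0. The parameter \<open>m\<close> is present
  because this family is closed under differentiation up to linear combinations;
  \<open>m = 0\<close> is the cut-off itself.\<close>

definition flat :: "nat \<Rightarrow> real \<Rightarrow> real" where
  "flat m s = (if 0 < s then (1 / s) ^ m / exp (1 / s) else 0)"

lemma flat_tendsto_0: "(flat m \<longlongrightarrow> 0) (at 0)"
proof (rule filterlim_split_at)
  have "((\<lambda>s. (1 / s) ^ m / exp (1 / s)) \<longlongrightarrow> 0) (at_right (0::real))"
    using filterlim_compose[OF tendsto_power_div_exp_0 filterlim_inverse_at_top_right]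
    by (simp add: inverse_eq_divide)
  then show "(flat m \<longlongrightarrow> 0) (at_right 0)"
    by (rule Lim_transform_eventually) (auto simp: eventually_at_filter flat_def)
  show "(flat m \<longlongrightarrow> 0) (at_left 0)"
    by (rule Lim_transform_eventually[OF tendsto_const]) (auto simp: eventually_at_filter flat_def)
qed

lemma has_real_derivative_flat:
  "(flat m has_real_derivative (flat (m + 2) s - real m * flat (m + 1) s)) (at s)"
proof -
  consider "0 < s" | "s < 0" | "s = 0" by linarith
  then show ?thesis
  proof cases
    case 1
    have "((\<lambda>s. (1 / s) ^ m * exp (- (1 / s))) has_real_derivative
        (real m * (1 / s) ^ (m - 1) * (- 1 / s\<^sup>2) * exp (- (1 / s)) + exp (- (1 / s)) * (1 / s\<^sup>2) * (1 / s) ^ m)) (at s)"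
      using 1 by (auto intro!: derivative_eq_intros simp: power2_eq_square)
    also have "real m * (1 / s) ^ (m - 1) * (- 1 / s\<^sup>2) * exp (- (1 / s)) + exp (- (1 / s)) * (1 / s\<^sup>2) * (1 / s) ^ m
        = flat (m + 2) s - real m * flat (m + 1) s"
    proof -
      have "real m * (1 / s) ^ (m - 1) * (1 / s\<^sup>2) = real m * (1 / s) ^ (m + 1)"
        using 1 by (cases m) (auto simp: power2_eq_square)
      moreover have "real m * (1 / s) ^ (m - 1) * (- 1 / s\<^sup>2) * E + E * (1 / s\<^sup>2) * (1 / s) ^ m
          = (1 / s) ^ (m + 2) * E - real m * (1 / s) ^ (m - 1) * (1 / s\<^sup>2) * E" for E
        by (simp add: power_add power_divide power2_eq_square)
      moreover have "flat j s = (1 / s) ^ j * exp (- (1 / s))" for j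
        using 1 by (simp add: flat_def exp_minus divide_inverse)
      ultimately show ?thesis by simp
    qed
    finally show ?thesis
      by (rule has_field_derivative_transform_within_open[of _ _ _ "{0<..}"])
        (use 1 in \<open>auto simp: flat_def exp_minus divide_inverse\<close>)
  next
    case 2
    have "((\<lambda>_. 0) has_real_derivative 0) (at s)" by simp
    then have "(flat m has_real_derivative 0) (at s)"
      by (rule has_field_derivative_transform_within_open[of _ _ _ "{..<0}"])
        (use 2 in \<open>auto simp: flat_def\<close>)
    then show ?thesis using 2 by (simp add: flat_def)
  next
    case 3
    \<comment> \<open>At 0 the difference quotient of \<open>flat m\<close> is
      \<open>flat (m + 1)\<close>, which tends to 0 from both sides.\<close>
    have "((\<lambda>h. (flat m (0 + h) - flat m 0) / h) \<longlongrightarrow> 0) (at 0)"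
      by (rule Lim_transform_eventually[OF flat_tendsto_0[of "m + 1"]])
        (auto simp: eventually_at_filter flat_def divide_inverse)
    then show ?thesis using 3 by (simp add: DERIV_def flat_def)
  qed
qed

lemma smooth_flat:
  assumes l: "smooth l"
  shows "smooth (\<lambda>x. flat m (l x))"
proof -
  have "k_times_differentiable k (\<lambda>x. flat m (l x))" for k
  proof (induction k arbitrary: m)
    case (Suc k)
    have [simp]: "k_times_differentiable k (partial i l)" for i
      using smooth_partial[OF l] by (auto simp: smooth_def)
    have "(flat m has_real_derivative (flat (m + 2) s + - real m * flat (m + 1) s)) (at s)" for s
      using has_real_derivative_flat by simp
    from grad_compose_real[OF l this] show ?case
    proof (rule k_times_SucI)
      show "k_times_differentiable k
          (\<lambda>x. ((flat (m + 2) (l x) + - real m * flat (m + 1) (l x)) *\<^sub>R grad l x) $ i)" for i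
        unfolding vector_scaleR_component real_scaleR_def grad_nth
        by (intro k_times_mult k_times_add k_times_const Suc) simp_all
    qed
  qed simp
  then show ?thesis by (simp add: smooth_def)
qed

lemma flat_0: "flat 0 s = (if 0 < s then exp (- (1 / s)) else 0)"
  by (simp add: flat_def exp_minus divide_inverse)

lemma flat_0_bounds: "0 \<le> flat 0 s" "flat 0 s \<le> 1"
  by (auto simp: flat_0)

text \<open>Smooth approximations of the indicator of the positive half-line. A positive
  \<open>c\<close> confines the support to \<open>s \<ge> c / (k + 1)\<close>, which is how compact
  supports arise; \<open>c = 0\<close> serves for the faces of a box.\<close>

lemma flat_scaled_tendsto:
  "(\<lambda>k. flat 0 (real (Suc k) * s - c)) \<longlonglongrightarrow> (if 0 < s then 1 else 0)" if "0 \<le> c"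
proof (cases "0 < s")
  case True
  have lim: "filterlim (\<lambda>k. real (Suc k) * s - c) at_top sequentially"
    using True by real_asymp
  have "(\<lambda>k. exp (- (1 / (real (Suc k) * s - c)))) \<longlonglongrightarrow> exp (- 0)"
    using tendsto_inverse_0_at_top[OF lim] by (intro tendsto_intros) (simp add: inverse_eq_divide)
  moreover have "\<forall>\<^sub>F k in sequentially. 0 < real (Suc k) * s - c"
    using filterlim_at_top_dense[THEN iffD1, OF lim] by blast
  ultimately show ?thesis using True
    by (auto elim!: Lim_transform_eventually eventually_mono simp: flat_0)
next
  case False
  then have "real (Suc k) * s - c \<le> 0" for k
    using that mult_nonneg_nonpos[of "real (Suc k)" s] by linarith
  then have "flat 0 (real (Suc k) * s - c) = 0" for k by (simp add: flat_0 not_less)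
  then show ?thesis using False by simp
qed

section \<open>Test functions in the ball separate integrable functions\<close>

section \<open>Uniqueness of weak gradients\<close>

text \<open>Boxes are an intersection-stable generator of the Borel sets, and the sets over which
  \<open>g\<close> has integral zero form a Dynkin system.\<close>

lemma borel_eqI_box:
  fixes g :: "'a::euclidean_space \<Rightarrow> real"
  assumes g: "integrable lborel g"
    and box: "\<And>a b. (\<integral>x. indicator (box a b) x * g x \<partial>lborel) = 0"
  shows "AE x in lborel. g x = 0"
proof (rule sigma_finite_measure.density_zero[OF sigma_finite_lborel g])
  have int: "integrable lborel (\<lambda>x. indicator A x * g x)" if "A \<in> sets borel" for A
    using integrable_mult_indicator[OF _ g, of A] that by simp
  \<comment> \<open>Closure under complements needs the integral over the whole space, a limit over
    an exhausting sequence of boxes.\<close>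
  have whole: "(\<integral>x. g x \<partial>lborel) = 0"
  proof -
    let ?A = "\<lambda>n::nat. box (- (real n *\<^sub>R One)) (real n *\<^sub>R One) :: 'a set"
    have "(\<lambda>n. \<integral>x. indicator (?A n) x * g x \<partial>lborel) \<longlonglongrightarrow> (\<integral>x. g x \<partial>lborel)"
    proof (rule integral_dominated_convergence)
      show "integrable lborel (\<lambda>x. norm (g x))" using g by simp
      show "AE x in lborel. (\<lambda>n. indicator (?A n) x * g x) \<longlonglongrightarrow> g x"
      proof (rule AE_I2)
        fix x :: 'a
        have "x \<in> (\<Union>i. ?A i)" by (simp only: UN_box_eq_UNIV UNIV_I)
        then obtain N where N: "x \<in> ?A N" by blast
        have "\<forall>\<^sub>F n in sequentially. g x = indicator (?A n) x * g x"
        proof (rule eventually_sequentiallyI[of N])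
          fix n assume "N \<le> n"
          then have "x \<in> ?A n" using N by (fastforce simp: mem_box)
          then show "g x = indicator (?A n) x * g x" by simp
        qed
        then show "(\<lambda>n. indicator (?A n) x * g x) \<longlonglongrightarrow> g x"
          by (rule Lim_transform_eventually[OF tendsto_const])
      qed
    qed (use g in \<open>auto simp: indicator_def\<close>)
    then show ?thesis using box by (simp add: LIMSEQ_const_iff)
  qed
  fix A :: "'a set" assume "A \<in> sets lborel"
  then have sets: "A \<in> sigma_sets UNIV (range (\<lambda>(a, b). box a b))"
    by (simp add: borel_eq_box)
  have stable: "Int_stable (range (\<lambda>(a, b). box a b :: 'a set))"
    by (auto simp: Int_stable_def box_Int_box)
  have "range (\<lambda>(a, b). box a b :: 'a set) \<subseteq> Pow UNIV" by simp
  from stable this sets have "(\<integral>x. indicator A x * g x \<partial>lborel) = 0"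
  proof (induction rule: sigma_sets_induct_disjoint)
    case (basic A)
    then show ?case using box by auto
  next
    case (compl A)
    then have A: "A \<in> sets borel" by (simp add: borel_eq_box)
    have "(\<integral>x. indicator (UNIV - A) x * g x \<partial>lborel) = (\<integral>x. g x - indicator A x * g x \<partial>lborel)"
      by (rule Bochner_Integration.integral_cong) (auto simp: indicator_def)
    then show ?case using compl whole g int[OF A] by simp
  next
    case (union F)
    then have F: "F i \<in> sets borel" for i by (auto simp: borel_eq_box)
    have "(\<lambda>n. \<integral>x. (\<Sum>i<n. indicator (F i) x) * g x \<partial>lborel)
        \<longlonglongrightarrow> (\<integral>x. indicator (\<Union>i. F i) x * g x \<partial>lborel)"
    proof (rule integral_dominated_convergence)
      show "integrable lborel (\<lambda>x. norm (g x))" using g by simp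
      show "AE x in lborel. (\<lambda>n. (\<Sum>i<n. indicator (F i) x) * g x) \<longlonglongrightarrow> indicator (\<Union>i. F i) x * g x"
        using indicator_sums[of F] union(1)
        by (intro AE_I2 tendsto_mult_right) (auto simp: sums_def disjoint_family_on_def)
      show "AE x in lborel. norm ((\<Sum>i<n. indicator (F i) x) * g x) \<le> norm (g x)" for n
      proof (rule AE_I2)
        fix x
        have "(\<Sum>i<n. indicator (F i) x :: real) = indicator (\<Union>i<n. F i) x"
          using union(1) by (subst indicator_UN_disjoint)
            (auto simp: disjoint_family_on_def)
        then show "norm ((\<Sum>i<n. indicator (F i) x) * g x) \<le> norm (g x)"
          by (auto simp: indicator_def)
      qed
    qed (use g F in auto)
    moreover have "(\<integral>x. (\<Sum>i<n. indicator (F i) x) * g x \<partial>lborel) = 0" for n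
      unfolding sum_distrib_right using int[OF F] union(3)
      by (subst Bochner_Integration.integral_sum) auto
    ultimately show ?case by (simp add: LIMSEQ_const_iff)
  qed simp
  then show "set_lebesgue_integral lborel A g = 0"
    by (simp add: set_lebesgue_integral_def)
qed

text \<open>On the ball, the indicator of any box is a bounded pointwise limit of test functions.
  Thus \<open>g\<close>, extended by zero, has integral zero over every box.\<close>

lemma test_functions_separate:
  fixes g :: "real^'n \<Rightarrow> real"
  assumes g: "integrable (volume_on (ball 0 1)) g"
    and zero: "\<And>\<phi>. test_function (ball 0 1) \<phi> \<Longrightarrow> (\<integral>x. g x * \<phi> x \<partial>volume_on (ball 0 1)) = 0"
  shows "AE x in volume_on (ball 0 1). g x = 0"
proof -
  let ?B = "ball 0 1 :: (real^'n) set"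
  have G: "integrable lborel (\<lambda>x. indicator ?B x *\<^sub>R g x)"
    using g by (subst (asm) integrable_restrict_space) auto
  have "AE x in lborel. indicator ?B x *\<^sub>R g x = 0"
  proof (rule borel_eqI_box[OF G])
    fix a b :: "real^'n"
    \<comment> \<open>The shift by 1 in the first factor confines the support to a closed ball of
      radius \<open>sqrt (1 - 1 / (k + 1))\<close>; the other factors approximate the open
      half-spaces whose intersection is the box.\<close>
    define \<phi> where "\<phi> k x = flat 0 (real (Suc k) * (1 - (norm x)\<^sup>2) - 1) *
      (\<Prod>i\<in>UNIV. flat 0 (real (Suc k) * (x $ i - a $ i) - 0) * flat 0 (real (Suc k) * (b $ i - x $ i) - 0))"
      for k and x :: "real^'n"
    have smooth: "smooth (\<phi> k)" for k
      unfolding \<phi>_def by (intro smooth_mult smooth_prod smooth_flat smooth_diff smooth_const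
          smooth_component smooth_norm_power2)
    have "test_function ?B (\<phi> k)" for k
    proof -
      have "{x. \<phi> k x \<noteq> 0} \<subseteq> cball 0 (sqrt (1 - 1 / real (Suc k)))"
      proof
        fix x assume "x \<in> {x. \<phi> k x \<noteq> 0}"
        then have "0 < real (Suc k) * (1 - (norm x)\<^sup>2) - 1"
          by (auto simp: \<phi>_def flat_0 split: if_splits)
        then have "(norm x)\<^sup>2 \<le> 1 - 1 / real (Suc k)"
          by (simp add: field_simps)
        then show "x \<in> cball 0 (sqrt (1 - 1 / real (Suc k)))"
          by (simp add: real_le_rsqrt)
      qed
      then have "closure {x. \<phi> k x \<noteq> 0} \<subseteq> cball 0 (sqrt (1 - 1 / real (Suc k)))"
        by (rule closure_minimal) simp
      moreover have "cball 0 (sqrt (1 - 1 / real (Suc k))) \<subseteq> ?B"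
        unfolding cball_subset_ball_iff by simp
      moreover have "compact (closure {x. \<phi> k x \<noteq> 0})"
        using calculation(1) by (meson bounded_cball bounded_subset closed_closure compact_eq_bounded_closed)
      ultimately show ?thesis using smooth by (auto simp: test_function_def)
    qed
    from zero[OF this] have "(\<integral>x. \<phi> k x * (indicator ?B x *\<^sub>R g x) \<partial>lborel) = 0" for k
      by (simp add: integral_restrict_space mult_ac)
    moreover have "(\<lambda>k. \<integral>x. \<phi> k x * (indicator ?B x *\<^sub>R g x) \<partial>lborel) \<longlonglongrightarrow>
        (\<integral>x. indicator (box a b) x * (indicator ?B x *\<^sub>R g x) \<partial>lborel)"
    proof (rule integral_dominated_convergence)
      show "integrable lborel (\<lambda>x. norm (indicator ?B x *\<^sub>R g x))" using G by (rule integrable_norm)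
      show "(\<lambda>x. \<phi> k x * (indicator ?B x *\<^sub>R g x)) \<in> borel_measurable lborel" for k
        using smooth_measurable[OF smooth, of k] borel_measurable_integrable[OF G] by simp
      show "(\<lambda>x. indicator (box a b) x * (indicator ?B x *\<^sub>R g x)) \<in> borel_measurable lborel"
        using borel_measurable_integrable[OF G] by simp
      have "\<bar>\<phi> k x\<bar> \<le> 1" for k x
      proof -
        have "0 \<le> \<phi> k x"
          unfolding \<phi>_def by (intro mult_nonneg_nonneg prod_nonneg ballI flat_0_bounds)
        moreover have "\<phi> k x \<le> 1"
          unfolding \<phi>_def by (intro mult_le_one prod_le_1 flat_0_bounds mult_nonneg_nonneg prod_nonneg conjI ballI)
        ultimately show ?thesis by simp
      qed
      then show "AE x in lborel. norm (\<phi> k x * (indicator ?B x *\<^sub>R g x)) \<le> norm (indicator ?B x *\<^sub>R g x)" for k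
        by (auto simp: abs_mult intro!: AE_I2 mult_left_le_one_le)
      have "(\<lambda>k. \<phi> k x * (indicator ?B x *\<^sub>R g x)) \<longlonglongrightarrow> indicator (box a b) x * (indicator ?B x *\<^sub>R g x)" for x
      proof (cases "x \<in> ?B")
        case True
        have "(\<lambda>k. \<phi> k x) \<longlonglongrightarrow> (if 0 < 1 - (norm x)\<^sup>2 then 1 else 0) *
           (\<Prod>i\<in>UNIV. (if 0 < x $ i - a $ i then 1 else 0) * (if 0 < b $ i - x $ i then 1 else 0))"
          unfolding \<phi>_def by (intro tendsto_mult tendsto_prod flat_scaled_tendsto) auto
        also have "(if 0 < 1 - (norm x)\<^sup>2 then 1 else 0) *
           (\<Prod>i\<in>UNIV. (if 0 < x $ i - a $ i then 1 else 0) * (if 0 < b $ i - x $ i then 1 else 0)) = (indicator (box a b) x :: real)"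
        proof -
          have "0 < 1 - (norm x)\<^sup>2" using True by (simp add: power_less_one_iff)
          moreover have "(\<Prod>i\<in>UNIV. (if 0 < x $ i - a $ i then 1 else 0) * (if 0 < b $ i - x $ i then 1 else 0 :: real))
              = indicator (box a b) x"
            by (auto simp: indicator_def mem_box_cart prod_eq_1_iff intro!: prod_zero)
          ultimately show ?thesis by simp
        qed
        finally show ?thesis by (rule tendsto_mult_right)
      qed simp
      then show "AE x in lborel. (\<lambda>k. \<phi> k x * (indicator ?B x *\<^sub>R g x)) \<longlonglongrightarrow> indicator (box a b) x * (indicator ?B x *\<^sub>R g x)"
        by simp
    qed
    ultimately show "(\<integral>x. indicator (box a b) x * (indicator ?B x *\<^sub>R g x) \<partial>lborel) = 0"
      by (simp add: LIMSEQ_const_iff)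
  qed
  then show ?thesis
    by (subst AE_restrict_space_iff) (auto elim!: eventually_mono)
qed

section \<open>Cone measure, dilations and Fubini, leading to the divergence theorem\<close>

section \<open>Integration over the unit ball and the unit sphere\<close>

abbreviation ball_measure :: "(real^'n) measure" where
  "ball_measure \<equiv> volume_on (ball 0 1)"

abbreviation unit_interval :: "real measure" where
  "unit_interval \<equiv> restrict_space lborel {0..1}"

lemma finite_ball_measure: "finite_measure (ball_measure :: (real^'n) measure)"
proof
  have "emeasure lborel (ball 0 1 :: (real^'n) set) < \<infinity>"
    by (rule emeasure_bounded_finite) simp
  then show "emeasure (ball_measure :: (real^'n) measure) (space ball_measure) \<noteq> \<infinity>"
    by (simp add: emeasure_restrict_space space_restrict_space)
qed

lemma space_ball_measure [simp]: "space ball_measure = ball 0 1"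
  by (simp add: space_restrict_space)

lemma finite_unit_interval: "finite_measure unit_interval"
  by standard (simp add: emeasure_restrict_space space_restrict_space)

lemma space_unit_interval [simp]: "space unit_interval = {0..1}"
  by (simp add: space_restrict_space)

lemma pred_mem_ball [measurable]: "Measurable.pred borel (\<lambda>x. x \<in> ball (c::real^'n) r)"
  unfolding mem_ball by measurable

lemma measurable_ball_measure:
  "f \<in> borel_measurable borel \<Longrightarrow> f \<in> borel_measurable ball_measure"
  by (simp add: measurable_restrict_space1)

lemma integral_ball_measure:
  fixes f :: "real^'n \<Rightarrow> 'b::euclidean_space"
  shows "(\<integral>x. f x \<partial>ball_measure) = (\<integral>x. indicator (ball 0 1) x *\<^sub>R f x \<partial>lborel)"
  by (simp add: integral_restrict_space)

lemma integrable_ball_bounded: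
  fixes f :: "real^'n \<Rightarrow> 'b::euclidean_space"
  assumes "f \<in> borel_measurable borel" "\<And>x. norm x < 1 \<Longrightarrow> norm (f x) \<le> C"
  shows "integrable ball_measure f"
proof -
  interpret finite_measure "ball_measure :: (real^'n) measure" by (rule finite_ball_measure)
  show ?thesis
    by (rule integrable_const_bound[of _ C])
      (use assms in \<open>auto intro: measurable_ball_measure AE_I2\<close>)
qed

lemma continuous_bounded_cball:
  fixes f :: "real^'n \<Rightarrow> 'b::real_normed_vector"
  assumes "continuous_on (cball 0 1) f"
  obtains C where "0 \<le> C" "\<And>x. norm x \<le> 1 \<Longrightarrow> norm (f x) \<le> C"
proof -
  have "bounded (f ` cball 0 1)"
    by (intro compact_imp_bounded compact_continuous_image assms compact_cball)
  then obtain C where "\<forall>y\<in>f ` cball 0 1. norm y \<le> C"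
    unfolding bounded_iff by blast
  then have "norm (f x) \<le> max C 0" if "norm x \<le> 1" for x
    using that by (intro max.coboundedI1) auto
  then show thesis by (intro that[of "max C 0"]) auto
qed

lemma continuous_integrable_ball:
  fixes f :: "real^'n \<Rightarrow> 'b::euclidean_space"
  assumes "continuous_on UNIV f"
  shows "integrable ball_measure f"
proof -
  obtain C where "0 \<le> C" "\<And>x. norm x \<le> 1 \<Longrightarrow> norm (f x) \<le> C"
    using continuous_bounded_cball[OF continuous_on_subset[OF assms subset_UNIV]] by blast
  then show ?thesis
    using borel_measurable_continuous_onI[OF assms] by (intro integrable_ball_bounded[of _ C]) auto
qed

lemma continuous_L2_ball:
  fixes f :: "real^'n \<Rightarrow> 'b::euclidean_space"
  assumes "continuous_on UNIV f"
  shows "f \<in> L2 ball_measure"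
proof -
  obtain C where "0 \<le> C" "\<And>x. norm x \<le> 1 \<Longrightarrow> norm (f x) \<le> C"
    using continuous_bounded_cball[OF continuous_on_subset[OF assms subset_UNIV]] by blast
  then show ?thesis
    using borel_measurable_continuous_onI[OF assms]
    by (intro L2_bounded[OF finite_ball_measure, where C=C] measurable_ball_measure) auto
qed

lemma scale_measure_eq_density: "scale_measure r M = density M (\<lambda>_. r)"
  by (rule measure_eqI) (auto simp: emeasure_density_const)

lemma sphere_measure_sgn:
  "(sgn :: real^'n \<Rightarrow> _) \<in> volume_on (ball 0 1 - {0}) \<rightarrow>\<^sub>M restrict_space borel (sphere 0 1)"
proof (rule measurable_restrict_space2)
  show "sgn \<in> space (volume_on (ball 0 1 - {0})) \<rightarrow> sphere (0::real^'n) 1"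
    by (auto simp: space_restrict_space norm_sgn)
  have "(sgn :: real^'n \<Rightarrow> _) \<in> lborel \<rightarrow>\<^sub>M borel" by simp
  then show "(sgn :: real^'n \<Rightarrow> _) \<in> volume_on (ball 0 1 - {0}) \<rightarrow>\<^sub>M borel"
    by (rule measurable_restrict_space1)
qed

lemma sets_sphere_measure: "sets sphere_measure = sets (restrict_space borel (sphere 0 1))"
  by (simp add: sphere_measure_def)

lemma space_sphere_measure [simp]: "space sphere_measure = sphere 0 1"
  by (simp add: sphere_measure_def space_scale_measure space_restrict_space)

lemma measurable_sphere_measure:
  "f \<in> borel_measurable borel \<Longrightarrow> f \<in> borel_measurable sphere_measure"
  using measurable_cong_sets[OF sets_sphere_measure refl] by (blast intro: measurable_restrict_space1)

lemma finite_sphere_measure: "finite_measure (sphere_measure :: (real^'n) measure)"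
proof
  have "emeasure lborel (ball 0 1 - {0} :: (real^'n) set) < \<infinity>"
    by (rule emeasure_bounded_finite) (simp add: bounded_diff)
  then have "finite_measure (volume_on (ball 0 1 - {0} :: (real^'n) set))"
    by (intro finite_measureI) (simp add: emeasure_restrict_space space_restrict_space)
  then interpret D: finite_measure "distr (volume_on (ball 0 1 - {0 :: real^'n}))
      (restrict_space borel (sphere 0 1)) sgn"
    by (rule finite_measure.finite_measure_distr[OF _ sphere_measure_sgn])
  show "emeasure (sphere_measure :: (real^'n) measure) (space sphere_measure) \<noteq> \<infinity>"
    unfolding sphere_measure_def emeasure_scale_measure
    using D.emeasure_finite by (simp add: ennreal_mult_eq_top_iff ennreal_of_nat_neq_top)
qed

text \<open>Unfolds the cone measure: extend \<open>f\<close> constantly along rays and integrate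
  over the ball. The origin, where \<open>sgn\<close> is not on the sphere, is a null set.\<close>

lemma integral_sphere_measure:
  fixes f :: "real^'n \<Rightarrow> real"
  assumes [measurable]: "f \<in> borel_measurable borel"
  shows "(\<integral>x. f x \<partial>sphere_measure) = real CARD('n) * (\<integral>x. f (sgn x) \<partial>ball_measure)"
proof -
  have f: "f \<in> borel_measurable (restrict_space borel (sphere 0 1))"
    by (rule measurable_restrict_space1) simp
  have nz: "AE x in lborel. x \<noteq> (0 :: real^'n)" by (rule AE_lborel_singleton)
  have "(\<integral>x. f x \<partial>sphere_measure) = (\<integral>x. real CARD('n) *\<^sub>R f x
      \<partial>distr (volume_on (ball 0 1 - {0})) (restrict_space borel (sphere 0 1)) sgn)"
    unfolding sphere_measure_def scale_measure_eq_density ennreal_of_nat_eq_real_of_nat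
    using f by (intro integral_density) auto
  also have "\<dots> = (\<integral>x. real CARD('n) *\<^sub>R f (sgn x) \<partial>volume_on (ball 0 1 - {0 :: real^'n}))"
    using f by (intro integral_distr sphere_measure_sgn) simp
  also have "\<dots> = real CARD('n) * (\<integral>x. indicator (ball 0 1 - {0}) x *\<^sub>R f (sgn x) \<partial>lborel)"
    by (simp add: integral_restrict_space)
  also have "(\<integral>x. indicator (ball 0 1 - {0}) x *\<^sub>R f (sgn x) \<partial>lborel)
      = (\<integral>x. indicator (ball 0 1) x *\<^sub>R f (sgn x) \<partial>lborel)"
    by (rule integral_cong_AE) (use nz in \<open>auto elim!: eventually_mono simp: indicator_def\<close>)
  finally show ?thesis by (simp add: integral_ball_measure)
qed

lemma integral_scaling:
  fixes f :: "real^'n \<Rightarrow> 'b::euclidean_space"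
  assumes [measurable]: "f \<in> borel_measurable borel" and c: "0 < c"
  shows "(\<integral>x. f x \<partial>lborel) = c ^ CARD('n) *\<^sub>R (\<integral>x. f (c *\<^sub>R x) \<partial>lborel)"
proof -
  have "lborel = density (distr lborel borel (\<lambda>x::real^'n. 0 + c *\<^sub>R x)) (\<lambda>_. ennreal (c ^ CARD('n)))"
    using lborel_affine[of c "0::real^'n"] c by (simp add: ennreal_power)
  then have "(\<integral>x. f x \<partial>lborel) = (\<integral>x. f x \<partial>density (distr lborel borel (\<lambda>x::real^'n. c *\<^sub>R x)) (\<lambda>_. ennreal (c ^ CARD('n))))"
    by simp
  also have "\<dots> = (\<integral>x. c ^ CARD('n) *\<^sub>R f x \<partial>distr lborel borel (\<lambda>x::real^'n. c *\<^sub>R x))"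
    using c by (intro integral_density) auto
  also have "\<dots> = (\<integral>x. c ^ CARD('n) *\<^sub>R f (c *\<^sub>R x) \<partial>lborel)"
    by (intro integral_distr) auto
  finally show ?thesis by simp
qed

lemma integral_translation:
  fixes f :: "real^'n \<Rightarrow> 'b::euclidean_space"
  assumes [measurable]: "f \<in> borel_measurable borel"
  shows "(\<integral>x. f (c + x) \<partial>lborel) = (\<integral>x. f x \<partial>lborel)"
proof -
  have "(\<integral>x. f x \<partial>lborel) = (\<integral>x. f x \<partial>distr lborel borel ((+) c))"
    by (simp add: lborel_distr_plus)
  also have "\<dots> = (\<integral>x. f (c + x) \<partial>lborel)"
    by (intro integral_distr) auto
  finally show ?thesis by simp
qed

text \<open>Measurability is asked for on the product of the full Borel spaces, where it is easy to
  check, and boundedness only over ball and interval; finiteness of both measures then gives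
  integrability.\<close>

lemma Fubini_ball_interval:
  fixes f :: "real^'n \<Rightarrow> real \<Rightarrow> 'b::euclidean_space"
  assumes meas: "(\<lambda>z. f (fst z) (snd z)) \<in> borel_measurable (borel \<Otimes>\<^sub>M borel)"
    and bd: "\<And>x s. norm x < 1 \<Longrightarrow> 0 \<le> s \<Longrightarrow> s \<le> 1 \<Longrightarrow> norm (f x s) \<le> C"
  shows "(\<integral>x. (\<integral>s. f x s \<partial>unit_interval) \<partial>ball_measure) = (\<integral>s. (\<integral>x. f x s \<partial>ball_measure) \<partial>unit_interval)"
    and "integrable ball_measure (\<lambda>x. \<integral>s. f x s \<partial>unit_interval)"
    and "integrable unit_interval (\<lambda>s. \<integral>x. f x s \<partial>ball_measure)"
proof -
  interpret B: finite_measure "ball_measure :: (real^'n) measure" by (rule finite_ball_measure)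
  interpret I: finite_measure unit_interval by (rule finite_unit_interval)
  interpret P: pair_sigma_finite "ball_measure :: (real^'n) measure" unit_interval ..
  interpret F: finite_measure "(ball_measure :: (real^'n) measure) \<Otimes>\<^sub>M unit_interval"
    by (intro finite_measure_pair_measure finite_ball_measure finite_unit_interval)
  have id: "(\<lambda>z. z) \<in> (ball_measure :: (real^'n) measure) \<Otimes>\<^sub>M unit_interval \<rightarrow>\<^sub>M borel \<Otimes>\<^sub>M borel"
  proof -
    have "fst \<in> (ball_measure :: (real^'n) measure) \<Otimes>\<^sub>M unit_interval \<rightarrow>\<^sub>M borel"
      by (rule measurable_compose[OF measurable_fst, where g="\<lambda>x. x"], rule measurable_ball_measure) simp
    moreover have "snd \<in> (ball_measure :: (real^'n) measure) \<Otimes>\<^sub>M unit_interval \<rightarrow>\<^sub>M borel"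
      by (rule measurable_compose[OF measurable_snd, where g="\<lambda>x. x"], rule measurable_restrict_space1) simp
    ultimately have "(\<lambda>z. (fst z, snd z)) \<in> (ball_measure :: (real^'n) measure) \<Otimes>\<^sub>M unit_interval \<rightarrow>\<^sub>M borel \<Otimes>\<^sub>M borel"
      by (rule measurable_Pair)
    then show ?thesis by simp
  qed
  have int: "integrable ((ball_measure :: (real^'n) measure) \<Otimes>\<^sub>M unit_interval) (case_prod f)"
    using measurable_compose[OF id meas] bd
    by (intro F.integrable_const_bound[of _ C])
      (auto simp: space_pair_measure case_prod_beta intro!: AE_I2)
  show "(\<integral>x. (\<integral>s. f x s \<partial>unit_interval) \<partial>ball_measure) = (\<integral>s. (\<integral>x. f x s \<partial>ball_measure) \<partial>unit_interval)"
    using P.Fubini_integral[OF int] by simp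
  show "integrable ball_measure (\<lambda>x. \<integral>s. f x s \<partial>unit_interval)"
    using P.integrable_fst'[OF int] by simp
  show "integrable unit_interval (\<lambda>s. \<integral>x. f x s \<partial>ball_measure)"
    using P.integrable_snd[OF int] by simp
qed

lemma integral_unit_interval:
  fixes f :: "real \<Rightarrow> 'b::euclidean_space"
  assumes "continuous_on {0..1} f"
  shows "(\<integral>s. f s \<partial>unit_interval) = integral {0..1} f"
proof -
  have "set_integrable lborel {0..1} f"
    by (rule borel_integrable_atLeastAtMost') fact
  then show ?thesis
    using set_borel_integral_eq_integral(2) by (simp add: integral_restrict_space set_lebesgue_integral_def)
qed

text \<open>A substitute for polar coordinates. \<open>1 - r^j\<close> is the integral of
  \<open>j s^(j-1)\<close> over \<open>r < s < 1\<close>; after exchanging integrals there remains a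
  function constant along rays, whose integral over the ball of radius \<open>s\<close> is
  \<open>s^n\<close> times that over the unit ball.\<close>

lemma integral_radial_power:
  fixes g :: "real^'n \<Rightarrow> real"
  assumes [measurable]: "g \<in> borel_measurable borel" and bd: "\<And>x. norm x \<le> 1 \<Longrightarrow> \<bar>g x\<bar> \<le> C"
  shows "(\<integral>x. norm x ^ j * g (sgn x) \<partial>ball_measure)
       = real CARD('n) / real (j + CARD('n)) * (\<integral>x. g (sgn x) \<partial>ball_measure)"
proof (cases j)
  case (Suc m)
  have sgn: "norm (sgn x) \<le> 1" for x :: "real^'n" by (simp add: norm_sgn)
  define I where "I = (\<integral>x. g (sgn x) \<partial>ball_measure)"
  \<comment> \<open>Here \<open>m = j - 1\<close>; the indicator encodes \<open>r < s\<close>, so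
    that Fubini runs over a product domain.\<close>
  define f where "f x s = (real j * s ^ m) * (indicator {x. norm x < s} x * g (sgn x))" for x :: "real^'n" and s
  have gint: "integrable ball_measure (\<lambda>x. g (sgn x))"
    by (rule integrable_ball_bounded[of _ C]) (use bd sgn in auto)
  have f_meas: "(\<lambda>z. f (fst z) (snd z)) \<in> borel_measurable (borel \<Otimes>\<^sub>M borel)"
    unfolding f_def by measurable
  have f_bd: "norm (f x s) \<le> real j * C" if "0 \<le> s" "s \<le> 1" for x s
  proof -
    have "s ^ m \<le> 1" using that by (simp add: power_le_one)
    moreover have "\<bar>indicator {x. norm x < s} x * g (sgn x)\<bar> \<le> C"
      using bd[OF sgn, of x] bd[of 0] by (auto simp: indicator_def)
    ultimately have "s ^ m * \<bar>indicator {x. norm x < s} x * g (sgn x)\<bar> \<le> 1 * C"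
      using that by (intro mult_mono) auto
    then show ?thesis
      using that by (simp add: f_def abs_mult mult_left_mono mult.assoc)
  qed
  have cone: "(\<integral>x. indicator {x. norm x < s} x * g (sgn x) \<partial>ball_measure) = s ^ CARD('n) * I"
    if "0 < s" "s \<le> 1" for s
  proof -
    have meas: "(\<lambda>x. indicator (ball 0 s) x * g (sgn x)) \<in> borel_measurable borel" by measurable
    have "(\<integral>x. indicator {x. norm x < s} x * g (sgn x) \<partial>ball_measure)
        = (\<integral>x. indicator (ball 0 s) x * g (sgn x) \<partial>lborel)"
      unfolding integral_ball_measure
      by (rule Bochner_Integration.integral_cong) (use that in \<open>auto simp: indicator_def\<close>)
    also have "\<dots> = s ^ CARD('n) * (\<integral>x. indicator (ball 0 s) (s *\<^sub>R x) * g (sgn (s *\<^sub>R x)) \<partial>lborel)"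
      using integral_scaling[OF meas \<open>0 < s\<close>] by simp
    also have "(\<integral>x. indicator (ball 0 s) (s *\<^sub>R x) * g (sgn (s *\<^sub>R x)) \<partial>lborel) = I"
      unfolding I_def integral_ball_measure
      by (rule Bochner_Integration.integral_cong) (use that in \<open>auto simp: indicator_def sgn_scaleR\<close>)
    finally show ?thesis .
  qed
  have "(\<integral>s. f x s \<partial>unit_interval) = (1 - norm x ^ j) * g (sgn x)" if "norm x < 1" for x
  proof -
    have "(\<integral>s. f x s \<partial>unit_interval) = (\<integral>s. (indicator {norm x..1} s *\<^sub>R (real j * s ^ m)) * g (sgn x) \<partial>lborel)"
    proof (subst integral_restrict_space, simp, rule integral_cong_AE)
      show "AE s in lborel. indicator {0..1} s *\<^sub>R f x s = (indicator {norm x..1} s *\<^sub>R (real j * s ^ m)) * g (sgn x)"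
        using AE_lborel_singleton[of "norm x"]
        by eventually_elim (auto simp: f_def indicator_def order.trans[OF norm_ge_zero])
    qed (unfold f_def, measurable)
    also have "\<dots> = (\<integral>s. indicator {norm x..1} s *\<^sub>R (real j * s ^ m) \<partial>lborel) * g (sgn x)"
      by simp
    also have "(\<integral>s. indicator {norm x..1} s *\<^sub>R (real j * s ^ m) \<partial>lborel) = 1 ^ j - norm x ^ j"
    proof (rule integral_FTC_Icc)
      show "norm x \<le> 1" using that by simp
      show "((\<lambda>s. s ^ j) has_vector_derivative real j * s ^ m) (at s within {norm x..1})" for s
        unfolding has_real_derivative_iff_has_vector_derivative[symmetric]
        by (rule DERIV_cong[OF DERIV_pow]) (simp add: Suc)
      show "continuous_on {norm x..1} (\<lambda>s. real j * s ^ m)" by (intro continuous_intros)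
    qed
    finally show ?thesis by simp
  qed
  then have "(\<integral>x. (1 - norm x ^ j) * g (sgn x) \<partial>ball_measure) = (\<integral>x. (\<integral>s. f x s \<partial>unit_interval) \<partial>ball_measure)"
    by (intro Bochner_Integration.integral_cong) auto
  also have "\<dots> = (\<integral>s. (\<integral>x. f x s \<partial>ball_measure) \<partial>unit_interval)"
    by (rule Fubini_ball_interval(1)[OF f_meas f_bd])
  also have "\<dots> = (\<integral>s. real j * s ^ (m + CARD('n)) * I \<partial>unit_interval)"
  proof (rule Bochner_Integration.integral_cong[OF refl])
    fix s assume "s \<in> space unit_interval"
    then consider "s = 0" | "0 < s" "s \<le> 1" by fastforce
    then show "(\<integral>x. f x s \<partial>ball_measure) = real j * s ^ (m + CARD('n)) * I"
    proof cases
      case 1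
      then show ?thesis by (simp add: f_def)
    next
      case 2
      then show ?thesis unfolding f_def using cone[OF 2] by (simp add: power_add mult_ac)
    qed
  qed
  also have "\<dots> = integral {0..1} (\<lambda>s. real j * s ^ (m + CARD('n)) * I)"
    by (intro integral_unit_interval continuous_intros)
  also have "\<dots> = real j / real (j + CARD('n)) * I"
  proof (rule integral_unique)
    have "((\<lambda>s. real j * s ^ (m + CARD('n)) * I) has_integral
        (real j / real (j + CARD('n)) * I * 1 ^ (j + CARD('n)) - real j / real (j + CARD('n)) * I * 0 ^ (j + CARD('n)))) {0..1}"
    proof (rule fundamental_theorem_of_calculus)
      show "((\<lambda>s. real j / real (j + CARD('n)) * I * s ^ (j + CARD('n))) has_vector_derivative
          real j * s ^ (m + CARD('n)) * I) (at s within {0..1})" for s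
      proof -
        have "j + CARD('n) - Suc 0 = m + CARD('n)" "real (j + CARD('n)) \<noteq> 0" by (simp_all add: Suc)
        then show ?thesis
          unfolding has_real_derivative_iff_has_vector_derivative[symmetric]
          by (intro DERIV_cong[OF DERIV_cmult[OF DERIV_pow]]) (simp del: of_nat_add)
      qed
    qed simp
    then show "((\<lambda>s. real j * s ^ (m + CARD('n)) * I) has_integral real j / real (j + CARD('n)) * I) {0..1}"
      by (simp add: Suc)
  qed
  finally have "(\<integral>x. (1 - norm x ^ j) * g (sgn x) \<partial>ball_measure) = real j / real (j + CARD('n)) * I" .
  moreover have "(\<integral>x. (1 - norm x ^ j) * g (sgn x) \<partial>ball_measure)
      = I - (\<integral>x. norm x ^ j * g (sgn x) \<partial>ball_measure)"
  proof -
    have "integrable ball_measure (\<lambda>x. norm x ^ j * g (sgn x))"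
    proof (rule integrable_ball_bounded[of _ C])
      fix x :: "real^'n" assume "norm x < 1"
      then have "norm x ^ j * \<bar>g (sgn x)\<bar> \<le> 1 * C"
        using bd[OF sgn, of x] by (intro mult_mono power_le_one) auto
      then show "norm (norm x ^ j * g (sgn x)) \<le> C" by (simp add: abs_mult)
    qed measurable
    then show ?thesis using gint by (simp add: I_def left_diff_distrib)
  qed
  ultimately have "(\<integral>x. norm x ^ j * g (sgn x) \<partial>ball_measure) = I - real j / real (j + CARD('n)) * I"
    by linarith
  also have "\<dots> = real CARD('n) / real (j + CARD('n)) * I"
    by (simp add: Suc field_simps)
  finally show ?thesis unfolding I_def .
qed simp

section \<open>Integrals of partial derivatives over the ball\<close>

lemma smooth_Lipschitz:
  fixes F :: "real^'n \<Rightarrow> real"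
  assumes "smooth F"
  obtains L where "0 \<le> L" "\<And>x y. norm x \<le> 1 \<Longrightarrow> norm y \<le> 1 \<Longrightarrow> \<bar>F x - F y\<bar> \<le> L * norm (x - y)"
proof -
  obtain L where L: "0 \<le> L" "\<And>x. norm x \<le> 1 \<Longrightarrow> norm (grad F x) \<le> L"
    using continuous_bounded_cball[OF smooth_continuous_grad[OF assms]] by blast
  have "\<bar>F x - F y\<bar> \<le> L * norm (x - y)" if "norm x \<le> 1" "norm y \<le> 1" for x y
    unfolding real_norm_def[symmetric]
  proof (rule differentiable_bound[OF convex_cball])
    show "(F has_derivative (\<lambda>d. d \<bullet> grad F x)) (at x within cball 0 1)" for x
      using smooth_has_derivative[OF assms] by (rule has_derivative_at_withinI)
    show "onorm (\<lambda>d. d \<bullet> grad F x) \<le> L" if "x \<in> cball 0 1" for x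
    proof (rule onorm_le)
      fix d
      have "norm (d \<bullet> grad F x) \<le> norm d * norm (grad F x)"
        unfolding real_norm_def by (rule Cauchy_Schwarz_ineq2)
      also have "\<dots> \<le> norm d * L"
        using L(2) that by (intro mult_left_mono) auto
      finally show "norm (d \<bullet> grad F x) \<le> L * norm d" by (simp only: mult.commute)
    qed
  qed (use that in auto)
  with L(1) show thesis by (rule that)
qed

text \<open>The intermediate value theorem for the norm along the segment. The crossing point lies
  between \<open>x\<close> and \<open>y\<close>, hence is no farther from \<open>x\<close> than
  \<open>y\<close> is.\<close>

lemma segment_meets_sphere:
  fixes x y :: "real^'n"
  assumes "norm x \<le> 1" "1 \<le> norm y"
  obtains z where "norm z = 1" "norm (x - z) \<le> norm (x - y)"
proof -
  let ?p = "\<lambda>t. (1 - t) *\<^sub>R x + t *\<^sub>R y"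
  have "\<exists>t\<ge>0. t \<le> 1 \<and> norm (?p t) = 1"
    using assms by (intro IVT') (auto intro!: continuous_intros)
  then obtain t where t: "0 \<le> t" "t \<le> 1" "norm (?p t) = 1" by blast
  have "x - ?p t = t *\<^sub>R (x - y)" by (simp add: algebra_simps)
  then have "norm (x - ?p t) = t * norm (x - y)" using t by simp
  also have "\<dots> \<le> norm (x - y)" using t by (simp add: mult_left_le_one_le)
  finally show thesis using that t by blast
qed

text \<open>The zero extension of \<open>F\<close> is Lipschitz, so its difference quotients converge boundedly,
  and each of them has integral zero by translation invariance.\<close>
lemma integral_partial_eq_0:
  fixes F :: "real^'n \<Rightarrow> real"
  assumes F: "smooth F" and zero: "\<And>x. norm x = 1 \<Longrightarrow> F x = 0"
  shows "(\<integral>x. partial i F x \<partial>ball_measure) = 0"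
proof -
  obtain L where L: "0 \<le> L" "\<And>x y. norm x \<le> 1 \<Longrightarrow> norm y \<le> 1 \<Longrightarrow> \<bar>F x - F y\<bar> \<le> L * norm (x - y)"
    using smooth_Lipschitz[OF F] by blast
  have [measurable]: "F \<in> borel_measurable borel" "partial i F \<in> borel_measurable borel"
    using F by (auto intro: smooth_measurable)
  define G where "G x = indicator (ball 0 1) x * F x" for x
  have [measurable]: "G \<in> borel_measurable borel" unfolding G_def by measurable
  \<comment> \<open>A segment leaving the ball meets the sphere, where \<open>F\<close> vanishes;
    this keeps the Lipschitz constant for the zero extension.\<close>
  have cross: "\<bar>F x\<bar> \<le> L * norm (x - y)" if x: "norm x < 1" and y: "1 \<le> norm y" for x y
  proof -
    obtain z where z: "norm z = 1" "norm (x - z) \<le> norm (x - y)"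
      using segment_meets_sphere[OF less_imp_le[OF x] y] by blast
    have "\<bar>F x\<bar> \<le> L * norm (x - z)" using L(2)[of x z] zero[OF z(1)] z(1) x by simp
    also have "\<dots> \<le> L * norm (x - y)" using z(2) L(1) by (rule mult_left_mono)
    finally show ?thesis .
  qed
  have lip: "\<bar>G x - G y\<bar> \<le> L * norm (x - y)" for x y
    using L(2)[of x y] cross[of x y] cross[of y x] L(1)
    by (cases "norm x < 1"; cases "norm y < 1") (auto simp: G_def norm_minus_commute)
  have supp: "G x = 0" if "1 \<le> norm x" for x using that by (simp add: G_def)
  define e :: "real^'n" where "e = axis i 1"
  have e: "norm e = 1" by (simp add: e_def norm_axis_1)
  define h where "h k = 1 / real (Suc k)" for k
  have h: "0 < h k" "h k \<le> 1" for k by (auto simp: h_def)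
  have h0: "h \<longlonglongrightarrow> 0" unfolding h_def using LIMSEQ_inverse_real_of_nat by (simp add: inverse_eq_divide)
  have Gint: "integrable lborel G"
  proof -
    have "integrable ball_measure F"
      by (rule continuous_integrable_ball[OF smooth_continuous[OF F]])
    then show ?thesis by (simp add: integrable_restrict_space G_def[abs_def])
  qed
  have Gint': "integrable lborel (\<lambda>x. G (c + x))" for c
    using Gint by (subst (asm) lborel_distr_plus[of c, symmetric]) (rule integrable_distr, auto)
  define D where "D k x = (G (h k *\<^sub>R e + x) - G x) / h k" for k x
  have "(\<lambda>k. \<integral>x. D k x \<partial>lborel) \<longlonglongrightarrow> (\<integral>x. indicator (ball 0 1) x *\<^sub>R partial i F x \<partial>lborel)"
  proof (rule integral_dominated_convergence)
    \<comment> \<open>The steps \<open>h k\<close> are at most 1, so all difference quotients are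
      supported in the ball of radius 2.\<close>
    show "integrable lborel (\<lambda>x::real^'n. indicator (ball 0 2) x *\<^sub>R L)"
      using emeasure_bounded_finite[OF bounded_ball, of "0::real^'n" 2]
      by (intro integrable_scaleR_left) auto
    show "AE x in lborel. norm (D k x) \<le> indicator (ball 0 2) x *\<^sub>R L" for k
    proof (rule AE_I2)
      fix x
      show "norm (D k x) \<le> indicator (ball 0 2) x *\<^sub>R L"
      proof (cases "norm x < 2")
        case True
        have "\<bar>G (h k *\<^sub>R e + x) - G x\<bar> \<le> L * h k"
          using lip[of "h k *\<^sub>R e + x" x] e h[of k] by simp
        then show ?thesis using True h[of k] by (simp add: D_def divide_le_eq)
      next
        case False
        have "norm x \<le> norm (h k *\<^sub>R e + x) + norm (h k *\<^sub>R e)"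
          using norm_triangle_ineq4[of "h k *\<^sub>R e + x" "h k *\<^sub>R e"] by simp
        then have "1 \<le> norm (h k *\<^sub>R e + x)" using False e h[of k] by simp
        then show ?thesis using False by (simp add: D_def supp)
      qed
    qed
    \<comment> \<open>Away from this null set the extension is locally either \<open>F\<close> or 0,
      so the quotients converge.\<close>
    have "sphere (0 :: real^'n) 1 \<in> null_sets lborel"
      using negligible_sphere[of "0::real^'n" 1] by (simp add: negligible_iff_null_sets null_sets_completion_iff)
    then have "AE x in lborel. x \<notin> sphere (0::real^'n) 1" by (rule AE_not_in)
    then show "AE x in lborel. (\<lambda>k. D k x) \<longlonglongrightarrow> indicator (ball 0 1) x *\<^sub>R partial i F x"
    proof eventually_elim
      case (elim x)
      have lim: "(\<lambda>k. h k *\<^sub>R e + x) \<longlonglongrightarrow> x"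
        using tendsto_add[OF tendsto_scaleR[OF h0 tendsto_const] tendsto_const] by force
      show ?case
      proof (cases "norm x < 1")
        case True
        then have "\<forall>\<^sub>F k in sequentially. h k *\<^sub>R e + x \<in> ball 0 1"
          using lim by (intro topological_tendstoD[OF lim]) auto
        moreover have "(\<lambda>k. (F (x + h k *\<^sub>R e) - F x) / h k) \<longlonglongrightarrow> partial i F x"
        proof -
          have "((\<lambda>t. F (x + t *\<^sub>R e)) has_derivative (\<lambda>t. (t *\<^sub>R e) \<bullet> grad F x)) (at 0)"
            using smooth_has_derivative[OF F, of x]
            by (intro has_derivative_compose[where f="\<lambda>t. x + t *\<^sub>R e" and g=F])
              (auto intro!: derivative_eq_intros)
          then have "((\<lambda>t. F (x + t *\<^sub>R e)) has_real_derivative partial i F x) (at 0)"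
            by (simp add: has_field_derivative_def e_def inner_axis' mult_commute_abs)
          then have "((\<lambda>t. (F (x + t *\<^sub>R e) - F x) / t) \<longlongrightarrow> partial i F x) (at 0)"
            by (simp add: DERIV_def)
          moreover have "filterlim h (at 0) sequentially"
            using h0 h by (auto simp: filterlim_at less_imp_neq[symmetric])
          ultimately show ?thesis by (rule filterlim_compose)
        qed
        ultimately show ?thesis
          using True by (auto elim!: Lim_transform_eventually eventually_mono simp: D_def G_def add.commute)
      next
        case False
        then have "x \<in> - cball 0 1" using elim by simp
        then have "\<forall>\<^sub>F k in sequentially. h k *\<^sub>R e + x \<in> - cball 0 1"
          using lim by (intro topological_tendstoD[OF lim]) auto
        then have "\<forall>\<^sub>F k in sequentially. 0 = D k x"
          by eventually_elim (use False in \<open>simp add: D_def supp\<close>)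
        then show ?thesis using False by (auto intro: Lim_transform_eventually)
      qed
    qed
  qed (unfold D_def, measurable)
  moreover have "(\<integral>x. D k x \<partial>lborel) = 0" for k
    unfolding D_def using Gint Gint' integral_translation[of G "h k *\<^sub>R e"] by simp
  ultimately show ?thesis by (simp add: integral_ball_measure LIMSEQ_const_iff)
qed

lemma grad_norm_power2: "grad (\<lambda>x::real^'n. (norm x)\<^sup>2) x = 2 *\<^sub>R x"
proof (rule grad_eqI)
  show "((\<lambda>x. (norm x)\<^sup>2) has_derivative (\<lambda>d. d \<bullet> 2 *\<^sub>R x)) (at x)"
    unfolding power2_norm_eq_inner
    by (auto intro!: derivative_eq_intros simp: inner_commute)
qed

lemma grad_norm_power: "grad (\<lambda>x::real^'n. ((norm x)\<^sup>2) ^ Suc m) x = (2 * real (Suc m) * ((norm x)\<^sup>2) ^ m) *\<^sub>R x"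
proof -
  have "((\<lambda>s::real. s ^ Suc m) has_real_derivative real (Suc m) * s ^ m) (at s)" for s
    by (rule DERIV_cong[OF DERIV_pow]) simp
  from grad_eqI[OF grad_compose_real[OF smooth_norm_power2 this]]
  have "grad (\<lambda>x::real^'n. ((norm x)\<^sup>2) ^ Suc m) x = (real (Suc m) * ((norm x)\<^sup>2) ^ m) *\<^sub>R 2 *\<^sub>R x"
    by (simp only: grad_norm_power2)
  then show ?thesis by (simp only: scaleR_scaleR mult_ac)
qed

text \<open>Apply the previous lemma to \<open>(1 - \<bar>x\<bar>\<^sup>2\<^sup>k) F\<close> and let \<open>k \<rightarrow> \<infinity>\<close>.\<close>
theorem divergence_theorem_ball:
  fixes F :: "real^'n \<Rightarrow> real"
  assumes F: "smooth F"
  shows "(\<integral>x. partial i F x \<partial>ball_measure) = (\<integral>x. F x * x $ i \<partial>sphere_measure)"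
proof -
  let ?n = "real CARD('n)"
  define G where "G x = F x * x $ i" for x
  have G: "smooth G" unfolding G_def using F by auto
  obtain L where L: "0 \<le> L" "\<And>x y. norm x \<le> 1 \<Longrightarrow> norm y \<le> 1 \<Longrightarrow> \<bar>G x - G y\<bar> \<le> L * norm (x - y)"
    using smooth_Lipschitz[OF G] by blast
  obtain C where C: "0 \<le> C" "\<And>x. norm x \<le> 1 \<Longrightarrow> norm (G x) \<le> C"
    using continuous_bounded_cball[OF smooth_continuous[OF G]] by blast
  have [measurable]: "F \<in> borel_measurable borel" "partial i F \<in> borel_measurable borel"
      "G \<in> borel_measurable borel"
    using F G by (auto intro: smooth_measurable)
  have sgn: "norm (sgn x) \<le> 1" for x :: "real^'n" by (simp add: norm_sgn)
  define p where "p m x = ((norm x)\<^sup>2) ^ m" for m and x :: "real^'n"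
  have p_eq: "p m x = norm x ^ (2 * m)" for m x by (simp add: p_def power_mult)
  have p_bd: "0 \<le> p m x" "norm x \<le> 1 \<Longrightarrow> p m x \<le> 1" for m x
    by (auto simp: p_eq power_le_one)
  have p_smooth: "smooth (p m)" for m unfolding p_def by auto
  have int_p: "integrable ball_measure (\<lambda>x. p m x * H x)" if "continuous_on UNIV H" for m and H :: "real^'n \<Rightarrow> real"
    using that smooth_continuous[OF p_smooth] by (intro continuous_integrable_ball continuous_on_mult)
  \<comment> \<open>The product of \<open>F\<close> with the cut-off \<open>1 - |x|^(2m+2)\<close>
    vanishes on the sphere; the derivative of the cut-off produces the weight
    \<open>|x|^(2m)\<close> and the factor \<open>x $ i\<close> contained in
    \<open>G\<close>.\<close>
  have key: "(\<integral>x. (1 - p (Suc m) x) * partial i F x \<partial>ball_measure)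
      = 2 * real (Suc m) * (\<integral>x. p m x * G x \<partial>ball_measure)" for m
  proof -
    have chi: "smooth (\<lambda>x. 1 - p (Suc m) x)" using p_smooth by auto
    have "partial i (\<lambda>x. 1 - p (Suc m) x) x = - (2 * real (Suc m) * p m x * x $ i)" for x
    proof -
      have "p (Suc m) = (\<lambda>x. ((norm x)\<^sup>2) ^ Suc m)" by (rule ext) (simp only: p_def)
      then have "grad (p (Suc m)) x = (2 * real (Suc m) * p m x) *\<^sub>R x"
        by (simp only: grad_norm_power p_def)
      then show ?thesis
        using arg_cong[OF grad_diff[OF smooth_const[of 1] p_smooth[of "Suc m"], of x], of "\<lambda>v. v $ i"]
          arg_cong[of "grad (p (Suc m)) x" _ "\<lambda>v. v $ i"] by simp
    qed
    note p' = this
    have eq: "partial i (\<lambda>x. (1 - p (Suc m) x) * F x) x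
        = (1 - p (Suc m) x) * partial i F x - 2 * real (Suc m) * (p m x * G x)" for x
      unfolding partial_mult[OF chi F] p' G_def by (simp add: algebra_simps)
    have "(\<integral>x. (1 - p (Suc m) x) * partial i F x - 2 * real (Suc m) * (p m x * G x) \<partial>ball_measure) = 0"
      unfolding eq[symmetric]
      by (rule integral_partial_eq_0) (use chi F in \<open>auto simp: p_def\<close>)
    moreover have "integrable ball_measure (\<lambda>x. (1 - p (Suc m) x) * partial i F x)"
      using smooth_continuous[OF chi] smooth_continuous[OF smooth_partial[OF F]]
      by (intro continuous_integrable_ball continuous_on_mult)
    ultimately show ?thesis using int_p[OF smooth_continuous[OF G], of m] by simp
  qed
  have lim1: "(\<lambda>m. \<integral>x. (1 - p (Suc m) x) * partial i F x \<partial>ball_measure) \<longlonglongrightarrow> (\<integral>x. partial i F x \<partial>ball_measure)"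
  proof (rule integral_dominated_convergence)
    show "integrable ball_measure (\<lambda>x. norm (partial i F x))"
      by (intro integrable_norm continuous_integrable_ball smooth_continuous smooth_partial F)
    show "AE x in ball_measure. norm ((1 - p (Suc m) x) * partial i F x) \<le> norm (partial i F x)" for m
      using p_bd[where m="Suc m"] by (intro AE_I2) (auto simp: abs_mult intro!: mult_left_le_one_le)
    show "AE x in ball_measure. (\<lambda>m. (1 - p (Suc m) x) * partial i F x) \<longlonglongrightarrow> partial i F x"
    proof (rule AE_I2)
      fix x :: "real^'n" assume "x \<in> space ball_measure"
      then have "(norm x)\<^sup>2 < 1" by (simp add: power_less_one_iff)
      then have "(\<lambda>m. p (Suc m) x) \<longlonglongrightarrow> 0"
        unfolding p_def by (intro LIMSEQ_Suc LIMSEQ_realpow_zero) auto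
      then show "(\<lambda>m. (1 - p (Suc m) x) * partial i F x) \<longlonglongrightarrow> partial i F x"
        using tendsto_mult_right[OF tendsto_diff[OF tendsto_const[of 1]]] by fastforce
    qed
  qed (auto intro!: measurable_ball_measure borel_measurable_continuous_onI continuous_intros
        smooth_continuous[OF p_smooth] smooth_continuous[OF smooth_partial[OF F]])
  \<comment> \<open>The weights \<open>2 (m + 1) |x|^(2m)\<close> concentrate at the sphere. For a
    function constant along rays the integral is explicit by \<open>integral_radial_power\<close>;
    the Lipschitz bound controls the replacement of \<open>G x\<close> by
    \<open>G (sgn x)\<close>.\<close>
  have lim2: "(\<lambda>m. 2 * real (Suc m) * (\<integral>x. p m x * G x \<partial>ball_measure)) \<longlonglongrightarrow> ?n * (\<integral>x. G (sgn x) \<partial>ball_measure)"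
  proof -
    define I J :: real where "I = (\<integral>x. G (sgn x) \<partial>ball_measure)" and "J = (\<integral>x. 1 \<partial>(ball_measure :: (real^'n) measure))"
    have pG: "(\<integral>x. p m x * G (sgn x) \<partial>ball_measure) = ?n / (2 * real m + ?n) * I" for m
      unfolding p_eq I_def using C by (subst integral_radial_power[of G C]) auto
    have pw: "(\<integral>x. norm x ^ j \<partial>(ball_measure :: (real^'n) measure)) = ?n / (real j + ?n) * J" for j
      unfolding J_def using integral_radial_power[of "\<lambda>_::real^'n. 1" 1 j] by simp
    have ip: "integrable ball_measure (\<lambda>x. p m x * G (sgn x))" for m
    proof (rule integrable_ball_bounded[of _ C])
      show "(\<lambda>x. p m x * G (sgn x)) \<in> borel_measurable borel" unfolding p_def by measurable
      fix x :: "real^'n" assume "norm x < 1"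
      then have "p m x * norm (G (sgn x)) \<le> 1 * C"
        using C(2)[OF sgn, of x] p_bd[where m=m and x=x] by (intro mult_mono) auto
      then show "norm (p m x * G (sgn x)) \<le> C" using p_bd(1)[of m x] by (simp add: abs_mult)
    qed
    \<comment> \<open>Since \<open>|x - sgn x| = 1 - |x|\<close> away from 0, the error is at most
      \<open>L\<close> times the integral of \<open>|x|^(2m) (1 - |x|)\<close>. This is O(1/m^2) and
      beats the factor \<open>2 (m + 1)\<close>.\<close>
    have bound: "\<bar>(\<integral>x. p m x * G x \<partial>ball_measure) - ?n / (2 * real m + ?n) * I\<bar>
        \<le> L * (?n / (2 * real m + ?n) * J - ?n / (2 * real m + 1 + ?n) * J)" for m
    proof -
      have i1: "integrable ball_measure (\<lambda>x::real^'n. norm x ^ j)" for j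
        by (intro continuous_integrable_ball continuous_intros)
      have "(\<integral>x. p m x * G x \<partial>ball_measure) - ?n / (2 * real m + ?n) * I
          = (\<integral>x. p m x * (G x - G (sgn x)) \<partial>ball_measure)"
        using ip int_p[OF smooth_continuous[OF G]] by (simp add: right_diff_distrib pG)
      also have "\<bar>\<dots>\<bar> \<le> (\<integral>x. \<bar>p m x * (G x - G (sgn x))\<bar> \<partial>ball_measure)"
        by (rule integral_abs_bound)
      also have "\<dots> \<le> (\<integral>x. L * (norm x ^ (2 * m) - norm x ^ (2 * m + 1)) \<partial>(ball_measure :: (real^'n) measure))"
      proof (rule integral_mono)
        show "integrable ball_measure (\<lambda>x. \<bar>p m x * (G x - G (sgn x))\<bar>)"
          using ip int_p[OF smooth_continuous[OF G]] by (simp add: right_diff_distrib)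
        show "integrable ball_measure (\<lambda>x::real^'n. L * (norm x ^ (2 * m) - norm x ^ (2 * m + 1)))"
          using i1[of "2*m"] i1[of "2*m+1"] by simp
        fix x :: "real^'n" assume x: "x \<in> space ball_measure"
        have "\<bar>G x - G (sgn x)\<bar> \<le> L * (1 - norm x)"
        proof (cases "x = 0")
          case False
          have "x - sgn x = (1 - 1 / norm x) *\<^sub>R x" by (simp add: sgn_div_norm algebra_simps divide_inverse)
          then have "norm (x - sgn x) = \<bar>1 - 1 / norm x\<bar> * norm x" by simp
          also have "\<dots> = 1 - norm x" using False x by (simp add: field_simps abs_if)
          finally show ?thesis using L(2)[of x "sgn x"] x sgn[of x] by simp
        qed (use L in simp)
        then have "p m x * \<bar>G x - G (sgn x)\<bar> \<le> p m x * (L * (1 - norm x))"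
          using p_bd by (intro mult_left_mono) auto
        then show "\<bar>p m x * (G x - G (sgn x))\<bar> \<le> L * (norm x ^ (2 * m) - norm x ^ (2 * m + 1))"
          unfolding abs_mult using p_bd(1)[of m x] by (simp add: p_eq) (simp add: algebra_simps)
      qed
      also have "\<dots> = L * (?n / (2 * real m + ?n) * J - ?n / (2 * real m + 1 + ?n) * J)"
        using i1[of "2*m"] i1[of "2*m+1"] pw[of "2*m"] pw[of "2*m+1"] by (simp add: add.commute)
      finally show ?thesis .
    qed
    have n: "0 < ?n" by simp
    have "(\<lambda>m. 2 * real (Suc m) * (\<integral>x. p m x * G x \<partial>ball_measure) - 2 * real (Suc m) * (?n / (2 * real m + ?n) * I)) \<longlonglongrightarrow> 0"
    proof (rule Lim_null_comparison[OF always_eventually], intro allI)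
      show "norm (2 * real (Suc m) * (\<integral>x. p m x * G x \<partial>ball_measure) - 2 * real (Suc m) * (?n / (2 * real m + ?n) * I))
        \<le> 2 * real (Suc m) * (L * (?n / (2 * real m + ?n) * J - ?n / (2 * real m + 1 + ?n) * J))" for m
        unfolding right_diff_distrib[symmetric] real_norm_def abs_mult
        using mult_left_mono[OF bound[of m], of "2 * real (Suc m)"] by simp
      show "(\<lambda>m. 2 * real (Suc m) * (L * (?n / (2 * real m + ?n) * J - ?n / (2 * real m + 1 + ?n) * J))) \<longlonglongrightarrow> 0"
        using n by real_asymp
    qed
    moreover have "(\<lambda>m. 2 * real (Suc m) * (?n / (2 * real m + ?n) * I)) \<longlonglongrightarrow> ?n * I"
      using n by real_asymp
    ultimately show ?thesis
      using tendsto_add[of _ 0 _ _ "?n * I"] unfolding I_def by fastforce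
  qed
  have "(\<integral>x. partial i F x \<partial>ball_measure) = ?n * (\<integral>x. G (sgn x) \<partial>ball_measure)"
    using LIMSEQ_unique[OF lim1] lim2 unfolding key by blast
  also have "\<dots> = (\<integral>x. G x \<partial>sphere_measure)"
    by (rule integral_sphere_measure[symmetric]) simp
  finally show ?thesis by (simp add: G_def)
qed

section \<open>The closure of smooth functions with respect to values, gradients and boundary
  values\<close>

section \<open>Traces and weak gradients as limits of smooth functions\<close>

text \<open>The closure of the graph of \<phi> \<mapsto> (\<phi>, grad \<phi>, \<phi> on the sphere)
  in a product of three L2 spaces. Carrying the gradient as an explicit component avoids the choice
  inside \<open>weak_grad\<close> and turns linearity, the Leibniz rule and closedness into
  statements about limits.\<close>

definition sobolev_triple ::
    "(real^'n \<Rightarrow> real) \<Rightarrow> (real^'n \<Rightarrow> real^'n) \<Rightarrow> (real^'n \<Rightarrow> real) \<Rightarrow> bool" where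
  "sobolev_triple u G f \<longleftrightarrow> (\<exists>\<phi>. (\<forall>k. smooth (\<phi> k)) \<and> L2_tendsto ball_measure \<phi> u \<and>
     L2_tendsto ball_measure (\<lambda>k. grad (\<phi> k)) G \<and> L2_tendsto sphere_measure \<phi> f)"

lemma sobolev_tripleE:
  assumes "sobolev_triple u G f"
  obtains \<phi> where "\<And>k. smooth (\<phi> k)" "L2_tendsto ball_measure \<phi> u"
    "L2_tendsto ball_measure (\<lambda>k. grad (\<phi> k)) G" "L2_tendsto sphere_measure \<phi> f"
  using assms unfolding sobolev_triple_def by blast

lemma sobolev_triple_L2:
  assumes "sobolev_triple u G f"
  shows "u \<in> L2 ball_measure" "G \<in> L2 ball_measure" "f \<in> L2 sphere_measure"
  using assms by (auto elim!: sobolev_tripleE dest: L2_tendsto_L2(2))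

lemma smooth_L2_ball: "smooth \<phi> \<Longrightarrow> \<phi> \<in> L2 ball_measure"
  by (intro continuous_L2_ball smooth_continuous)

lemma smooth_grad_L2_ball: "smooth \<phi> \<Longrightarrow> grad \<phi> \<in> L2 ball_measure"
  by (intro continuous_L2_ball smooth_continuous_grad)

lemma smooth_L2_sphere:
  fixes \<phi> :: "real^'n \<Rightarrow> real"
  assumes "smooth \<phi>" shows "\<phi> \<in> L2 sphere_measure"
proof -
  obtain C where "\<And>x. norm x \<le> 1 \<Longrightarrow> norm (\<phi> x) \<le> C"
    using continuous_bounded_cball[OF smooth_continuous[OF assms]] by blast
  then show ?thesis
    by (intro L2_bounded[OF finite_sphere_measure, where C=C] measurable_sphere_measure
        smooth_measurable assms) auto
qed

lemma sobolev_triple_smooth: "smooth \<phi> \<Longrightarrow> sobolev_triple \<phi> (grad \<phi>) \<phi>"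
  unfolding sobolev_triple_def
  by (intro exI[of _ "\<lambda>_. \<phi>"])
    (auto intro!: L2_tendsto_const smooth_L2_ball smooth_grad_L2_ball smooth_L2_sphere)

lemma L2_tendsto_scaleR_bounded:
  fixes f :: "'a \<Rightarrow> 'b::euclidean_space"
  assumes F: "L2_tendsto M F f" and c: "c \<in> borel_measurable M" "\<And>x. x \<in> space M \<Longrightarrow> \<bar>c x\<bar> \<le> C"
  shows "L2_tendsto M (\<lambda>k x. c x *\<^sub>R F k x) (\<lambda>x. c x *\<^sub>R f x)"
proof (rule L2_tendsto_dominated[OF F, where C="\<bar>C\<bar>"])
  have bd: "\<bar>c x\<bar> \<le> \<bar>C\<bar>" if "x \<in> space M" for x using c(2)[OF that] by linarith
  show "(\<lambda>x. c x *\<^sub>R F k x) \<in> borel_measurable M" for k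
    using c(1) L2_measurable[OF L2_tendsto_L2(1)[OF F]] by measurable
  show "(\<lambda>x. c x *\<^sub>R f x) \<in> L2 M"
    using c(1) L2_measurable[OF L2_tendsto_L2(2)[OF F]] bd
    by (intro L2_dominated[OF L2_tendsto_L2(2)[OF F], where C="\<bar>C\<bar>"])
      (auto intro: mult_right_mono)
  show "norm (c x *\<^sub>R F k x - c x *\<^sub>R f x) \<le> \<bar>C\<bar> * norm (F k x - f x)" if "x \<in> space M" for k x
    using bd[OF that] by (simp add: mult_right_mono flip: scaleR_diff_right)
qed simp

lemma L2_tendsto_inner_bounded:
  fixes f :: "'a \<Rightarrow> 'b::euclidean_space"
  assumes F: "L2_tendsto M F f" and Y: "Y \<in> borel_measurable M" "\<And>x. x \<in> space M \<Longrightarrow> norm (Y x) \<le> C"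
  shows "L2_tendsto M (\<lambda>k x. Y x \<bullet> F k x) (\<lambda>x. Y x \<bullet> f x)"
proof (rule L2_tendsto_dominated[OF F, where C="\<bar>C\<bar>"])
  have bd: "norm (Y x \<bullet> z) \<le> \<bar>C\<bar> * norm z" if "x \<in> space M" for x z
  proof -
    have "norm (Y x \<bullet> z) \<le> norm (Y x) * norm z" by (simp add: Cauchy_Schwarz_ineq2)
    also have "\<dots> \<le> \<bar>C\<bar> * norm z" using Y(2)[OF that] by (intro mult_right_mono) auto
    finally show ?thesis .
  qed
  show "(\<lambda>x. Y x \<bullet> F k x) \<in> borel_measurable M" for k
    using Y(1) L2_measurable[OF L2_tendsto_L2(1)[OF F]] by measurable
  show "(\<lambda>x. Y x \<bullet> f x) \<in> L2 M"
    using Y(1) L2_measurable[OF L2_tendsto_L2(2)[OF F]] bd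
    by (intro L2_dominated[OF L2_tendsto_L2(2)[OF F], where C="\<bar>C\<bar>"]) auto
  show "norm (Y x \<bullet> F k x - Y x \<bullet> f x) \<le> \<bar>C\<bar> * norm (F k x - f x)" if "x \<in> space M" for k x
    using bd[OF that] by (simp flip: inner_diff_right)
qed simp

lemma L2_tendsto_ball_scaleR:
  fixes f :: "real^'n \<Rightarrow> 'b::euclidean_space"
  assumes "L2_tendsto ball_measure F f" "continuous_on UNIV c"
  shows "L2_tendsto ball_measure (\<lambda>k x. c x *\<^sub>R F k x) (\<lambda>x. c x *\<^sub>R f x)"
proof -
  obtain C where C: "\<And>x. norm x \<le> 1 \<Longrightarrow> norm (c x) \<le> C"
    using continuous_bounded_cball[OF continuous_on_subset[OF assms(2) subset_UNIV]] by blast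
  show ?thesis
    by (rule L2_tendsto_scaleR_bounded[OF assms(1), where C=C])
      (use C in \<open>auto intro!: measurable_ball_measure borel_measurable_continuous_onI assms(2)\<close>)
qed

lemma L2_tendsto_ball_inner:
  fixes f :: "real^'n \<Rightarrow> 'b::euclidean_space"
  assumes "L2_tendsto ball_measure F f" "continuous_on UNIV Y"
  shows "L2_tendsto ball_measure (\<lambda>k x. Y x \<bullet> F k x) (\<lambda>x. Y x \<bullet> f x)"
proof -
  obtain C where C: "\<And>x. norm x \<le> 1 \<Longrightarrow> norm (Y x) \<le> C"
    using continuous_bounded_cball[OF continuous_on_subset[OF assms(2) subset_UNIV]] by blast
  show ?thesis
    by (rule L2_tendsto_inner_bounded[OF assms(1), where C=C])
      (use C in \<open>auto intro!: measurable_ball_measure borel_measurable_continuous_onI assms(2)\<close>)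
qed

lemma L2_tendsto_sphere_scaleR:
  fixes f :: "real^'n \<Rightarrow> 'b::euclidean_space"
  assumes "L2_tendsto sphere_measure F f" "continuous_on UNIV c"
  shows "L2_tendsto sphere_measure (\<lambda>k x. c x *\<^sub>R F k x) (\<lambda>x. c x *\<^sub>R f x)"
proof -
  obtain C where C: "\<And>x. norm x \<le> 1 \<Longrightarrow> norm (c x) \<le> C"
    using continuous_bounded_cball[OF continuous_on_subset[OF assms(2) subset_UNIV]] by blast
  show ?thesis
    by (rule L2_tendsto_scaleR_bounded[OF assms(1), where C=C])
      (use C in \<open>auto intro!: measurable_sphere_measure borel_measurable_continuous_onI assms(2)\<close>)
qed

lemma sobolev_triple_add:
  assumes "sobolev_triple u G f" "sobolev_triple v K g"
  shows "sobolev_triple (\<lambda>x. u x + v x) (\<lambda>x. G x + K x) (\<lambda>x. f x + g x)"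
proof -
  obtain \<phi> where \<phi>: "\<And>k. smooth (\<phi> k)" "L2_tendsto ball_measure \<phi> u"
    "L2_tendsto ball_measure (\<lambda>k. grad (\<phi> k)) G" "L2_tendsto sphere_measure \<phi> f"
    using sobolev_tripleE[OF assms(1)] by blast
  obtain \<psi> where \<psi>: "\<And>k. smooth (\<psi> k)" "L2_tendsto ball_measure \<psi> v"
    "L2_tendsto ball_measure (\<lambda>k. grad (\<psi> k)) K" "L2_tendsto sphere_measure \<psi> g"
    using sobolev_tripleE[OF assms(2)] by blast
  have "grad (\<lambda>x. \<phi> k x + \<psi> k x) = (\<lambda>x. grad (\<phi> k) x + grad (\<psi> k) x)" for k
    using grad_add[OF \<phi>(1) \<psi>(1)] by blast
  then show ?thesis unfolding sobolev_triple_def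
    using \<phi> \<psi> L2_tendsto_add[OF \<phi>(2) \<psi>(2)] L2_tendsto_add[OF \<phi>(3) \<psi>(3)] L2_tendsto_add[OF \<phi>(4) \<psi>(4)]
    by (intro exI[of _ "\<lambda>k x. \<phi> k x + \<psi> k x"]) auto
qed

text \<open>The Leibniz rule for the approximants passes to the limit because \<open>W\<close> and
  its gradient are bounded on the closed ball.\<close>

lemma sobolev_triple_mult_smooth:
  assumes W: "smooth W" and "sobolev_triple u G f"
  shows "sobolev_triple (\<lambda>x. W x * u x) (\<lambda>x. W x *\<^sub>R G x + u x *\<^sub>R grad W x) (\<lambda>x. W x * f x)"
proof -
  obtain \<phi> where \<phi>: "\<And>k. smooth (\<phi> k)" "L2_tendsto ball_measure \<phi> u"
    "L2_tendsto ball_measure (\<lambda>k. grad (\<phi> k)) G" "L2_tendsto sphere_measure \<phi> f"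
    using sobolev_tripleE[OF assms(2)] by blast
  note W' = smooth_continuous[OF W, of UNIV] smooth_continuous_grad[OF W, of UNIV]
  have g: "grad (\<lambda>x. W x * \<phi> k x) = (\<lambda>x. W x *\<^sub>R grad (\<phi> k) x + \<phi> k x *\<^sub>R grad W x)" for k
    using grad_mult[OF W \<phi>(1)] by blast
  obtain C where C: "0 \<le> C" "\<And>x. norm x \<le> 1 \<Longrightarrow> norm (grad W x) \<le> C"
    using continuous_bounded_cball[OF smooth_continuous_grad[OF W]] by blast
  have uW: "L2_tendsto ball_measure (\<lambda>k x. \<phi> k x *\<^sub>R grad W x) (\<lambda>x. u x *\<^sub>R grad W x)"
  proof (rule L2_tendsto_dominated[OF \<phi>(2) _ _ C(1)])
    have [measurable]: "grad W \<in> borel_measurable ball_measure" "u \<in> borel_measurable ball_measure"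
      "\<phi> k \<in> borel_measurable ball_measure" for k
      using smooth_grad_measurable[OF W] L2_tendsto_L2[OF \<phi>(2)]
      by (auto intro: measurable_ball_measure L2_measurable)
    show "(\<lambda>x. \<phi> k x *\<^sub>R grad W x) \<in> borel_measurable ball_measure" for k by measurable
    show "(\<lambda>x. u x *\<^sub>R grad W x) \<in> L2 ball_measure"
      by (rule L2_dominated[OF L2_tendsto_L2(2)[OF \<phi>(2)], where C=C])
        (use C in \<open>auto simp: mult.commute[of C] intro!: mult_left_mono\<close>)
    show "norm (\<phi> k x *\<^sub>R grad W x - u x *\<^sub>R grad W x) \<le> C * norm (\<phi> k x - u x)"
      if "x \<in> space ball_measure" for k x
      using C that by (simp add: mult.commute[of C] mult_left_mono flip: scaleR_diff_left)
  qed
  have s: "smooth (\<lambda>x. W x * \<phi> k x)" for k using W \<phi>(1) by auto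
  show ?thesis unfolding sobolev_triple_def
    using s L2_tendsto_ball_scaleR[OF \<phi>(2) W'(1)]
      L2_tendsto_add[OF L2_tendsto_ball_scaleR[OF \<phi>(3) W'(1)] uW] L2_tendsto_sphere_scaleR[OF \<phi>(4) W'(1)]
    by (intro exI[of _ "\<lambda>k x. W x * \<phi> k x"]) (auto simp: g)
qed

lemma sobolev_triple_scaleR:
  assumes "sobolev_triple u G f"
  shows "sobolev_triple (\<lambda>x. c * u x) (\<lambda>x. c *\<^sub>R G x) (\<lambda>x. c * f x)"
  using sobolev_triple_mult_smooth[OF smooth_const assms, of c] by simp

lemma sobolev_triple_diff:
  assumes "sobolev_triple u G f" "sobolev_triple v K g"
  shows "sobolev_triple (\<lambda>x. u x - v x) (\<lambda>x. G x - K x) (\<lambda>x. f x - g x)"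
  using sobolev_triple_add[OF assms(1) sobolev_triple_scaleR[OF assms(2), of "-1"]] by simp

lemma test_function_eq_0:
  assumes "test_function (ball 0 1) \<psi>" "norm x = 1"
  shows "\<psi> x = 0"
  using assms closure_subset[of "{x. \<psi> x \<noteq> 0}"] by (auto simp: test_function_def)

text \<open>The product of a smooth approximant with a test function vanishes on the sphere, so its
  partial derivatives integrate to zero. Both sides of the resulting integration by parts are L2
  pairings and pass to the limit.\<close>

lemma sobolev_triple_has_weak_grad:
  fixes u :: "real^'n \<Rightarrow> real"
  assumes "sobolev_triple u G f"
  shows "has_weak_grad (ball 0 1) u G"
  unfolding has_weak_grad_def
proof (intro allI impI)
  fix \<psi> :: "real^'n \<Rightarrow> real" and i assume \<psi>: "test_function (ball 0 1) \<psi>"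
  then have s: "smooth \<psi>" by (simp add: test_function_def)
  obtain \<phi> where \<phi>: "\<And>k. smooth (\<phi> k)" "L2_tendsto ball_measure \<phi> u"
    "L2_tendsto ball_measure (\<lambda>k. grad (\<phi> k)) G"
    using sobolev_tripleE[OF assms] by blast
  have 1: "(\<lambda>k. \<integral>x. \<phi> k x * partial i \<psi> x \<partial>ball_measure) \<longlonglongrightarrow> (\<integral>x. u x * partial i \<psi> x \<partial>ball_measure)"
    using L2_tendsto_inner[OF \<phi>(2) L2_tendsto_const[OF smooth_L2_ball[OF smooth_partial[OF s, of i]]]]
    by simp
  have "(\<lambda>x. \<psi> x *\<^sub>R (axis i 1 :: real^'n)) \<in> L2 ball_measure"
    by (intro continuous_L2_ball continuous_intros smooth_continuous s)
  from L2_tendsto_inner[OF \<phi>(3) L2_tendsto_const[OF this]]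
  have 2: "(\<lambda>k. \<integral>x. partial i (\<phi> k) x * \<psi> x \<partial>ball_measure) \<longlonglongrightarrow> (\<integral>x. G x $ i * \<psi> x \<partial>ball_measure)"
    by (simp add: inner_axis mult.commute)
  have "(\<integral>x. \<phi> k x * partial i \<psi> x \<partial>ball_measure) = - (\<integral>x. partial i (\<phi> k) x * \<psi> x \<partial>ball_measure)" for k
  proof -
    have "(\<integral>x. partial i (\<lambda>x. \<phi> k x * \<psi> x) x \<partial>ball_measure) = 0"
      by (rule integral_partial_eq_0) (use \<phi>(1) s test_function_eq_0[OF \<psi>] in auto)
    moreover have "integrable ball_measure (\<lambda>x. \<phi> k x * partial i \<psi> x)"
      "integrable ball_measure (\<lambda>x. \<psi> x * partial i (\<phi> k) x)"
      by (intro continuous_integrable_ball continuous_intros smooth_continuous smooth_partial \<phi>(1) s)+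
    ultimately show ?thesis unfolding partial_mult[OF \<phi>(1) s] by (simp add: mult.commute)
  qed
  then show "(\<integral>x. u x * partial i \<psi> x \<partial>ball_measure) = - (\<integral>x. G x $ i * \<psi> x \<partial>ball_measure)"
    using LIMSEQ_unique[OF 1] tendsto_minus[OF 2] by simp
qed

lemma has_weak_grad_unique:
  fixes G K :: "real^'n \<Rightarrow> real^'n"
  assumes G: "G \<in> L2 ball_measure" "has_weak_grad (ball 0 1) u G"
    and K: "K \<in> L2 ball_measure" "has_weak_grad (ball 0 1) u K"
  shows "AE x in ball_measure. G x = K x"
proof -
  have "(\<lambda>_::real^'n. 1::real) \<in> L2 ball_measure"
    by (intro continuous_L2_ball continuous_intros)
  have comp: "(\<lambda>x. H x $ i) \<in> L2 ball_measure" if "H \<in> L2 ball_measure" for H :: "real^'n \<Rightarrow> real^'n" and i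
    using L2_measurable[OF that]
    by (intro L2_dominated[OF that, where C=1])
      (auto simp: component_le_norm_cart intro!: measurable_compose[OF _ borel_measurable_nth])
  have "AE x in ball_measure. G x $ i - K x $ i = 0" for i
  proof (rule test_functions_separate)
    show "integrable ball_measure (\<lambda>x. G x $ i - K x $ i)"
      using L2_integrable_mult[OF L2_diff[OF comp[OF G(1)] comp[OF K(1)]] \<open>(\<lambda>_. 1) \<in> _\<close>] by simp
    fix \<phi> :: "real^'n \<Rightarrow> real" assume \<phi>: "test_function (ball 0 1) \<phi>"
    then have "\<phi> \<in> L2 ball_measure" by (simp add: test_function_def smooth_L2_ball)
    note int = L2_integrable_mult[OF comp[OF G(1)] this] L2_integrable_mult[OF comp[OF K(1)] this]
    have "(\<integral>x. G x $ i * \<phi> x \<partial>ball_measure) = (\<integral>x. K x $ i * \<phi> x \<partial>ball_measure)"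
      using G(2)[unfolded has_weak_grad_def, rule_format, OF \<phi>, of i]
        K(2)[unfolded has_weak_grad_def, rule_format, OF \<phi>, of i] by simp
    then show "(\<integral>x. (G x $ i - K x $ i) * \<phi> x \<partial>ball_measure) = 0"
      using int by (simp add: left_diff_distrib)
  qed
  then have "AE x in ball_measure. \<forall>i\<in>UNIV. G x $ i - K x $ i = 0"
    by (intro AE_finite_allI) auto
  then show ?thesis by eventually_elim (simp add: vec_eq_iff)
qed

lemma weak_gradI:
  assumes "u \<in> H1 (ball 0 1)"
  shows "weak_grad (ball 0 1) u \<in> L2 ball_measure" "has_weak_grad (ball 0 1) u (weak_grad (ball 0 1) u)"
proof -
  have "\<exists>G. G \<in> L2 ball_measure \<and> has_weak_grad (ball 0 1) u G"
    using assms by (auto simp: H1_def)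
  from someI_ex[OF this]
  show "weak_grad (ball 0 1) u \<in> L2 ball_measure" "has_weak_grad (ball 0 1) u (weak_grad (ball 0 1) u)"
    by (auto simp: weak_grad_def)
qed

lemma sobolev_triple_H1: "sobolev_triple u G f \<Longrightarrow> u \<in> H1 (ball 0 1)"
  unfolding H1_def using sobolev_triple_has_weak_grad sobolev_triple_L2(1,2) by blast

lemma sobolev_triple_weak_grad:
  assumes "sobolev_triple u G f"
  shows "AE x in ball_measure. G x = weak_grad (ball 0 1) u x"
  by (rule has_weak_grad_unique[OF sobolev_triple_L2(2)[OF assms] sobolev_triple_has_weak_grad[OF assms]
      weak_gradI[OF sobolev_triple_H1[OF assms]]])

lemma sobolev_triple_cong_weak_grad:
  assumes "sobolev_triple u G f"
  shows "sobolev_triple u (weak_grad (ball 0 1) u) f"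
proof -
  obtain \<phi> where \<phi>: "\<And>k. smooth (\<phi> k)" "L2_tendsto ball_measure \<phi> u"
    "L2_tendsto ball_measure (\<lambda>k. grad (\<phi> k)) G" "L2_tendsto sphere_measure \<phi> f"
    using sobolev_tripleE[OF assms] by blast
  have "L2_tendsto ball_measure (\<lambda>k. grad (\<phi> k)) (weak_grad (ball 0 1) u)"
    by (rule L2_tendsto_cong_AE[OF \<phi>(3) sobolev_triple_weak_grad[OF assms]
      L2_measurable[OF weak_gradI(1)[OF sobolev_triple_H1[OF assms]]]])
  with \<phi> show ?thesis unfolding sobolev_triple_def by blast
qed

lemma L2_norm_tendsto_0_iff:
  "(\<lambda>k. L2_norm M (\<lambda>x. F k x - f x)) \<longlonglongrightarrow> 0 \<longleftrightarrow> (\<lambda>k. \<integral>x. (norm (F k x - f x))\<^sup>2 \<partial>M) \<longlonglongrightarrow> 0"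
proof
  assume "(\<lambda>k. \<integral>x. (norm (F k x - f x))\<^sup>2 \<partial>M) \<longlonglongrightarrow> 0"
  from tendsto_real_sqrt[OF this] show "(\<lambda>k. L2_norm M (\<lambda>x. F k x - f x)) \<longlonglongrightarrow> 0"
    by (simp add: L2_norm_def)
next
  assume "(\<lambda>k. L2_norm M (\<lambda>x. F k x - f x)) \<longlonglongrightarrow> 0"
  from tendsto_power[OF this, of 2] show "(\<lambda>k. \<integral>x. (norm (F k x - f x))\<^sup>2 \<partial>M) \<longlonglongrightarrow> 0"
    by (simp add: L2_norm_power2)
qed

text \<open>The link between the given notion of trace and triples. The integral of a sum of two
  squares tends to 0 exactly if both integrals do, and smooth functions lie in all the
  \<open>L2\<close> spaces involved.\<close>

lemma has_trace_iff: "has_trace u f \<longleftrightarrow> sobolev_triple u (weak_grad (ball 0 1) u) f"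
proof -
  let ?G = "weak_grad (ball 0 1) u"
  have eq: "((\<lambda>k. \<integral>x. (\<phi> k x - u x)\<^sup>2 + (norm (grad (\<phi> k) x - ?G x))\<^sup>2 \<partial>ball_measure) \<longlonglongrightarrow> 0 \<and>
        (\<lambda>k. \<integral>x. (\<phi> k x - f x)\<^sup>2 \<partial>sphere_measure) \<longlonglongrightarrow> 0) \<longleftrightarrow>
      (L2_tendsto ball_measure \<phi> u \<and> L2_tendsto ball_measure (\<lambda>k. grad (\<phi> k)) ?G \<and>
       L2_tendsto sphere_measure \<phi> f)"
    if s: "\<And>k. smooth (\<phi> k)" and u: "u \<in> H1 (ball 0 1)" and f: "f \<in> L2 sphere_measure" for \<phi>
  proof -
    have uL: "u \<in> L2 ball_measure" using u by (simp add: H1_def)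
    note L = uL weak_gradI(1)[OF u] f smooth_L2_ball[OF s] smooth_grad_L2_ball[OF s] smooth_L2_sphere[OF s]
    define a b where "a k = (\<integral>x. (norm (\<phi> k x - u x))\<^sup>2 \<partial>ball_measure)"
      and "b k = (\<integral>x. (norm (grad (\<phi> k) x - ?G x))\<^sup>2 \<partial>ball_measure)" for k
    have sum: "(\<integral>x. (\<phi> k x - u x)\<^sup>2 + (norm (grad (\<phi> k) x - ?G x))\<^sup>2 \<partial>ball_measure) = a k + b k" for k
      using L2_integrable[OF L2_diff[OF L(4) L(1), of k]] L2_integrable[OF L2_diff[OF L(5) L(2), of k]]
      by (simp add: a_def b_def)
    have "(\<lambda>k. a k + b k) \<longlonglongrightarrow> 0 \<longleftrightarrow> a \<longlonglongrightarrow> 0 \<and> b \<longlonglongrightarrow> 0"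
    proof
      assume ab: "(\<lambda>k. a k + b k) \<longlonglongrightarrow> 0"
      have "0 \<le> a k" "0 \<le> b k" for k by (auto simp: a_def b_def)
      then have "\<forall>\<^sub>F k in sequentially. norm (a k) \<le> a k + b k" "\<forall>\<^sub>F k in sequentially. norm (b k) \<le> a k + b k"
        by simp_all
      then show "a \<longlonglongrightarrow> 0 \<and> b \<longlonglongrightarrow> 0"
        using Lim_null_comparison[OF _ ab] by blast
    next
      assume "a \<longlonglongrightarrow> 0 \<and> b \<longlonglongrightarrow> 0"
      then show "(\<lambda>k. a k + b k) \<longlonglongrightarrow> 0" using tendsto_add_zero by blast
    qed
    then show ?thesis
      using L unfolding sum L2_tendsto_def L2_norm_tendsto_0_iff a_def b_def by auto
  qed
  show ?thesis
  proof
    assume h: "has_trace u f"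
    then obtain \<phi> where \<phi>: "\<And>k. smooth (\<phi> k)"
      "(\<lambda>k. \<integral>x. (\<phi> k x - u x)\<^sup>2 + (norm (grad (\<phi> k) x - ?G x))\<^sup>2 \<partial>ball_measure) \<longlonglongrightarrow> 0"
      "(\<lambda>k. \<integral>x. (\<phi> k x - f x)\<^sup>2 \<partial>sphere_measure) \<longlonglongrightarrow> 0"
      unfolding has_trace_def by blast
    have "u \<in> H1 (ball 0 1)" "f \<in> L2 sphere_measure" using h by (auto simp: has_trace_def)
    from eq[of \<phi>, OF \<phi>(1) this] \<phi>(2,3) have "L2_tendsto ball_measure \<phi> u \<and>
        L2_tendsto ball_measure (\<lambda>k. grad (\<phi> k)) ?G \<and> L2_tendsto sphere_measure \<phi> f" by simp
    with \<phi>(1) show "sobolev_triple u ?G f"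
      unfolding sobolev_triple_def by blast
  next
    assume h: "sobolev_triple u ?G f"
    then obtain \<phi> where \<phi>: "\<And>k. smooth (\<phi> k)" "L2_tendsto ball_measure \<phi> u"
      "L2_tendsto ball_measure (\<lambda>k. grad (\<phi> k)) ?G" "L2_tendsto sphere_measure \<phi> f"
      using sobolev_tripleE by blast
    note H = sobolev_triple_H1[OF h] sobolev_triple_L2(3)[OF h]
    from eq[of \<phi>, OF \<phi>(1) H] \<phi>(2-4) have "(\<lambda>k. \<integral>x. (\<phi> k x - u x)\<^sup>2 + (norm (grad (\<phi> k) x - ?G x))\<^sup>2 \<partial>ball_measure) \<longlonglongrightarrow> 0 \<and>
        (\<lambda>k. \<integral>x. (\<phi> k x - f x)\<^sup>2 \<partial>sphere_measure) \<longlonglongrightarrow> 0" by simp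
    with \<phi>(1) H show "has_trace u f"
      unfolding has_trace_def by blast
  qed
qed

lemma sobolev_triple_has_trace: "sobolev_triple u G f \<Longrightarrow> has_trace u f"
  by (simp add: has_trace_iff sobolev_triple_cong_weak_grad)

text \<open>The gradient in a triple agrees almost everywhere with the chosen weak gradient, so the
  form can be computed from explicit gradients.\<close>

lemma schrodinger_form_eq:
  assumes u: "sobolev_triple u G f" and v: "sobolev_triple v K g"
    and q: "q \<in> borel_measurable ball_measure"
  shows "schrodinger_form q u v = (\<integral>x. G x \<bullet> K x + q x * u x * v x \<partial>ball_measure)"
  unfolding schrodinger_form_def
proof (rule integral_cong_AE)
  note L = sobolev_triple_L2[OF u, THEN L2_measurable] sobolev_triple_L2[OF v, THEN L2_measurable]
    weak_gradI(1)[OF sobolev_triple_H1[OF u], THEN L2_measurable]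
    weak_gradI(1)[OF sobolev_triple_H1[OF v], THEN L2_measurable]
  show "(\<lambda>x. weak_grad (ball 0 1) u x \<bullet> weak_grad (ball 0 1) v x + q x * u x * v x) \<in> borel_measurable ball_measure"
    "(\<lambda>x. G x \<bullet> K x + q x * u x * v x) \<in> borel_measurable ball_measure"
    using L q by measurable
  show "AE x in ball_measure. weak_grad (ball 0 1) u x \<bullet> weak_grad (ball 0 1) v x + q x * u x * v x
      = G x \<bullet> K x + q x * u x * v x"
    using sobolev_triple_weak_grad[OF u] sobolev_triple_weak_grad[OF v] by eventually_elim simp
qed

section \<open>Consequences of the divergence theorem for the radial field\<close>

section \<open>Green's formula, Poincare's inequality and the trace inequality\<close>

text \<open>The integrand is the divergence of the field \<open>p(x) x\<close>, whose flux density
  through the unit sphere is \<open>p\<close> because \<open>x\<close> is the outer normal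
  there.\<close>

lemma integral_radial_divergence:
  fixes p :: "real^'n \<Rightarrow> real"
  assumes p: "smooth p"
  shows "(\<integral>x. real CARD('n) * p x + x \<bullet> grad p x \<partial>ball_measure) = (\<integral>x. p x \<partial>sphere_measure)"
proof -
  have F: "smooth (\<lambda>x. p x * x $ i)" for i using p by auto
  have px: "partial i (\<lambda>x. x $ i) x = 1" for i and x :: "real^'n"
  proof -
    have "grad (\<lambda>x. x $ i) x = axis i 1"
      by (rule grad_eqI) (auto simp: inner_axis intro!: bounded_linear_imp_has_derivative bounded_linear_vec_nth)
    then have "grad (\<lambda>x. x $ i) x $ i = 1" by (simp add: axis_def)
    then show ?thesis by simp
  qed
  have "partial i (\<lambda>x. p x * x $ i) x = p x + x $ i * grad p x $ i" for i x
    by (simp add: partial_mult[OF p smooth_component] px)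
  then have "real CARD('n) * p x + x \<bullet> grad p x = (\<Sum>i\<in>UNIV. partial i (\<lambda>x. p x * x $ i) x)" for x
    by (simp add: sum.distrib inner_vec_def)
  then have "(\<integral>x. real CARD('n) * p x + x \<bullet> grad p x \<partial>ball_measure)
      = (\<Sum>i\<in>UNIV. \<integral>x. partial i (\<lambda>x. p x * x $ i) x \<partial>ball_measure)"
    by (simp add: Bochner_Integration.integral_sum continuous_integrable_ball smooth_continuous[OF smooth_partial[OF F]])
  also have "\<dots> = (\<Sum>i\<in>UNIV. \<integral>x. p x * x $ i * x $ i \<partial>sphere_measure)"
    by (simp add: divergence_theorem_ball[OF F])
  also have "\<dots> = (\<integral>x. (\<Sum>i\<in>UNIV. p x * x $ i * x $ i) \<partial>sphere_measure)"
  proof (rule Bochner_Integration.integral_sum[symmetric])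
    have s: "smooth (\<lambda>x. x $ i)" for i :: 'n by auto
    show "integrable sphere_measure (\<lambda>x. p x * x $ i * x $ i)" for i
      using L2_integrable_mult[OF smooth_L2_sphere[OF F] smooth_L2_sphere[OF s]] by simp
  qed
  also have "\<dots> = (\<integral>x. p x \<partial>sphere_measure)"
  proof (rule Bochner_Integration.integral_cong[OF refl])
    fix x :: "real^'n" assume "x \<in> space sphere_measure"
    then have "x \<bullet> x = 1" by (simp add: dot_square_norm)
    then have "(\<Sum>i\<in>UNIV. x $ i * x $ i) = 1" by (simp add: inner_vec_def)
    then show "(\<Sum>i\<in>UNIV. p x * x $ i * x $ i) = p x"
      by (simp add: mult.assoc flip: sum_distrib_left)
  qed
  finally show ?thesis .
qed

text \<open>The radial divergence identity for the product \<open>Q h v\<close>. Being of first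
  order in \<open>h\<close> and \<open>v\<close>, it survives the passage from smooth functions to
  their L2 limits.\<close>

lemma integral_radial_divergence_sobolev:
  fixes h v :: "real^'n \<Rightarrow> real"
  assumes Q: "smooth Q" and h: "sobolev_triple h K a" and v: "sobolev_triple v V b"
  shows "(\<integral>x. (real CARD('n) * Q x + x \<bullet> grad Q x) * h x * v x + Q x * (x \<bullet> K x) * v x
      + Q x * h x * (x \<bullet> V x) \<partial>ball_measure) = (\<integral>x. Q x * a x * b x \<partial>sphere_measure)"
proof -
  obtain \<phi> where \<phi>: "\<And>k. smooth (\<phi> k)" "L2_tendsto ball_measure \<phi> h"
    "L2_tendsto ball_measure (\<lambda>k. grad (\<phi> k)) K" "L2_tendsto sphere_measure \<phi> a"
    using sobolev_tripleE[OF h] by blast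
  obtain \<psi> where \<psi>: "\<And>k. smooth (\<psi> k)" "L2_tendsto ball_measure \<psi> v"
    "L2_tendsto ball_measure (\<lambda>k. grad (\<psi> k)) V" "L2_tendsto sphere_measure \<psi> b"
    using sobolev_tripleE[OF v] by blast
  define c where "c x = real CARD('n) * Q x + x \<bullet> grad Q x" for x
  note Qc = smooth_continuous[OF Q, of UNIV]
  have cc: "continuous_on UNIV c"
    unfolding c_def by (intro continuous_intros Qc smooth_continuous_grad Q)
  have idc: "continuous_on UNIV (\<lambda>x::real^'n. x)" by (rule continuous_on_id)
  note A = L2_tendsto_ball_scaleR[OF \<phi>(2) cc]
  note B = L2_tendsto_ball_scaleR[OF L2_tendsto_ball_inner[OF \<phi>(3) idc] Qc]
  note C = L2_tendsto_ball_scaleR[OF \<phi>(2) Qc]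
  note D = L2_tendsto_ball_inner[OF \<psi>(3) idc]
  \<comment> \<open>Three separate pairings of two \<open>L2\<close> factors each, since limits are
    available for such pairings only.\<close>
  have split: "(\<integral>x. c x * f x * g x + Q x * (x \<bullet> F x) * g x + Q x * f x * (x \<bullet> G x) \<partial>ball_measure)
      = (\<integral>x. (c x *\<^sub>R f x) \<bullet> g x \<partial>ball_measure) + (\<integral>x. (Q x *\<^sub>R (x \<bullet> F x)) \<bullet> g x \<partial>ball_measure)
        + (\<integral>x. (Q x *\<^sub>R f x) \<bullet> (x \<bullet> G x) \<partial>ball_measure)"
    if "(\<lambda>x. c x *\<^sub>R f x) \<in> L2 ball_measure" "g \<in> L2 ball_measure" "(\<lambda>x. Q x *\<^sub>R (x \<bullet> F x)) \<in> L2 ball_measure"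
      "(\<lambda>x. Q x *\<^sub>R f x) \<in> L2 ball_measure" "(\<lambda>x. x \<bullet> G x) \<in> L2 ball_measure" for f g F G
    using L2_integrable_inner[OF that(1,2)] L2_integrable_inner[OF that(3,2)] L2_integrable_inner[OF that(4,5)]
    by simp
  have "(\<lambda>k. \<integral>x. c x * \<phi> k x * \<psi> k x + Q x * (x \<bullet> grad (\<phi> k) x) * \<psi> k x
      + Q x * \<phi> k x * (x \<bullet> grad (\<psi> k) x) \<partial>ball_measure)
    \<longlonglongrightarrow> (\<integral>x. c x * h x * v x + Q x * (x \<bullet> K x) * v x + Q x * h x * (x \<bullet> V x) \<partial>ball_measure)"
    unfolding split[OF L2_tendsto_L2(1)[OF A] L2_tendsto_L2(1)[OF \<psi>(2)] L2_tendsto_L2(1)[OF B] L2_tendsto_L2(1)[OF C] L2_tendsto_L2(1)[OF D]]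
      split[OF L2_tendsto_L2(2)[OF A] L2_tendsto_L2(2)[OF \<psi>(2)] L2_tendsto_L2(2)[OF B] L2_tendsto_L2(2)[OF C] L2_tendsto_L2(2)[OF D]]
    by (intro tendsto_add L2_tendsto_inner A B C D \<psi>(2))
  moreover have "(\<integral>x. c x * \<phi> k x * \<psi> k x + Q x * (x \<bullet> grad (\<phi> k) x) * \<psi> k x
      + Q x * \<phi> k x * (x \<bullet> grad (\<psi> k) x) \<partial>ball_measure) = (\<integral>x. Q x * \<phi> k x * \<psi> k x \<partial>sphere_measure)" for k
  proof -
    have s1: "smooth (\<lambda>x. Q x * \<phi> k x)" and s: "smooth (\<lambda>x. Q x * \<phi> k x * \<psi> k x)"
      by (intro smooth_mult Q \<phi>(1) \<psi>(1))+
    have "real CARD('n) * (Q x * \<phi> k x * \<psi> k x) + x \<bullet> grad (\<lambda>x. Q x * \<phi> k x * \<psi> k x) x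
      = c x * \<phi> k x * \<psi> k x + Q x * (x \<bullet> grad (\<phi> k) x) * \<psi> k x + Q x * \<phi> k x * (x \<bullet> grad (\<psi> k) x)" for x
      unfolding grad_mult[OF s1 \<psi>(1)] grad_mult[OF Q \<phi>(1)]
      by (simp add: c_def inner_add_right algebra_simps)
    then show ?thesis using integral_radial_divergence[OF s] by simp
  qed
  moreover have "(\<lambda>k. \<integral>x. Q x * \<phi> k x * \<psi> k x \<partial>sphere_measure) \<longlonglongrightarrow> (\<integral>x. Q x * a x * b x \<partial>sphere_measure)"
    using L2_tendsto_inner[OF L2_tendsto_sphere_scaleR[OF \<phi>(4) Qc] \<psi>(4)] by simp
  ultimately show ?thesis
    using LIMSEQ_unique unfolding c_def by fastforce
qed

text \<open>Taking \<open>Q = 1\<close> and \<open>h = v = u\<close> in the radial identity, the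
  difference equals twice the integral of \<open>u (x . G)\<close>, and
  \<open>2ab \<le> a^2/2 + 2b^2\<close>. One direction gives Poincare's inequality, the other the
  trace inequality; the coefficient 1/2 stays below the dimension, so that it can be
  absorbed.\<close>

lemma sobolev_radial_bound:
  fixes u :: "real^'n \<Rightarrow> real"
  assumes "sobolev_triple u G f"
  shows "\<bar>(L2_norm sphere_measure f)\<^sup>2 - real CARD('n) * (L2_norm ball_measure u)\<^sup>2\<bar>
    \<le> (1/2) * (L2_norm ball_measure u)\<^sup>2 + 2 * (L2_norm ball_measure G)\<^sup>2"
proof -
  let ?n = "real CARD('n)"
  note L = sobolev_triple_L2[OF assms]
  have "(\<lambda>x. x \<bullet> G x) \<in> L2 ball_measure"
    using L2_tendsto_L2(2)[OF L2_tendsto_ball_inner[OF L2_tendsto_const[OF L(2)] continuous_on_id]] .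
  note int = L2_integrable_mult[OF L(1) L(1)] L2_integrable_mult[OF L(1) this]
    L2_integrable[OF L(1)] L2_integrable[OF L(2)]
  have n: "(L2_norm sphere_measure f)\<^sup>2 = (\<integral>x. f x * f x \<partial>sphere_measure)"
    "(L2_norm ball_measure u)\<^sup>2 = (\<integral>x. u x * u x \<partial>ball_measure)"
    unfolding L2_norm_power2 by (simp_all add: power2_eq_square)
  have "(\<integral>x. ?n * u x * u x + (x \<bullet> G x) * u x + u x * (x \<bullet> G x) \<partial>ball_measure) = (\<integral>x. f x * f x \<partial>sphere_measure)"
    using integral_radial_divergence_sobolev[OF smooth_const[of 1] assms assms] by simp
  also have "(\<lambda>x. ?n * u x * u x + (x \<bullet> G x) * u x + u x * (x \<bullet> G x)) = (\<lambda>x. ?n * (u x * u x) + 2 * (u x * (x \<bullet> G x)))"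
    by (auto simp: algebra_simps)
  finally have "(L2_norm sphere_measure f)\<^sup>2 - ?n * (L2_norm ball_measure u)\<^sup>2 = (\<integral>x. 2 * (u x * (x \<bullet> G x)) \<partial>ball_measure)"
    using int unfolding n by simp
  also have "\<bar>\<dots>\<bar> \<le> (\<integral>x. \<bar>2 * (u x * (x \<bullet> G x))\<bar> \<partial>ball_measure)" by (rule integral_abs_bound)
  also have "\<dots> \<le> (\<integral>x. (1/2) * (norm (u x))\<^sup>2 + 2 * (norm (G x))\<^sup>2 \<partial>ball_measure)"
  proof (rule integral_mono)
    fix x :: "real^'n" assume x: "x \<in> space ball_measure"
    have "\<bar>x \<bullet> G x\<bar> \<le> norm x * norm (G x)" by (rule Cauchy_Schwarz_ineq2)
    also have "\<dots> \<le> 1 * norm (G x)" using x by (intro mult_right_mono) auto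
    finally have "\<bar>u x\<bar> * \<bar>x \<bullet> G x\<bar> \<le> \<bar>u x\<bar> * norm (G x)" by (simp add: mult_left_mono)
    moreover have "0 \<le> (\<bar>u x\<bar> - 2 * norm (G x))\<^sup>2" by simp
    then have "2 * (\<bar>u x\<bar> * norm (G x)) \<le> (1/2) * \<bar>u x\<bar>\<^sup>2 + 2 * (norm (G x))\<^sup>2"
      by (simp add: power2_diff algebra_simps)
    ultimately show "\<bar>2 * (u x * (x \<bullet> G x))\<bar> \<le> (1/2) * (norm (u x))\<^sup>2 + 2 * (norm (G x))\<^sup>2"
      by (simp add: abs_mult)
  qed (use int in auto)
  also have "\<dots> = (1/2) * (L2_norm ball_measure u)\<^sup>2 + 2 * (L2_norm ball_measure G)\<^sup>2"
    using int by (simp add: L2_norm_power2)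
  finally show ?thesis .
qed

text \<open>For trace zero and \<open>n \<ge> 1\<close> the radial bound leaves half of the squared
  norm of \<open>u\<close> below twice that of \<open>G\<close>.\<close>

lemma Poincare_inequality:
  fixes u :: "real^'n \<Rightarrow> real"
  assumes "sobolev_triple u G (\<lambda>_. 0)"
  shows "L2_norm ball_measure u \<le> 2 * L2_norm ball_measure G"
proof (rule power2_le_imp_le)
  have "1 \<le> real CARD('n)" by (simp add: Suc_leI)
  then have "1 * (L2_norm ball_measure u)\<^sup>2 \<le> real CARD('n) * (L2_norm ball_measure u)\<^sup>2"
    by (intro mult_right_mono) auto
  then show "(L2_norm ball_measure u)\<^sup>2 \<le> (2 * L2_norm ball_measure G)\<^sup>2"
    using sobolev_radial_bound[OF assms] by (simp add: L2_norm_def power_mult_distrib)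
qed simp

lemma trace_inequality:
  fixes u :: "real^'n \<Rightarrow> real"
  assumes "sobolev_triple u G f"
  shows "L2_norm sphere_measure f \<le> (real CARD('n) + 2) * (L2_norm ball_measure u + L2_norm ball_measure G)"
proof (rule power2_le_imp_le)
  let ?n = "real CARD('n)" and ?a = "L2_norm ball_measure u" and ?b = "L2_norm ball_measure G"
  have "(L2_norm sphere_measure f)\<^sup>2 \<le> (?n + 2) * (?a\<^sup>2 + ?b\<^sup>2)"
  proof -
    have "0 \<le> ?n * ?b\<^sup>2" "0 \<le> ?a\<^sup>2" by simp_all
    then show ?thesis
      using abs_le_D1[OF sobolev_radial_bound[OF assms]] unfolding distrib_left distrib_right by linarith
  qed
  also have "\<dots> \<le> (?n + 2)\<^sup>2 * (?a + ?b)\<^sup>2"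
    by (intro mult_mono) (auto simp: power2_eq_square algebra_simps)
  finally show "(L2_norm sphere_measure f)\<^sup>2 \<le> ((?n + 2) * (?a + ?b))\<^sup>2"
    by (simp add: power_mult_distrib)
qed simp

section \<open>Weakly harmonic extension by minimisation\<close>

section \<open>The Dirichlet principle\<close>

text \<open>Diagonal choice: for each \<open>k\<close> a single smooth function that is within
  \<open>1 / (k + 1)\<close> of the \<open>k\<close>-th triple in all three norms.\<close>

lemma sobolev_triple_closed:
  assumes T: "\<And>k. sobolev_triple (U k) (G k) (F k)"
    and u: "L2_tendsto ball_measure U u" and g: "L2_tendsto ball_measure G g"
    and f: "L2_tendsto sphere_measure F f"
  shows "sobolev_triple u g f"
proof -
  define e where "e k = 1 / real (Suc k)" for k
  have e: "e \<longlonglongrightarrow> 0" "\<And>k. 0 < e k"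
    unfolding e_def using LIMSEQ_inverse_real_of_nat by (simp_all add: inverse_eq_divide)
  have ex: "\<exists>\<phi>. smooth \<phi> \<and> L2_norm ball_measure (\<lambda>x. \<phi> x - U k x) < e k \<and>
      L2_norm ball_measure (\<lambda>x. grad \<phi> x - G k x) < e k \<and> L2_norm sphere_measure (\<lambda>x. \<phi> x - F k x) < e k" for k
  proof -
    obtain \<phi> where \<phi>: "\<And>j. smooth (\<phi> j)" "L2_tendsto ball_measure \<phi> (U k)"
      "L2_tendsto ball_measure (\<lambda>j. grad (\<phi> j)) (G k)" "L2_tendsto sphere_measure \<phi> (F k)"
      using sobolev_tripleE[OF T[of k]] by blast
    have "\<forall>\<^sub>F j in sequentially. L2_norm ball_measure (\<lambda>x. \<phi> j x - U k x) < e k \<and>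
      L2_norm ball_measure (\<lambda>x. grad (\<phi> j) x - G k x) < e k \<and> L2_norm sphere_measure (\<lambda>x. \<phi> j x - F k x) < e k"
      using \<phi>(2-4) e(2) unfolding L2_tendsto_def by (intro eventually_conj order_tendstoD) blast+
    then show ?thesis using \<phi>(1) eventually_happens' sequentially_bot by blast
  qed
  from choice[OF allI[OF ex]] obtain \<phi> where "\<forall>k. smooth (\<phi> k) \<and>
      L2_norm ball_measure (\<lambda>x. \<phi> k x - U k x) < e k \<and>
      L2_norm ball_measure (\<lambda>x. grad (\<phi> k) x - G k x) < e k \<and>
      L2_norm sphere_measure (\<lambda>x. \<phi> k x - F k x) < e k" ..
  then have \<phi>: "\<And>k. smooth (\<phi> k)" "\<And>k. L2_norm ball_measure (\<lambda>x. \<phi> k x - U k x) < e k"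
      "\<And>k. L2_norm ball_measure (\<lambda>x. grad (\<phi> k) x - G k x) < e k"
      "\<And>k. L2_norm sphere_measure (\<lambda>x. \<phi> k x - F k x) < e k" by simp_all
  have gen: "L2_tendsto M \<psi> w" if "\<And>k. \<psi> k \<in> L2 M" "L2_tendsto M X w" "\<And>k. L2_norm M (\<lambda>x. \<psi> k x - X k x) < e k"
    for M :: "'c measure" and \<psi> X and w :: "'c \<Rightarrow> 'd::euclidean_space"
  proof (rule L2_tendstoI)
    show "L2_norm M (\<lambda>x. \<psi> k x - w x) \<le> e k + L2_norm M (\<lambda>x. X k x - w x)" for k
      using L2_norm_triangle_diff[OF that(1) L2_tendsto_L2[OF that(2)], of k k] that(3)[of k] by linarith
    show "(\<lambda>k. e k + L2_norm M (\<lambda>x. X k x - w x)) \<longlonglongrightarrow> 0"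
      using that(2) by (intro tendsto_add_zero e(1)) (simp add: L2_tendsto_def)
  qed (use that L2_tendsto_L2 in blast)+
  show ?thesis unfolding sobolev_triple_def
    using \<phi>(1) gen[OF smooth_L2_ball[OF \<phi>(1)] u \<phi>(2)] gen[OF smooth_grad_L2_ball[OF \<phi>(1)] g \<phi>(3)]
      gen[OF smooth_L2_sphere[OF \<phi>(1)] f \<phi>(4)] by blast
qed

lemma L2_norm_add_power2:
  fixes f g :: "'a \<Rightarrow> 'b::euclidean_space"
  assumes "f \<in> L2 M" "g \<in> L2 M"
  shows "(L2_norm M (\<lambda>x. f x + c *\<^sub>R g x))\<^sup>2
    = (L2_norm M f)\<^sup>2 + 2 * c * (\<integral>x. f x \<bullet> g x \<partial>M) + c\<^sup>2 * (L2_norm M g)\<^sup>2"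
proof -
  have "(norm (f x + c *\<^sub>R g x))\<^sup>2 = (norm (f x))\<^sup>2 + 2 * c * (f x \<bullet> g x) + c\<^sup>2 * (norm (g x))\<^sup>2" for x
    unfolding power2_norm_eq_inner
    by (simp add: inner_add_left inner_add_right inner_commute algebra_simps power2_eq_square)
  then show ?thesis
    using L2_integrable[OF assms(1)] L2_integrable[OF assms(2)] L2_integrable_inner[OF assms]
    by (simp add: L2_norm_power2)
qed

text \<open>The direct method. The parallelogram identity makes a minimising sequence of gradients
  Cauchy; differences of competitors have trace zero, so Poincare's inequality makes the functions
  Cauchy too. The first variation at the minimum is the orthogonality.\<close>

theorem harmonic_extension_exists:
  assumes "sobolev_triple u0 G0 f"
  obtains H G where "sobolev_triple H G f"
    "\<And>v V. sobolev_triple v V (\<lambda>_. 0) \<Longrightarrow> (\<integral>x. G x \<bullet> V x \<partial>ball_measure) = 0"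
proof -
  let ?N = "L2_norm ball_measure"
  define S where "S = {(?N G)\<^sup>2 | u G. sobolev_triple u G f}"
  define m where "m = Inf S"
  have bdd: "bdd_below S" unfolding S_def by (rule bdd_belowI[of _ 0]) auto
  have m_le: "m \<le> (?N G)\<^sup>2" if "sobolev_triple u G f" for u G
    unfolding m_def by (rule cInf_lower[OF _ bdd]) (use that in \<open>auto simp: S_def\<close>)
  have "\<exists>u G. sobolev_triple u G f \<and> (?N G)\<^sup>2 < m + 1 / real (Suc k)" for k
  proof -
    have "S \<noteq> {}" using assms by (auto simp: S_def)
    moreover have "Inf S < m + 1 / real (Suc k)" by (simp add: m_def)
    ultimately obtain s where "s \<in> S" "s < m + 1 / real (Suc k)" by (rule cInf_lessD[elim_format]) blast
    then show ?thesis by (auto simp: S_def)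
  qed
  then obtain U G where UG: "\<And>k. sobolev_triple (U k) (G k) f" "\<And>k. (?N (G k))\<^sup>2 < m + 1 / real (Suc k)"
    by metis
  note L = sobolev_triple_L2[OF UG(1)]
  have Gij: "(?N (\<lambda>x. G i x - G j x))\<^sup>2 \<le> 2 / real (Suc i) + 2 / real (Suc j)" for i j
  proof -
    \<comment> \<open>The midpoint has trace \<open>(f + f) / 2 = f\<close>, so it competes and its
      energy is at least \<open>m\<close>.\<close>
    have "sobolev_triple (\<lambda>x. (1/2) * (U i x + U j x)) (\<lambda>x. (1/2) *\<^sub>R (G i x + G j x)) (\<lambda>x. (1/2) * (f x + f x))"
      by (intro sobolev_triple_scaleR sobolev_triple_add UG)
    then have "m \<le> (?N (\<lambda>x. (1/2) *\<^sub>R (G i x + G j x)))\<^sup>2" using m_le by simp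
    also have "\<dots> = (1/4) * (?N (\<lambda>x. G i x + 1 *\<^sub>R G j x))\<^sup>2"
      by (simp add: L2_norm_power2 power_divide)
    finally have "4 * m \<le> (?N (G i))\<^sup>2 + 2 * (\<integral>x. G i x \<bullet> G j x \<partial>ball_measure) + (?N (G j))\<^sup>2"
      unfolding L2_norm_add_power2[OF L(2) L(2)] by simp
    moreover have "(?N (\<lambda>x. G i x + (-1) *\<^sub>R G j x))\<^sup>2 = (?N (G i))\<^sup>2 - 2 * (\<integral>x. G i x \<bullet> G j x \<partial>ball_measure) + (?N (G j))\<^sup>2"
      unfolding L2_norm_add_power2[OF L(2) L(2)] by simp
    ultimately show ?thesis using UG(2)[of i] UG(2)[of j] by simp
  qed
  have Uij: "?N (\<lambda>x. U i x - U j x) \<le> 2 * ?N (\<lambda>x. G i x - G j x)" for i j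
    using Poincare_inequality[of "\<lambda>x. U i x - U j x" "\<lambda>x. G i x - G j x"]
      sobolev_triple_diff[OF UG(1)[of i] UG(1)[of j]] by simp
  have GC: "\<exists>N. \<forall>i\<ge>N. \<forall>j\<ge>N. ?N (\<lambda>x. G i x - G j x) < d" if "0 < d" for d
  proof -
    obtain N where N: "1 / real (Suc N) < d\<^sup>2 / 4"
      using nat_approx_posE[of "d\<^sup>2 / 4"] \<open>0 < d\<close> by auto
    have "?N (\<lambda>x. G i x - G j x) < d" if "i \<ge> N" "j \<ge> N" for i j
    proof (rule power2_less_imp_less)
      have "1 / real (Suc i) \<le> 1 / real (Suc N)" "1 / real (Suc j) \<le> 1 / real (Suc N)"
        using that by (auto simp: frac_le)
      then show "(?N (\<lambda>x. G i x - G j x))\<^sup>2 < d\<^sup>2"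
        using Gij[of i j] N by simp
    qed (use \<open>0 < d\<close> in simp)
    then show ?thesis by blast
  qed
  obtain g where g: "L2_tendsto ball_measure G g" using L2_complete[OF L(2) GC] by blast
  have UC: "\<exists>N. \<forall>i\<ge>N. \<forall>j\<ge>N. ?N (\<lambda>x. U i x - U j x) < d" if "0 < d" for d
    using GC[of "d/2"] Uij that by (smt (verit) field_sum_of_halves half_gt_zero)
  obtain H where H: "L2_tendsto ball_measure U H" using L2_complete[OF L(1) UC] by blast
  have T: "sobolev_triple H g f"
    using sobolev_triple_closed[OF UG(1) H g L2_tendsto_const[OF L(3)]] .
  have "(\<lambda>k. m + 1 / real (Suc k)) \<longlonglongrightarrow> m + 0"
    using LIMSEQ_inverse_real_of_nat by (intro tendsto_add tendsto_const) (simp add: inverse_eq_divide)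
  then have "(?N g)\<^sup>2 \<le> m + 0"
    using UG(2) by (intro LIMSEQ_le[OF tendsto_power[OF L2_tendsto_norm[OF g]]]) (auto intro: less_imp_le)
  then have min: "(?N g)\<^sup>2 \<le> (?N K)\<^sup>2" if "sobolev_triple u K f" for u K
    using m_le[OF that] by linarith
  have "(\<integral>x. g x \<bullet> V x \<partial>ball_measure) = 0" if V: "sobolev_triple v V (\<lambda>_. 0)" for v V
  proof -
    define a b where "a = (\<integral>x. g x \<bullet> V x \<partial>ball_measure)" and "b = (?N V)\<^sup>2"
    have b: "0 \<le> b" by (simp add: b_def)
    have "0 \<le> 2 * c * a + c\<^sup>2 * b" for c
    proof -
      have "sobolev_triple (\<lambda>x. H x + c * v x) (\<lambda>x. g x + c *\<^sub>R V x) (\<lambda>x. f x + c * 0)"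
        by (intro sobolev_triple_add sobolev_triple_scaleR T V)
      then have "(?N g)\<^sup>2 \<le> (?N (\<lambda>x. g x + c *\<^sub>R V x))\<^sup>2" using min by simp
      then show ?thesis
        unfolding L2_norm_add_power2[OF sobolev_triple_L2(2)[OF T] sobolev_triple_L2(2)[OF V]]
        by (simp add: a_def b_def)
    qed
    note quad = this
    \<comment> \<open>The denominator \<open>b + 1\<close> also covers \<open>b = 0\<close>; at
      \<open>c = -t\<close> the inequality becomes \<open>0 \<le> - t^2 (b + 2)\<close>.\<close>
    define t where "t = a / (b + 1)"
    have at: "a = t * (b + 1)" using b by (simp add: t_def)
    have "0 \<le> - (t\<^sup>2 * (b + 2))"
      using quad[of "- t"] by (simp add: at power2_eq_square algebra_simps)
    moreover have "t\<^sup>2 * (b + 2) > 0" if "t \<noteq> 0" using that b by (intro mult_pos_pos) auto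
    ultimately have "t = 0" by fastforce
    then show ?thesis using at by (simp add: a_def)
  qed
  with T show thesis by (rule that)
qed

section \<open>Inverting the Euler operator \<open>x . grad + (b + 1)\<close> by an integral over
  dilations\<close>

section \<open>Weighted averages over dilations\<close>

lemma has_derivative_parametric_integral:
  fixes F :: "real^'n \<Rightarrow> real \<Rightarrow> real" and g :: "real^'n \<Rightarrow> real \<Rightarrow> real^'n"
  assumes deriv: "\<And>x t. t \<in> {a..b} \<Longrightarrow> ((\<lambda>x. F x t) has_derivative (\<lambda>d. d \<bullet> g x t)) (at x)"
    and contF: "\<And>x. continuous_on {a..b} (F x)"
    and contg: "continuous_on (UNIV \<times> {a..b}) (\<lambda>(x, t). g x t)"
  shows "((\<lambda>x. integral {a..b} (F x)) has_derivative (\<lambda>d. d \<bullet> integral {a..b} (g x))) (at x)"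
proof -
  have "((\<lambda>x. integral (cbox a b) (F x)) has_derivative
      blinfun_apply (integral (cbox a b) (\<lambda>t. blinfun_inner_left (g x t)))) (at x within UNIV)"
  proof (rule leibniz_rule)
    show "((\<lambda>x. F x t) has_derivative blinfun_apply (blinfun_inner_left (g x t))) (at x within UNIV)"
      if "t \<in> cbox a b" for x t using deriv that by simp
    show "F x integrable_on cbox a b" for x
      using integrable_continuous_real[OF contF] by simp
    show "continuous_on (UNIV \<times> cbox a b) (\<lambda>(x, t). blinfun_inner_left (g x t))"
      using bounded_linear.continuous_on[OF bounded_linear_blinfun_inner_left contg]
      by (simp add: case_prod_beta)
  qed auto
  moreover have "integral {a..b} (\<lambda>t. blinfun_inner_left (g x t)) = blinfun_inner_left (integral {a..b} (g x))"
  proof -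
    have "continuous_on {a..b} (\<lambda>t. (\<lambda>(x, t). g x t) (x, t))"
      by (rule continuous_on_compose2[OF contg]) (auto intro!: continuous_intros)
    then have "g x integrable_on {a..b}" by (intro integrable_continuous_real) simp
    from integral_linear[OF this bounded_linear_blinfun_inner_left] show ?thesis by (simp add: o_def)
  qed
  ultimately show ?thesis by simp
qed

lemma continuous_on_powr_const: "0 < b \<Longrightarrow> continuous_on {0..} (\<lambda>t::real. t powr b)"
  by (intro continuous_on_powr' continuous_intros) auto

lemma continuous_on_UNIV_compose:
  "continuous_on UNIV f \<Longrightarrow> continuous_on S h \<Longrightarrow> continuous_on S (\<lambda>x. f (h x))"
  by (rule continuous_on_compose2) auto

text \<open>The solution operator of \<open>x . grad h + (b + 1) h = g\<close>. The gauge integral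
  suits differentiation under the integral sign; \<open>radial_avg_lebesgue\<close> supplies the
  Lebesgue form for Fubini.\<close>

definition radial_avg :: "real \<Rightarrow> (real^'n \<Rightarrow> 'b::euclidean_space) \<Rightarrow> real^'n \<Rightarrow> 'b" where
  "radial_avg b g x = integral {0..1} (\<lambda>t. t powr b *\<^sub>R g (t *\<^sub>R x))"

lemma radial_avg_continuous_integrand:
  fixes g :: "real^'n \<Rightarrow> 'b::euclidean_space"
  assumes "0 < b" "continuous_on UNIV g"
  shows "continuous_on {0..1} (\<lambda>t. t powr b *\<^sub>R g (t *\<^sub>R x))"
  by (intro continuous_on_scaleR continuous_on_subset[OF continuous_on_powr_const[OF assms(1)]]
      continuous_on_UNIV_compose[OF assms(2)] continuous_intros) auto

lemma radial_avg_lebesgue: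
  fixes g :: "real^'n \<Rightarrow> 'b::euclidean_space"
  assumes "0 < b" "continuous_on UNIV g"
  shows "radial_avg b g x = (\<integral>t. t powr b *\<^sub>R g (t *\<^sub>R x) \<partial>unit_interval)"
  unfolding radial_avg_def using integral_unit_interval[OF radial_avg_continuous_integrand[OF assms]] by simp

text \<open>The chain rule contributes a factor \<open>t\<close>: the gradient of an average is the
  average of the gradient, with exponent raised by one.\<close>

lemma has_derivative_radial_avg:
  assumes b: "0 < b" and s: "smooth \<phi>"
  shows "(radial_avg b \<phi> has_derivative (\<lambda>d. d \<bullet> radial_avg (b + 1) (grad \<phi>) x)) (at x)"
  unfolding radial_avg_def
proof (rule has_derivative_parametric_integral)
  show "((\<lambda>x. t powr b *\<^sub>R \<phi> (t *\<^sub>R x)) has_derivative (\<lambda>d. d \<bullet> t powr (b + 1) *\<^sub>R grad \<phi> (t *\<^sub>R x))) (at x)"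
    if "t \<in> {0..1}" for x t
  proof -
    have "((\<lambda>x. t *\<^sub>R x) has_derivative (\<lambda>d. t *\<^sub>R d)) (at x)"
      by (auto intro!: derivative_eq_intros)
    from has_derivative_scaleR_right[OF has_derivative_compose[OF this smooth_has_derivative[OF s]], of "t powr b"]
    show ?thesis using that by (simp add: powr_add mult.assoc)
  qed
  show "continuous_on {0..1} (\<lambda>t. t powr b *\<^sub>R \<phi> (t *\<^sub>R x))" for x
    by (rule radial_avg_continuous_integrand[OF b smooth_continuous[OF s]])
  show "continuous_on (UNIV \<times> {0..1}) (\<lambda>(x, t). t powr (b + 1) *\<^sub>R grad \<phi> (t *\<^sub>R x))"
    unfolding case_prod_beta
    by (intro continuous_on_scaleR continuous_on_UNIV_compose[OF smooth_continuous_grad[OF s]]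
        continuous_on_compose2[OF continuous_on_powr_const] continuous_intros) (use b in auto)
qed

lemma grad_radial_avg:
  assumes "0 < b" "smooth \<phi>"
  shows "grad (radial_avg b \<phi>) = radial_avg (b + 1) (grad \<phi>)"
  using grad_eqI[OF has_derivative_radial_avg[OF assms]] by blast

lemma radial_avg_nth:
  assumes "0 < b" "smooth \<phi>"
  shows "radial_avg b (grad \<phi>) x $ i = radial_avg b (partial i \<phi>) x"
proof -
  have "(\<lambda>t. t powr b *\<^sub>R grad \<phi> (t *\<^sub>R x)) integrable_on {0..1}"
    by (intro integrable_continuous_real radial_avg_continuous_integrand smooth_continuous_grad assms)
  from integral_linear[OF this bounded_linear_vec_nth[of i]] show ?thesis
    by (simp add: radial_avg_def o_def)
qed

lemma smooth_radial_avg: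
  fixes \<phi> :: "real^'n \<Rightarrow> real"
  assumes "0 < b" "smooth \<phi>"
  shows "smooth (radial_avg b \<phi>)"
proof -
  have "k_times_differentiable k (radial_avg b \<phi>)" for k
    using assms
  proof (induction k arbitrary: b \<phi>)
    case (Suc k)
    show ?case
    proof (rule k_times_SucI[OF has_derivative_radial_avg[OF Suc.prems]])
      show "k_times_differentiable k (\<lambda>x. radial_avg (b + 1) (grad \<phi>) x $ i)" for i
        using Suc.IH[of "b + 1" "partial i \<phi>"] Suc.prems
        by (simp add: radial_avg_nth[OF _ Suc.prems(2)] smooth_partial)
    qed
  qed simp
  then show ?thesis by (simp add: smooth_def)
qed

text \<open>The left-hand side is the integral over \<open>0 \<le> t \<le> 1\<close> of the
  derivative of \<open>t^(b+1) \<phi>(t x)\<close>; the lower endpoint contributes nothing since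
  \<open>b + 1 > 0\<close>.\<close>

lemma radial_avg_Euler:
  assumes b: "0 < b" and s: "smooth \<phi>"
  shows "x \<bullet> grad (radial_avg b \<phi>) x + (b + 1) * radial_avg b \<phi> x = \<phi> x"
proof -
  note c1 = radial_avg_continuous_integrand[OF b smooth_continuous[OF s]]
  have b1: "0 < b + 1" using b by simp
  note c2 = radial_avg_continuous_integrand[OF b1 smooth_continuous_grad[OF s]]
  note i1 = integrable_continuous_real[OF c1[of x]] and i2 = integrable_continuous_real[OF c2[of x]]
  have "((\<lambda>t. x \<bullet> (t powr (b + 1) *\<^sub>R grad \<phi> (t *\<^sub>R x)) + (b + 1) * (t powr b *\<^sub>R \<phi> (t *\<^sub>R x)))
      has_integral (1 powr (b + 1) * \<phi> (1 *\<^sub>R x) - 0 powr (b + 1) * \<phi> (0 *\<^sub>R x))) {0..1}"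
  proof (rule fundamental_theorem_of_calculus_interior)
    show "continuous_on {0..1} (\<lambda>t. t powr (b + 1) * \<phi> (t *\<^sub>R x))"
      using radial_avg_continuous_integrand[OF b1 smooth_continuous[OF s]] by simp
    fix t :: real assume t: "t \<in> {0<..<1}"
    have "((\<lambda>t. t *\<^sub>R x) has_derivative (\<lambda>d. d *\<^sub>R x)) (at t)"
      by (auto intro!: derivative_eq_intros)
    from has_derivative_compose[OF this smooth_has_derivative[OF s]]
    have "((\<lambda>t. \<phi> (t *\<^sub>R x)) has_real_derivative x \<bullet> grad \<phi> (t *\<^sub>R x)) (at t)"
      by (simp add: has_field_derivative_def mult_commute_abs)
    moreover have "((\<lambda>t. t powr (b + 1)) has_real_derivative (b + 1) * t powr b) (at t)"
      using has_real_derivative_powr[of t "b + 1"] t by simp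
    ultimately have "((\<lambda>t. t powr (b + 1) * \<phi> (t *\<^sub>R x)) has_real_derivative
        (b + 1) * t powr b * \<phi> (t *\<^sub>R x) + (x \<bullet> grad \<phi> (t *\<^sub>R x)) * t powr (b + 1)) (at t)"
      by (intro DERIV_mult) auto
    then show "((\<lambda>t. t powr (b + 1) * \<phi> (t *\<^sub>R x)) has_vector_derivative
        x \<bullet> (t powr (b + 1) *\<^sub>R grad \<phi> (t *\<^sub>R x)) + (b + 1) * (t powr b *\<^sub>R \<phi> (t *\<^sub>R x))) (at t)"
      unfolding has_real_derivative_iff_has_vector_derivative[symmetric]
      by (simp add: algebra_simps)
  qed simp
  then have "integral {0..1} (\<lambda>t. x \<bullet> (t powr (b + 1) *\<^sub>R grad \<phi> (t *\<^sub>R x)) + (b + 1) * (t powr b *\<^sub>R \<phi> (t *\<^sub>R x)))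
      = \<phi> x" using b by (simp add: integral_unique)
  moreover have "integral {0..1} (\<lambda>t. x \<bullet> (t powr (b + 1) *\<^sub>R grad \<phi> (t *\<^sub>R x)) + (b + 1) * (t powr b *\<^sub>R \<phi> (t *\<^sub>R x)))
      = x \<bullet> radial_avg (b + 1) (grad \<phi>) x + (b + 1) * radial_avg b \<phi> x"
  proof (rule integral_unique, intro has_integral_add)
    show "((\<lambda>t. x \<bullet> (t powr (b + 1) *\<^sub>R grad \<phi> (t *\<^sub>R x))) has_integral x \<bullet> radial_avg (b + 1) (grad \<phi>) x) {0..1}"
      using has_integral_linear[OF integrable_integral[OF i2] bounded_linear_inner_right]
      by (simp only: o_def radial_avg_def)
    show "((\<lambda>t. (b + 1) * (t powr b *\<^sub>R \<phi> (t *\<^sub>R x))) has_integral (b + 1) * radial_avg b \<phi> x) {0..1}"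
      using has_integral_mult_right[OF integrable_integral[OF i1]] by (simp only: radial_avg_def)
  qed
  ultimately show ?thesis by (simp add: grad_radial_avg[OF b s])
qed

text \<open>The substitution \<open>y = t x\<close>. The unit ball is kept as the domain and the
  shrunken image is marked by an indicator, so that integrals over \<open>t\<close> and
  \<open>y\<close> can be exchanged afterwards.\<close>

lemma integral_ball_rescale:
  fixes P :: "real^'n \<Rightarrow> 'b::euclidean_space"
  assumes [measurable]: "P \<in> borel_measurable borel" and t: "0 < t" "t \<le> 1"
  shows "(\<integral>x. P x \<partial>ball_measure)
    = (1 / t ^ CARD('n)) *\<^sub>R (\<integral>y. indicator (ball 0 t) y *\<^sub>R P ((1 / t) *\<^sub>R y) \<partial>ball_measure)"
proof -
  have m: "(\<lambda>y. indicator (ball 0 t) y *\<^sub>R P ((1 / t) *\<^sub>R y)) \<in> borel_measurable borel"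
    by measurable
  have "(\<integral>y. indicator (ball 0 t) y *\<^sub>R P ((1 / t) *\<^sub>R y) \<partial>ball_measure)
      = (\<integral>y. indicator (ball 0 t) y *\<^sub>R P ((1 / t) *\<^sub>R y) \<partial>lborel)"
    unfolding integral_ball_measure
    by (rule Bochner_Integration.integral_cong) (use t in \<open>auto simp: indicator_def\<close>)
  also have "\<dots> = t ^ CARD('n) *\<^sub>R (\<integral>x. indicator (ball 0 t) (t *\<^sub>R x) *\<^sub>R P x \<partial>lborel)"
    using integral_scaling[OF m t(1)] t by simp
  also have "(\<integral>x. indicator (ball 0 t) (t *\<^sub>R x) *\<^sub>R P x \<partial>lborel) = (\<integral>x. P x \<partial>ball_measure)"
    unfolding integral_ball_measure
    by (rule Bochner_Integration.integral_cong) (use t in \<open>auto simp: indicator_def\<close>)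
  finally show ?thesis using t by simp
qed

text \<open>Cauchy-Schwarz in \<open>t\<close> against the constant 1, then Fubini. Dilation by
  \<open>t\<close> costs a factor \<open>t^(-n)\<close> in the squared norm, which is compensated by
  \<open>t^(2b)\<close> when \<open>b \<ge> n\<close>; so averaging is a contraction.\<close>

lemma radial_avg_L2_bound:
  fixes g :: "real^'n \<Rightarrow> 'b::euclidean_space"
  assumes b: "real CARD('n) \<le> b" and g: "continuous_on UNIV g"
  shows "L2_norm ball_measure (radial_avg b g) \<le> L2_norm ball_measure g"
proof -
  have b0: "0 < b" using b by (smt (verit) of_nat_0_less_iff zero_less_card_finite)
  have [measurable]: "g \<in> borel_measurable borel" using g by (rule borel_measurable_continuous_onI)
  obtain C where C: "0 \<le> C" "\<And>x. norm x \<le> 1 \<Longrightarrow> norm (g x) \<le> C"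
    using continuous_bounded_cball[OF continuous_on_subset[OF g subset_UNIV]] by blast
  define f where "f x t = (t powr b)\<^sup>2 * (norm (g (t *\<^sub>R x)))\<^sup>2" for x t
  have fm: "(\<lambda>z. f (fst z) (snd z)) \<in> borel_measurable (borel \<Otimes>\<^sub>M borel)"
    unfolding f_def by measurable
  have t_le: "norm (t *\<^sub>R x) \<le> 1" if "norm x < 1" "0 \<le> t" "t \<le> 1" for t and x :: "real^'n"
    using that mult_mono[of t 1 "norm x" 1] by simp
  have fb: "norm (f x t) \<le> C\<^sup>2" if "norm x < 1" "0 \<le> t" "t \<le> 1" for x t
  proof -
    have "t powr b \<le> 1" using that b0 by (simp add: powr_le1)
    then have "(t powr b)\<^sup>2 * (norm (g (t *\<^sub>R x)))\<^sup>2 \<le> 1 * C\<^sup>2"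
      using C t_le[OF that] by (intro mult_mono power_le_one power_mono) auto
    then show ?thesis by (simp add: f_def)
  qed
  interpret I: finite_measure unit_interval by (rule finite_unit_interval)
  have pt: "(norm (radial_avg b g x))\<^sup>2 \<le> (\<integral>t. f x t \<partial>unit_interval)" for x
  proof -
    let ?k = "\<lambda>t. t powr b *\<^sub>R g (t *\<^sub>R x)"
    have meas: "?k \<in> borel_measurable unit_interval"
      by (rule measurable_restrict_space1) measurable
    have "continuous_on {0..1} ?k" using b0 g by (rule radial_avg_continuous_integrand)
    then have "bounded (?k ` {0..1})"
      by (intro compact_imp_bounded compact_continuous_image) auto
    then obtain K where "\<forall>y\<in>?k ` {0..1}. norm y \<le> K" unfolding bounded_iff by blast
    then have kL: "?k \<in> L2 unit_interval"
      using meas by (intro L2_bounded[OF finite_unit_interval, where C=K]) auto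
    have oneL: "(\<lambda>_. 1 :: real) \<in> L2 unit_interval"
      by (rule L2_bounded[OF finite_unit_interval, where C=1]) auto
    have one: "L2_norm unit_interval (\<lambda>_. 1 :: real) = 1"
      by (simp add: L2_norm_def measure_restrict_space)
    have "norm (radial_avg b g x) \<le> (\<integral>t. norm (?k t) * norm (1::real) \<partial>unit_interval)"
      unfolding radial_avg_lebesgue[OF b0 g] using integral_norm_bound[of unit_interval ?k] by simp
    also have "\<dots> \<le> L2_norm unit_interval ?k * 1"
      using Cauchy_Schwarz_L2[OF kL oneL] unfolding one .
    finally have "(norm (radial_avg b g x))\<^sup>2 \<le> (L2_norm unit_interval ?k)\<^sup>2"
      by (intro power_mono) auto
    then show ?thesis by (simp add: L2_norm_power2 f_def power_mult_distrib)
  qed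
  note F = Fubini_ball_interval[OF fm fb]
  have sc: "(\<integral>x. f x t \<partial>ball_measure) \<le> (L2_norm ball_measure g)\<^sup>2" if t: "0 \<le> t" "t \<le> 1" for t
  proof (cases "t = 0")
    case True
    then show ?thesis using b0 by (simp add: f_def)
  next
    case False
    with t have t0: "0 < t" by simp
    have gi: "integrable ball_measure (\<lambda>y. (norm (g y))\<^sup>2)"
      by (intro continuous_integrable_ball continuous_intros g)
    have "(\<integral>x. f x t \<partial>ball_measure) = (1 / t ^ CARD('n)) * (\<integral>y. indicator (ball 0 t) y * ((t powr b)\<^sup>2 * (norm (g y))\<^sup>2) \<partial>ball_measure)"
      using integral_ball_rescale[of "\<lambda>x. (t powr b)\<^sup>2 * (norm (g (t *\<^sub>R x)))\<^sup>2", OF _ t0 t(2)] t0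
      by (simp add: f_def)
    also have "\<dots> = ((t powr b)\<^sup>2 / t ^ CARD('n)) * (\<integral>y. indicator (ball 0 t) y * (norm (g y))\<^sup>2 \<partial>ball_measure)"
      by (simp add: mult.left_commute[of _ "(t powr b)\<^sup>2"])
    also have "\<dots> \<le> 1 * (\<integral>y. (norm (g y))\<^sup>2 \<partial>ball_measure)"
    proof (rule mult_mono)
      have "(t powr b)\<^sup>2 = t powr (2 * b)" by (simp add: powr_add[symmetric] power2_eq_square)
      also have "\<dots> \<le> t powr real CARD('n)"
        using t0 t b b0 by (intro powr_mono') auto
      finally show "(t powr b)\<^sup>2 / t ^ CARD('n) \<le> 1"
        using t0 by (simp add: powr_realpow divide_le_eq)
      show "(\<integral>y. indicator (ball 0 t) y * (norm (g y))\<^sup>2 \<partial>ball_measure) \<le> (\<integral>y. (norm (g y))\<^sup>2 \<partial>ball_measure)"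
      proof (rule integral_mono[OF _ gi])
        show "integrable ball_measure (\<lambda>y. indicator (ball 0 t) y * (norm (g y))\<^sup>2)"
          by (rule Bochner_Integration.integrable_bound[OF gi])
            (auto simp: indicator_def intro!: measurable_ball_measure)
      qed (auto simp: indicator_def)
    qed (auto intro!: integral_nonneg_AE)
    finally show ?thesis by (simp add: L2_norm_power2)
  qed
  have "(L2_norm ball_measure (radial_avg b g))\<^sup>2 \<le> (\<integral>x. (\<integral>t. f x t \<partial>unit_interval) \<partial>ball_measure)"
    unfolding L2_norm_power2
  proof (rule integral_mono_AE')
    show "AE x in ball_measure. (norm (radial_avg b g x))\<^sup>2 \<le> (\<integral>t. f x t \<partial>unit_interval)"
      using pt by simp
  qed (use F(2) in \<open>auto intro!: AE_I2 integral_nonneg_AE simp: f_def\<close>)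
  also have "\<dots> = (\<integral>t. (\<integral>x. f x t \<partial>ball_measure) \<partial>unit_interval)" by (rule F(1))
  also have "\<dots> \<le> (\<integral>t. (L2_norm ball_measure g)\<^sup>2 \<partial>unit_interval)"
    by (rule integral_mono[OF F(3)]) (use sc in auto)
  also have "\<dots> = (L2_norm ball_measure g)\<^sup>2" by (simp add: measure_restrict_space)
  finally show ?thesis by (rule power2_le_imp_le) simp
qed

lemma radial_avg_diff:
  fixes f g :: "real^'n \<Rightarrow> 'b::euclidean_space"
  assumes "0 < b" "continuous_on UNIV f" "continuous_on UNIV g"
  shows "radial_avg b (\<lambda>x. f x - g x) x = radial_avg b f x - radial_avg b g x"
  unfolding radial_avg_def scaleR_diff_right
  by (intro integral_diff integrable_continuous_real radial_avg_continuous_integrand assms)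

lemma radial_avg_Cauchy:
  fixes f :: "nat \<Rightarrow> real^'n \<Rightarrow> 'b::euclidean_space"
  assumes b: "real CARD('n) \<le> b" and c: "\<And>k. continuous_on UNIV (f k)"
    and c': "\<And>k. continuous_on UNIV (radial_avg b (f k))" and L: "L2_tendsto ball_measure f g"
  obtains h where "L2_tendsto ball_measure (\<lambda>k. radial_avg b (f k)) h"
proof -
  let ?N = "L2_norm ball_measure"
  have b0: "0 < b" using b by (smt (verit) of_nat_0_less_iff zero_less_card_finite)
  have bd: "?N (\<lambda>x. radial_avg b (f i) x - radial_avg b (f j) x) \<le> ?N (\<lambda>x. f i x - g x) + ?N (\<lambda>x. f j x - g x)" for i j
  proof -
    have "?N (\<lambda>x. radial_avg b (f i) x - radial_avg b (f j) x) = ?N (radial_avg b (\<lambda>x. f i x - f j x))"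
      by (simp add: radial_avg_diff[OF b0 c c, symmetric])
    also have "\<dots> \<le> ?N (\<lambda>x. f i x - f j x)"
      by (intro radial_avg_L2_bound b continuous_intros c)
    also have "\<dots> \<le> ?N (\<lambda>x. f i x - g x) + ?N (\<lambda>x. g x - f j x)"
      by (intro L2_norm_triangle_diff L2_tendsto_L2[OF L])
    finally show ?thesis using L2_norm_minus_commute[of ball_measure g "f j"] by simp
  qed
  have "\<exists>h. L2_tendsto ball_measure (\<lambda>k. radial_avg b (f k)) h"
  proof (rule L2_complete)
    show "radial_avg b (f k) \<in> L2 ball_measure" for k by (intro continuous_L2_ball c')
    fix e :: real assume "0 < e"
    then have "\<forall>\<^sub>F k in sequentially. ?N (\<lambda>x. f k x - g x) < e / 2"
      using L unfolding L2_tendsto_def by (intro order_tendstoD) auto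
    then obtain N where N: "\<And>k. k \<ge> N \<Longrightarrow> ?N (\<lambda>x. f k x - g x) < e / 2"
      by (auto simp: eventually_sequentially)
    have "?N (\<lambda>x. radial_avg b (f i) x - radial_avg b (f j) x) < e" if "i \<ge> N" "j \<ge> N" for i j
      using bd[of i j] N[OF that(1)] N[OF that(2)] by simp
    then show "\<exists>N. \<forall>i\<ge>N. \<forall>j\<ge>N. ?N (\<lambda>x. radial_avg b (f i) x - radial_avg b (f j) x) < e" by blast
  qed
  then show thesis using that by blast
qed

text \<open>The contraction is used with exponent \<open>b\<close> for the functions and
  \<open>b + 1\<close> for their gradients. The boundary values are then Cauchy by the trace
  inequality, so the trace \<open>a\<close> is produced by the construction instead of being
  prescribed.\<close>

lemma radial_avg_sobolev:
  fixes H :: "real^'n \<Rightarrow> real"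
  assumes b: "real CARD('n) \<le> b" and \<phi>: "\<And>k. smooth (\<phi> k)" "L2_tendsto ball_measure \<phi> H"
    "L2_tendsto ball_measure (\<lambda>k. grad (\<phi> k)) G"
  obtains h K a where "L2_tendsto ball_measure (\<lambda>k. radial_avg b (\<phi> k)) h"
    "L2_tendsto ball_measure (\<lambda>k. grad (radial_avg b (\<phi> k))) K"
    "L2_tendsto sphere_measure (\<lambda>k. radial_avg b (\<phi> k)) a"
proof -
  have b0: "0 < b" using b by (smt (verit) of_nat_0_less_iff zero_less_card_finite)
  have s: "smooth (radial_avg b (\<phi> k))" for k by (rule smooth_radial_avg[OF b0 \<phi>(1)])
  obtain h where h: "L2_tendsto ball_measure (\<lambda>k. radial_avg b (\<phi> k)) h"
    using radial_avg_Cauchy[OF b smooth_continuous[OF \<phi>(1)] smooth_continuous[OF s] \<phi>(2)] by blast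
  have c: "continuous_on UNIV (radial_avg (b + 1) (grad (\<phi> k)))" for k
    using smooth_continuous_grad[OF s, of UNIV k] by (simp add: grad_radial_avg[OF b0 \<phi>(1)])
  have "real CARD('n) \<le> b + 1" using b by simp
  from radial_avg_Cauchy[OF this smooth_continuous_grad[OF \<phi>(1)] c \<phi>(3)]
  obtain K where K: "L2_tendsto ball_measure (\<lambda>k. grad (radial_avg b (\<phi> k))) K"
    unfolding grad_radial_avg[OF b0 \<phi>(1)] by blast
  let ?T = "\<lambda>k. radial_avg b (\<phi> k)"
  let ?n = "real CARD('n) + 2"
  have cauchy: "L2_norm sphere_measure (\<lambda>x. ?T i x - ?T j x)
      \<le> ?n * ((L2_norm ball_measure (\<lambda>x. ?T i x - h x) + L2_norm ball_measure (\<lambda>x. ?T j x - h x))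
        + (L2_norm ball_measure (\<lambda>x. grad (?T i) x - K x) + L2_norm ball_measure (\<lambda>x. grad (?T j) x - K x)))" for i j
  proof -
    have "L2_norm sphere_measure (\<lambda>x. ?T i x - ?T j x)
      \<le> ?n * (L2_norm ball_measure (\<lambda>x. ?T i x - ?T j x) + L2_norm ball_measure (\<lambda>x. grad (?T i) x - grad (?T j) x))"
      by (intro trace_inequality sobolev_triple_diff sobolev_triple_smooth s)
    also have "\<dots> \<le> ?n * ((L2_norm ball_measure (\<lambda>x. ?T i x - h x) + L2_norm ball_measure (\<lambda>x. h x - ?T j x))
        + (L2_norm ball_measure (\<lambda>x. grad (?T i) x - K x) + L2_norm ball_measure (\<lambda>x. K x - grad (?T j) x)))"
      by (intro mult_left_mono add_mono L2_norm_triangle_diff L2_tendsto_L2[OF h] L2_tendsto_L2[OF K]) simp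
    finally show ?thesis
      using L2_norm_minus_commute[of ball_measure h "?T j"] L2_norm_minus_commute[of ball_measure K "grad (?T j)"] by simp
  qed
  have "\<exists>a. L2_tendsto sphere_measure ?T a"
  proof (rule L2_complete)
    show "?T k \<in> L2 sphere_measure" for k by (rule smooth_L2_sphere[OF s])
    fix e :: real assume e: "0 < e"
    \<comment> \<open>The estimate \<open>cauchy\<close> has four error terms inside the factor
      \<open>?n\<close>.\<close>
    define d where "d = e / (4 * ?n)"
    have d: "0 < d" using e by (simp add: d_def add_nonneg_pos)
    have "\<forall>\<^sub>F k in sequentially. L2_norm ball_measure (\<lambda>x. ?T k x - h x) < d \<and> L2_norm ball_measure (\<lambda>x. grad (?T k) x - K x) < d"
      using h K d unfolding L2_tendsto_def by (intro eventually_conj order_tendstoD) auto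
    then obtain N where N: "\<And>k. k \<ge> N \<Longrightarrow> L2_norm ball_measure (\<lambda>x. ?T k x - h x) < d"
       "\<And>k. k \<ge> N \<Longrightarrow> L2_norm ball_measure (\<lambda>x. grad (?T k) x - K x) < d"
      by (auto simp: eventually_sequentially)
    have "L2_norm sphere_measure (\<lambda>x. ?T i x - ?T j x) < e" if "i \<ge> N" "j \<ge> N" for i j
    proof -
      have "L2_norm sphere_measure (\<lambda>x. ?T i x - ?T j x) < ?n * ((d + d) + (d + d))"
        by (rule le_less_trans[OF cauchy], intro mult_strict_left_mono add_strict_mono N that) simp
      also have "\<dots> = e" by (simp add: d_def field_simps add_nonneg_eq_0_iff)
      finally show ?thesis .
    qed
    then show "\<exists>N. \<forall>i\<ge>N. \<forall>j\<ge>N. L2_norm sphere_measure (\<lambda>x. ?T i x - ?T j x) < e" by blast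
  qed
  with h K show thesis using that by blast
qed

section \<open>Transposing the average, and weak harmonicity of the averaged function\<close>

section \<open>The adjoint of the dilation average\<close>

text \<open>The transpose of the average with exponent \<open>b + 1\<close>, applied to
  \<open>grad \<psi>\<close>, when \<open>c = b + 1 - n\<close>. The indicator expresses that
  \<open>y / t\<close> lies in the unit ball.\<close>

definition dual_field :: "real \<Rightarrow> (real^'n \<Rightarrow> real) \<Rightarrow> real^'n \<Rightarrow> real^'n" where
  "dual_field c \<psi> y =
     (\<integral>t. indicator {t. norm y < t} t *\<^sub>R (t powr c *\<^sub>R grad \<psi> ((1 / t) *\<^sub>R y)) \<partial>unit_interval)"

lemma dual_integrand_bound:
  fixes y :: "real^'n"
  assumes C: "\<And>x. norm x \<le> 1 \<Longrightarrow> norm (grad \<psi> x) \<le> C" "0 \<le> C" and c: "0 \<le> c" and t: "0 \<le> t" "t \<le> 1"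
  shows "norm (indicator {t. norm y < t} t *\<^sub>R (t powr c *\<^sub>R grad \<psi> ((1 / t) *\<^sub>R y))) \<le> C"
proof (cases "norm y < t")
  case True
  then have t0: "0 < t" using norm_ge_zero[of y] by linarith
  have "norm ((1 / t) *\<^sub>R y) \<le> 1" using True t0 by (simp add: divide_le_eq)
  then have "t powr c * norm (grad \<psi> ((1 / t) *\<^sub>R y)) \<le> 1 * C"
    using C t c by (intro mult_mono powr_le1) auto
  then show ?thesis using True by simp
qed (use C in simp)

lemma dual_integrand_measurable:
  fixes \<psi> :: "real^'n \<Rightarrow> real"
  assumes "smooth \<psi>"
  shows "(\<lambda>z. indicator {t. norm (fst z) < t} (snd z) *\<^sub>R (snd z powr c *\<^sub>R grad \<psi> ((1 / snd z) *\<^sub>R fst z)))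
     \<in> borel_measurable (borel \<Otimes>\<^sub>M borel)"
proof -
  note [measurable] = smooth_grad_measurable[OF assms]
  have "(\<lambda>z. indicator {z. norm (fst z) < snd z} z *\<^sub>R (snd z powr c *\<^sub>R grad \<psi> ((1 / snd z) *\<^sub>R fst z)))
     \<in> borel_measurable (borel \<Otimes>\<^sub>M borel)" by measurable
  then show ?thesis by (simp add: indicator_def)
qed

lemma dual_integrand_integrable:
  fixes y :: "real^'n"
  assumes \<psi>: "smooth \<psi>" and c: "0 \<le> c"
  shows "integrable unit_interval (\<lambda>t. indicator {t. norm y < t} t *\<^sub>R (t powr c *\<^sub>R grad \<psi> ((1 / t) *\<^sub>R y)))"
proof -
  interpret I: finite_measure unit_interval by (rule finite_unit_interval)
  obtain C where C: "0 \<le> C" "\<And>x. norm x \<le> 1 \<Longrightarrow> norm (grad \<psi> x) \<le> C"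
    using continuous_bounded_cball[OF smooth_continuous_grad[OF \<psi>]] by blast
  note [measurable] = smooth_grad_measurable[OF \<psi>]
  show ?thesis
  proof (rule I.integrable_const_bound[of _ C])
    show "AE t in unit_interval. norm (indicator {t. norm y < t} t *\<^sub>R (t powr c *\<^sub>R grad \<psi> ((1 / t) *\<^sub>R y))) \<le> C"
      using dual_integrand_bound[OF C(2,1) c] by (intro AE_I2) simp
    show "(\<lambda>t. indicator {t. norm y < t} t *\<^sub>R (t powr c *\<^sub>R grad \<psi> ((1 / t) *\<^sub>R y))) \<in> borel_measurable unit_interval"
      by (rule measurable_restrict_space1) measurable
  qed
qed

lemma dual_field_bounded:
  fixes \<psi> :: "real^'n \<Rightarrow> real"
  assumes "smooth \<psi>" "0 \<le> c"
  obtains C where "0 \<le> C" "\<And>y. norm (dual_field c \<psi> y) \<le> C"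
proof -
  interpret I: finite_measure unit_interval by (rule finite_unit_interval)
  obtain C where C: "0 \<le> C" "\<And>x. norm x \<le> 1 \<Longrightarrow> norm (grad \<psi> x) \<le> C"
    using continuous_bounded_cball[OF smooth_continuous_grad[OF assms(1)]] by blast
  have "norm (dual_field c \<psi> y) \<le> C" for y
  proof -
    let ?k = "\<lambda>t. indicator {t. norm y < t} t *\<^sub>R (t powr c *\<^sub>R grad \<psi> ((1 / t) *\<^sub>R y))"
    have "norm (dual_field c \<psi> y) \<le> (\<integral>t. norm (?k t) \<partial>unit_interval)"
      unfolding dual_field_def by (rule integral_norm_bound)
    also have "\<dots> \<le> (\<integral>t. C \<partial>unit_interval)"
    proof (rule integral_mono)
      show "integrable unit_interval (\<lambda>t. norm (?k t))"
        using dual_integrand_integrable[OF assms] by (rule integrable_norm)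
      show "norm (?k t) \<le> C" if "t \<in> space unit_interval" for t
        using dual_integrand_bound[OF C(2,1) assms(2)] that by simp
    qed simp
    also have "\<dots> = C" by (simp add: measure_restrict_space)
    finally show ?thesis .
  qed
  with C(1) show thesis by (rule that)
qed

lemma dual_field_measurable:
  fixes \<psi> :: "real^'n \<Rightarrow> real"
  assumes "smooth \<psi>"
  shows "dual_field c \<psi> \<in> borel_measurable borel"
proof -
  interpret I: finite_measure unit_interval by (rule finite_unit_interval)
  have "(\<lambda>z. z) \<in> (borel :: (real^'n) measure) \<Otimes>\<^sub>M unit_interval \<rightarrow>\<^sub>M borel \<Otimes>\<^sub>M borel"
  proof -
    have "snd \<in> (borel :: (real^'n) measure) \<Otimes>\<^sub>M unit_interval \<rightarrow>\<^sub>M borel"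
      by (rule measurable_compose[OF measurable_snd, where g="\<lambda>x. x"], rule measurable_restrict_space1) simp
    then have "(\<lambda>z. (fst z, snd z)) \<in> (borel :: (real^'n) measure) \<Otimes>\<^sub>M unit_interval \<rightarrow>\<^sub>M borel \<Otimes>\<^sub>M borel"
      by (intro measurable_Pair measurable_fst)
    then show ?thesis by simp
  qed
  from measurable_compose[OF this dual_integrand_measurable[OF assms, of c]]
  show ?thesis unfolding dual_field_def[abs_def]
    by (intro I.borel_measurable_lebesgue_integral) (simp add: case_prod_beta)
qed

lemma dual_field_L2:
  fixes \<psi> :: "real^'n \<Rightarrow> real"
  assumes "smooth \<psi>" "0 \<le> c"
  shows "dual_field c \<psi> \<in> L2 ball_measure"
proof -
  obtain C where "\<And>y. norm (dual_field c \<psi> y) \<le> C"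
    using dual_field_bounded[OF assms] by blast
  then show ?thesis
    by (intro L2_bounded[OF finite_ball_measure, where C=C] measurable_ball_measure dual_field_measurable assms)
qed

text \<open>Fubini, the substitution \<open>y = t x\<close> for fixed \<open>t\<close>, and Fubini
  again. The Jacobian \<open>t^(-n)\<close> lowers the exponent \<open>b + 1\<close> to that of the
  dual field.\<close>

lemma radial_avg_dual:
  fixes \<phi> \<psi> :: "real^'n \<Rightarrow> real"
  assumes b: "real CARD('n) \<le> b" and \<phi>: "smooth \<phi>" and \<psi>: "smooth \<psi>"
  shows "(\<integral>x. grad (radial_avg b \<phi>) x \<bullet> grad \<psi> x \<partial>ball_measure)
    = (\<integral>y. grad \<phi> y \<bullet> dual_field (b + 1 - real CARD('n)) \<psi> y \<partial>ball_measure)"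
proof -
  have b0: "0 < b" using b by (smt (verit) of_nat_0_less_iff zero_less_card_finite)
  define c where "c = b + 1 - real CARD('n)"
  have c0: "0 \<le> c" using b by (simp add: c_def)
  note [measurable] = smooth_grad_measurable[OF \<phi>] smooth_grad_measurable[OF \<psi>]
  obtain C where C: "0 \<le> C" "\<And>x. norm x \<le> 1 \<Longrightarrow> norm (grad \<phi> x) \<le> C"
    using continuous_bounded_cball[OF smooth_continuous_grad[OF \<phi>]] by blast
  obtain D where D: "0 \<le> D" "\<And>x. norm x \<le> 1 \<Longrightarrow> norm (grad \<psi> x) \<le> D"
    using continuous_bounded_cball[OF smooth_continuous_grad[OF \<psi>]] by blast
  define k where "k y t = indicator {t. norm y < t} t *\<^sub>R (t powr c *\<^sub>R grad \<psi> ((1 / t) *\<^sub>R y))" for y t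
  define f where "f x t = (t powr (b + 1) *\<^sub>R grad \<phi> (t *\<^sub>R x)) \<bullet> grad \<psi> x" for x t
  define g where "g y t = grad \<phi> y \<bullet> k y t" for y t
  have fm: "(\<lambda>z. f (fst z) (snd z)) \<in> borel_measurable (borel \<Otimes>\<^sub>M borel)"
    unfolding f_def by measurable
  have gm: "(\<lambda>z. g (fst z) (snd z)) \<in> borel_measurable (borel \<Otimes>\<^sub>M borel)"
    unfolding g_def k_def
    by (intro borel_measurable_inner dual_integrand_measurable \<psi>) measurable
  have fb: "norm (f x t) \<le> C * D" if "norm x < 1" "0 \<le> t" "t \<le> 1" for x t
  proof -
    have "norm (t *\<^sub>R x) \<le> 1" using that mult_mono[of t 1 "norm x" 1] by simp
    then have "t powr (b + 1) * norm (grad \<phi> (t *\<^sub>R x)) \<le> 1 * C"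
      using C that b0 by (intro mult_mono powr_le1) auto
    then have "norm (t powr (b + 1) *\<^sub>R grad \<phi> (t *\<^sub>R x)) * norm (grad \<psi> x) \<le> C * D"
      using C D that by (intro mult_mono) auto
    then show ?thesis unfolding f_def real_norm_def using Cauchy_Schwarz_ineq2 order_trans by blast
  qed
  have gb: "norm (g y t) \<le> C * D" if "norm y < 1" "0 \<le> t" "t \<le> 1" for y t
  proof -
    have "norm (grad \<phi> y) * norm (k y t) \<le> C * D"
      using dual_integrand_bound[OF D(2,1) c0 that(2,3), of y] C that(1)
      unfolding k_def by (intro mult_mono) auto
    then show ?thesis unfolding g_def real_norm_def using Cauchy_Schwarz_ineq2 order_trans by blast
  qed
  have "(\<integral>x. grad (radial_avg b \<phi>) x \<bullet> grad \<psi> x \<partial>ball_measure) = (\<integral>x. (\<integral>t. f x t \<partial>unit_interval) \<partial>ball_measure)"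
  proof (rule Bochner_Integration.integral_cong[OF refl])
    fix x
    have b1: "0 < b + 1" using b0 by simp
    note cont = radial_avg_continuous_integrand[OF b1 smooth_continuous_grad[OF \<phi>], of x]
    have "integrable unit_interval (\<lambda>t. t powr (b + 1) *\<^sub>R grad \<phi> (t *\<^sub>R x))"
      using borel_integrable_atLeastAtMost'[OF cont] by (simp add: set_integrable_def integrable_restrict_space)
    then show "grad (radial_avg b \<phi>) x \<bullet> grad \<psi> x = (\<integral>t. f x t \<partial>unit_interval)"
      unfolding f_def grad_radial_avg[OF b0 \<phi>] radial_avg_lebesgue[OF b1 smooth_continuous_grad[OF \<phi>]]
      by (intro integral_inner_left[symmetric])
  qed
  also have "\<dots> = (\<integral>t. (\<integral>x. f x t \<partial>ball_measure) \<partial>unit_interval)"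
    by (rule Fubini_ball_interval(1)[OF fm fb])
  also have "\<dots> = (\<integral>t. (\<integral>y. g y t \<partial>ball_measure) \<partial>unit_interval)"
  proof (rule Bochner_Integration.integral_cong[OF refl])
    fix t assume "t \<in> space unit_interval"
    then consider "t = 0" | "0 < t" "t \<le> 1" by fastforce
    then show "(\<integral>x. f x t \<partial>ball_measure) = (\<integral>y. g y t \<partial>ball_measure)"
    proof cases
      case 1
      then show ?thesis using b0 by (simp add: f_def g_def k_def)
    next
      case 2
      have "(\<integral>x. f x t \<partial>ball_measure)
          = (1 / t ^ CARD('n)) *\<^sub>R (\<integral>y. indicator (ball 0 t) y *\<^sub>R f ((1 / t) *\<^sub>R y) t \<partial>ball_measure)"
        by (rule integral_ball_rescale[OF _ 2]) (unfold f_def, measurable)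
      also have "\<dots> = (\<integral>y. (1 / t ^ CARD('n)) *\<^sub>R (indicator (ball 0 t) y *\<^sub>R f ((1 / t) *\<^sub>R y) t) \<partial>ball_measure)"
        by simp
      also have "\<dots> = (\<integral>y. g y t \<partial>ball_measure)"
      proof (rule Bochner_Integration.integral_cong[OF refl])
        fix y :: "real^'n"
        have "t powr (b + 1) / t ^ CARD('n) = t powr c"
          using 2 by (simp add: c_def powr_diff powr_realpow)
        then have "t powr (b + 1) * z / t ^ CARD('n) = t powr c * z" for z
          by (metis times_divide_eq_left)
        then show "(1 / t ^ CARD('n)) *\<^sub>R (indicator (ball 0 t) y *\<^sub>R f ((1 / t) *\<^sub>R y) t) = g y t"
          using 2 by (auto simp: f_def g_def k_def indicator_def)
      qed
      finally show ?thesis .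
    qed
  qed
  also have "\<dots> = (\<integral>y. (\<integral>t. g y t \<partial>unit_interval) \<partial>ball_measure)"
    by (rule Fubini_ball_interval(1)[OF gm gb, symmetric])
  also have "\<dots> = (\<integral>y. grad \<phi> y \<bullet> dual_field c \<psi> y \<partial>ball_measure)"
    unfolding g_def dual_field_def k_def
    by (intro Bochner_Integration.integral_cong refl integral_inner_right dual_integrand_integrable \<psi> c0)
  finally show ?thesis unfolding c_def .
qed

text \<open>The dual field is, up to an endpoint term, the gradient of the integral of
  \<open>t^c \<psi>(y / t)\<close> over \<open>|y| < t < 1\<close>. This is approximated by a
  difference of two integrals starting at a fixed \<open>\<delta> > 0\<close>, away from the
  singularity at \<open>t = 0\<close>, so that only upper limits depend on \<open>y\<close>.\<close>

definition cone_integral :: "real \<Rightarrow> real \<Rightarrow> (real^'n \<Rightarrow> 'b::euclidean_space) \<Rightarrow> real \<Rightarrow> real^'n \<Rightarrow> 'b" where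
  "cone_integral \<delta> c \<psi> \<alpha> y = integral {\<delta>..\<alpha>} (\<lambda>t. t powr c *\<^sub>R \<psi> ((1 / t) *\<^sub>R y))"

lemma cone_integrand_continuous:
  fixes \<psi> :: "real^'n \<Rightarrow> 'b::euclidean_space"
  assumes "continuous_on UNIV \<psi>" "continuous_on S f" "continuous_on S h" "\<And>z. z \<in> S \<Longrightarrow> 0 < f z"
  shows "continuous_on S (\<lambda>z. f z powr c *\<^sub>R \<psi> ((1 / f z) *\<^sub>R h z))"
  using assms(4)
  by (intro continuous_on_scaleR continuous_on_powr' continuous_on_UNIV_compose[OF assms(1)]
      continuous_on_divide continuous_on_const assms(2,3)) (auto simp: less_imp_neq[symmetric] less_imp_le)

lemma has_derivative_cone_integral_const:
  assumes \<delta>: "0 < \<delta>" and \<psi>: "smooth \<psi>"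
  shows "(cone_integral \<delta> c \<psi> \<alpha> has_derivative (\<lambda>d. d \<bullet> cone_integral \<delta> (c - 1) (grad \<psi>) \<alpha> y)) (at y)"
  unfolding cone_integral_def
proof (rule has_derivative_parametric_integral)
  show "((\<lambda>y. t powr c *\<^sub>R \<psi> ((1 / t) *\<^sub>R y)) has_derivative (\<lambda>d. d \<bullet> t powr (c - 1) *\<^sub>R grad \<psi> ((1 / t) *\<^sub>R y))) (at y)"
    if "t \<in> {\<delta>..\<alpha>}" for y t
  proof -
    have "((\<lambda>y. (1 / t) *\<^sub>R y) has_derivative (\<lambda>d. (1 / t) *\<^sub>R d)) (at y)"
      by (auto intro!: derivative_eq_intros)
    from has_derivative_scaleR_right[OF has_derivative_compose[OF this smooth_has_derivative[OF \<psi>]], of "t powr c"]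
    show ?thesis using that \<delta> by (simp add: powr_diff)
  qed
  show "continuous_on {\<delta>..\<alpha>} (\<lambda>t. t powr c *\<^sub>R \<psi> ((1 / t) *\<^sub>R y))" for y
    by (rule cone_integrand_continuous) (use \<delta> \<psi> in \<open>auto intro: smooth_continuous continuous_intros\<close>)
  show "continuous_on (UNIV \<times> {\<delta>..\<alpha>}) (\<lambda>(y, t). t powr (c - 1) *\<^sub>R grad \<psi> ((1 / t) *\<^sub>R y))"
    unfolding case_prod_beta
    by (rule cone_integrand_continuous) (use \<delta> \<psi> in \<open>auto intro: smooth_continuous_grad continuous_intros\<close>)
qed

text \<open>Leibniz's rule with a moving endpoint: the integral is differentiated jointly in
  \<open>y\<close> and its upper limit, then composed with
  \<open>y \<mapsto> (y, a y)\<close>.\<close>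

lemma has_derivative_cone_integral:
  fixes \<psi> a :: "real^'n \<Rightarrow> real"
  assumes \<delta>: "0 < \<delta>" and \<psi>: "smooth \<psi>" and a: "smooth a" "\<delta> < a y"
  shows "((\<lambda>y. cone_integral \<delta> c \<psi> (a y) y) has_derivative
    (\<lambda>d. d \<bullet> (cone_integral \<delta> (c - 1) (grad \<psi>) (a y) y
      + (a y powr c * \<psi> ((1 / a y) *\<^sub>R y)) *\<^sub>R grad a y))) (at y)"
proof -
  let ?k = "\<lambda>y \<alpha>. \<alpha> powr c *\<^sub>R \<psi> ((1 / \<alpha>) *\<^sub>R y)"
  have cont: "continuous_on {\<delta>..\<beta>} (?k y)" for \<beta> y
    by (rule cone_integrand_continuous) (use \<delta> \<psi> in \<open>auto intro: smooth_continuous continuous_intros\<close>)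
  have "((\<lambda>(y, \<alpha>). cone_integral \<delta> c \<psi> \<alpha> y) has_derivative
      (\<lambda>(d, s). d \<bullet> cone_integral \<delta> (c - 1) (grad \<psi>) (a y) y + blinfun_apply (blinfun_inner_left (?k y (a y))) s))
      (at (y, a y) within UNIV \<times> {\<delta><..})"
  proof (rule has_derivative_partialsI)
    show "((\<lambda>y. cone_integral \<delta> c \<psi> (a y0) y) has_derivative
        (\<lambda>d. d \<bullet> cone_integral \<delta> (c - 1) (grad \<psi>) (a y0) y)) (at y within UNIV)" for y y0
      using has_derivative_cone_integral_const[OF \<delta> \<psi>] by simp
    show "((\<lambda>\<alpha>. cone_integral \<delta> c \<psi> \<alpha> y) has_derivative blinfun_apply (blinfun_inner_left (?k y \<alpha>)))
        (at \<alpha> within {\<delta><..})" if "\<alpha> \<in> {\<delta><..}" for y \<alpha>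
    proof -
      \<comment> \<open>The interval reaches beyond \<open>\<alpha>\<close>, so that
        \<open>\<alpha>\<close> is interior and the derivative is two-sided.\<close>
      have "((\<lambda>\<alpha>. cone_integral \<delta> c \<psi> \<alpha> y) has_vector_derivative ?k y \<alpha>) (at \<alpha> within {\<delta>..\<alpha> + 1})"
        unfolding cone_integral_def
        by (rule integral_has_vector_derivative[OF cont]) (use that in auto)
      moreover have "at \<alpha> within {\<delta>..\<alpha> + 1} = at \<alpha>"
        by (rule at_within_interior) (use that in auto)
      ultimately show ?thesis
        by (auto simp: has_vector_derivative_def intro: has_derivative_at_withinI)
    qed
    have "continuous_on (UNIV \<times> {\<delta><..}) (\<lambda>z. (snd z) powr c *\<^sub>R \<psi> ((1 / snd z) *\<^sub>R fst z))"
      by (rule cone_integrand_continuous) (use \<delta> \<psi> in \<open>auto intro: smooth_continuous continuous_intros\<close>)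
    from bounded_linear.continuous_on[OF bounded_linear_blinfun_inner_left this]
    show "continuous (at (y, a y) within UNIV \<times> {\<delta><..}) (\<lambda>(y, \<alpha>). blinfun_inner_left (?k y \<alpha>))"
      using a(2) by (simp add: continuous_on_eq_continuous_within case_prod_unfold)
  qed (use a in auto)
  moreover have "at (y, a y) within UNIV \<times> {\<delta><..} = at (y, a y)"
    by (rule at_within_open) (use a in \<open>auto intro: open_Times\<close>)
  ultimately have "((\<lambda>(y, \<alpha>). cone_integral \<delta> c \<psi> \<alpha> y) has_derivative
      (\<lambda>(d, s). d \<bullet> cone_integral \<delta> (c - 1) (grad \<psi>) (a y) y + s * ?k y (a y))) (at (y, a y))"
    by simp
  moreover have "((\<lambda>y. (y, a y)) has_derivative (\<lambda>d. (d, d \<bullet> grad a y))) (at y)"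
    using smooth_has_derivative[OF a(1)] by (intro has_derivative_Pair has_derivative_ident)
  ultimately have "((\<lambda>y. (\<lambda>(y, \<alpha>). cone_integral \<delta> c \<psi> \<alpha> y) (y, a y)) has_derivative
      (\<lambda>d. (\<lambda>(d, s). d \<bullet> cone_integral \<delta> (c - 1) (grad \<psi>) (a y) y + s * ?k y (a y)) (d, d \<bullet> grad a y))) (at y)"
    by (rule has_derivative_compose[rotated])
  then show ?thesis by (simp add: inner_add_right mult_ac)
qed

lemma cone_integral_nth:
  assumes \<delta>: "0 < \<delta>" and \<psi>: "smooth \<psi>"
  shows "cone_integral \<delta> c (grad \<psi>) \<alpha> y $ i = cone_integral \<delta> c (partial i \<psi>) \<alpha> y"
proof -
  have "(\<lambda>t. t powr c *\<^sub>R grad \<psi> ((1 / t) *\<^sub>R y)) integrable_on {\<delta>..\<alpha>}"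
    by (rule integrable_continuous_real, rule cone_integrand_continuous)
      (use \<delta> \<psi> in \<open>auto intro: smooth_continuous_grad continuous_intros\<close>)
  from integral_linear[OF this bounded_linear_vec_nth[of i]] show ?thesis
    by (simp add: cone_integral_def o_def)
qed

text \<open>The gradient is a cone integral with exponent \<open>c - 1\<close> and a derivative of
  \<open>\<psi>\<close>, plus an explicit smooth endpoint term; hence the induction over all
  \<open>c\<close> and \<open>\<psi>\<close>.\<close>

lemma smooth_cone_integral:
  fixes \<psi> a :: "real^'n \<Rightarrow> real"
  assumes \<delta>: "0 < \<delta>" and a: "smooth a" "\<And>y. \<delta> < a y" and \<psi>: "smooth \<psi>"
  shows "smooth (\<lambda>y. cone_integral \<delta> c \<psi> (a y) y)"
proof -
  have a0: "0 < a y" for y using \<delta> a(2)[of y] by linarith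
  have "k_times_differentiable k (\<lambda>y. cone_integral \<delta> c \<psi> (a y) y)" for k
    using \<psi>
  proof (induction k arbitrary: c \<psi>)
    case (Suc k)
    have "smooth (\<lambda>y. 1 / a y)"
      using smooth_divide[OF smooth_const a(1)] a0 less_imp_neq by metis
    then have "smooth (\<lambda>y. (a y powr c * \<psi> ((1 / a y) *\<^sub>R y)) * partial i a y)" for i
      by (intro smooth_mult smooth_powr smooth_rescale smooth_partial a(1) a0 Suc.prems)
    then have s: "k_times_differentiable k (\<lambda>y. (a y powr c * \<psi> ((1 / a y) *\<^sub>R y)) * partial i a y)" for i
      by (simp add: smooth_def)
    show ?case
    proof (rule k_times_SucI[OF has_derivative_cone_integral[OF \<delta> Suc.prems a]])
      show "k_times_differentiable k (\<lambda>y. (cone_integral \<delta> (c - 1) (grad \<psi>) (a y) y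
          + (a y powr c * \<psi> ((1 / a y) *\<^sub>R y)) *\<^sub>R grad a y) $ i)" for i
        unfolding vector_add_component vector_scaleR_component real_scaleR_def grad_nth
          cone_integral_nth[OF \<delta> Suc.prems]
        by (intro k_times_add Suc.IH smooth_partial Suc.prems s)
    qed
  qed simp
  then show ?thesis by (simp add: smooth_def)
qed

lemma sobolev_triple_cong_sphere:
  assumes "sobolev_triple u G f" "\<And>x. norm x = 1 \<Longrightarrow> f x = g x" "g \<in> borel_measurable sphere_measure"
  shows "sobolev_triple u G g"
proof -
  obtain \<phi> where \<phi>: "\<And>k. smooth (\<phi> k)" "L2_tendsto ball_measure \<phi> u"
    "L2_tendsto ball_measure (\<lambda>k. grad (\<phi> k)) G" "L2_tendsto sphere_measure \<phi> f"
    using sobolev_tripleE[OF assms(1)] by blast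
  have "L2_tendsto sphere_measure \<phi> g"
    by (rule L2_tendsto_cong_AE[OF \<phi>(4) _ assms(3)]) (use assms(2) in \<open>auto intro: AE_I2\<close>)
  with \<phi> show ?thesis unfolding sobolev_triple_def by blast
qed

text \<open>For a smooth \<open>\<psi>\<close> the adjoint average \<open>V y = \<integral>\<^bsub>\<bar>y\<bar>\<^esub>\<^bsup>1\<^esup> t\<^sup>c \<psi> (y/t) dt\<close> vanishes on the sphere,
  but is not smooth at the origin.  Shifting \<open>\<bar>y\<bar>\<^sup>2\<close> by \<open>\<epsilon>\<close> makes it smooth.\<close>
lemma dual_field_orthogonal:
  fixes \<psi> :: "real^'n \<Rightarrow> real"
  assumes c: "1 \<le> c" and \<psi>: "smooth \<psi>" and G: "G \<in> L2 ball_measure"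
    and orth: "\<And>W. smooth W \<Longrightarrow> (\<And>x. norm x = 1 \<Longrightarrow> W x = 0) \<Longrightarrow> (\<integral>x. G x \<bullet> grad W x \<partial>ball_measure) = 0"
  shows "(\<integral>y. G y \<bullet> dual_field (c - 1) \<psi> y \<partial>ball_measure)
    = (\<integral>y. G y \<bullet> ((norm y powr c * \<psi> (sgn y)) *\<^sub>R sgn y) \<partial>ball_measure)"
proof -
  obtain C where C: "0 \<le> C" "\<And>x. norm x \<le> 1 \<Longrightarrow> norm (grad \<psi> x) \<le> C"
    using continuous_bounded_cball[OF smooth_continuous_grad[OF \<psi>]] by blast
  obtain D where D: "0 \<le> D" "\<And>x. norm x \<le> 1 \<Longrightarrow> norm (\<psi> x) \<le> D"
    using continuous_bounded_cball[OF smooth_continuous[OF \<psi>]] by blast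
  define e where "e k = 1 / real (Suc k)" for k
  have e: "0 < e k" "e k \<le> 1" for k by (auto simp: e_def)
  have e0: "e \<longlonglongrightarrow> 0" unfolding e_def using LIMSEQ_inverse_real_of_nat by (simp add: inverse_eq_divide)
  \<comment> \<open>A smoothed norm. Its constant value \<open>u k\<close> on the unit sphere
    replaces the upper limit 1, so that \<open>W k\<close> below vanishes there exactly.\<close>
  define a where "a k y = ((norm y)\<^sup>2 + e k) powr (1 / 2)" for k and y :: "real^'n"
  define u where "u k = (1 + e k) powr (1 / 2)" for k
  \<comment> \<open>Half of the minimum of \<open>a k\<close>, hence strictly below all its
    values.\<close>
  define \<delta> where "\<delta> k = sqrt (e k) / 2" for k
  have l: "smooth (\<lambda>y::real^'n. (norm y)\<^sup>2 + e k)" "0 < (norm y)\<^sup>2 + e k" for k and y :: "real^'n"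
    using e(1)[of k] by (auto intro: add_nonneg_pos)
  have a_sqrt: "a k y = sqrt ((norm y)\<^sup>2 + e k)" for k y
    using l(2)[where k=k and y=y] by (simp add: a_def powr_half_sqrt)
  have u_sqrt: "u k = sqrt (1 + e k)" for k
    using e(1)[of k] by (simp add: u_def powr_half_sqrt)
  have \<delta>0: "0 < \<delta> k" for k using e(1) by (simp add: \<delta>_def)
  have \<delta>a: "\<delta> k < a k y" for k y
  proof -
    have "sqrt (e k) \<le> a k y" unfolding a_sqrt by simp
    moreover have "0 < sqrt (e k)" using e(1) by simp
    ultimately show ?thesis unfolding \<delta>_def by linarith
  qed
  have ua: "u k = a k y" if "norm y = 1" for k y using that by (simp add: a_def u_def)
  have \<delta>u: "\<delta> k < u k" for k
    using \<delta>a[of k "axis undefined 1"] ua[of "axis undefined 1" k] by (simp add: norm_axis_1)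
  have a_smooth: "smooth (a k)" for k unfolding a_def by (rule smooth_powr[OF l])
  have norm_a: "norm y \<le> a k y" for k y
    unfolding a_sqrt using e(1)[of k] by (intro real_le_rsqrt) simp
  have grad_a: "grad (a k) y = (1 / a k y) *\<^sub>R y" for k y
  proof -
    have "((\<lambda>s. s powr (1 / 2)) has_real_derivative (1 / 2) * s powr (1 / 2 - 1)) (at s)" if "0 < s" for s :: real
      by (rule has_real_derivative_powr[OF that])
    from grad_eqI[OF grad_compose_real[OF l(1) this[OF l(2)]]]
    have "grad (a k) y = ((1 / 2) * ((norm y)\<^sup>2 + e k) powr (1 / 2 - 1)) *\<^sub>R grad (\<lambda>y. (norm y)\<^sup>2 + e k) y"
      unfolding a_def .
    also have "grad (\<lambda>y::real^'n. (norm y)\<^sup>2 + e k) y = 2 *\<^sub>R y"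
      using grad_add[OF smooth_norm_power2 smooth_const] by (simp add: grad_norm_power2)
    also have "((norm y)\<^sup>2 + e k) powr (1 / 2 - 1) = 1 / a k y"
      using l(2)[where k=k and y=y] powr_minus_divide[of "(norm y)\<^sup>2 + e k" "1/2"] by (simp add: a_def)
    finally show ?thesis by simp
  qed
  define W where "W k y = cone_integral (\<delta> k) c \<psi> (u k) y - cone_integral (\<delta> k) c \<psi> (a k y) y" for k y
  have sW: "smooth (\<lambda>y. cone_integral (\<delta> k) c \<psi> (u k) y)" "smooth (\<lambda>y. cone_integral (\<delta> k) c \<psi> (a k y) y)" for k
    using smooth_cone_integral[OF \<delta>0 smooth_const \<delta>u \<psi>] smooth_cone_integral[OF \<delta>0 a_smooth \<delta>a \<psi>] by auto
  have W: "smooth (W k)" "\<And>x. norm x = 1 \<Longrightarrow> W k x = 0" for k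
    unfolding W_def[abs_def] by (rule smooth_diff[OF sW]) (simp add: ua)
  define g where "g y t = t powr (c - 1) *\<^sub>R grad \<psi> ((1 / t) *\<^sub>R y)" for y t
  have g_cont: "continuous_on {s..s'} (g y)" if "0 < s" for s s' y
    unfolding g_def by (rule cone_integrand_continuous) (use that \<psi> in \<open>auto intro: smooth_continuous_grad continuous_intros\<close>)
  have gint: "g y integrable_on {s..s'}" if "0 < s" for s s' y
    using g_cont[OF that] by (rule integrable_continuous_real)
  have a_le_u: "a k y \<le> u k" if "norm y < 1" for k y
    unfolding a_sqrt u_sqrt using that by (simp add: power_le_one)
  \<comment> \<open>The common start \<open>\<delta> k\<close> cancels. The moving limit
    \<open>a k y\<close> contributes the endpoint term, which in the limit becomes the field
    \<open>|y|^c \<psi>(sgn y) sgn y\<close>.\<close>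
  have gradW: "grad (W k) y = integral {a k y..u k} (g y)
      - (a k y powr c * \<psi> ((1 / a k y) *\<^sub>R y)) *\<^sub>R ((1 / a k y) *\<^sub>R y)" if y: "norm y < 1" for k y
  proof -
    have "grad (W k) y = grad (\<lambda>y. cone_integral (\<delta> k) c \<psi> (u k) y) y - grad (\<lambda>y. cone_integral (\<delta> k) c \<psi> (a k y) y) y"
      unfolding W_def by (rule grad_diff[OF sW])
    also have "\<dots> = cone_integral (\<delta> k) (c - 1) (grad \<psi>) (u k) y - (cone_integral (\<delta> k) (c - 1) (grad \<psi>) (a k y) y
      + (a k y powr c * \<psi> ((1 / a k y) *\<^sub>R y)) *\<^sub>R grad (a k) y)"
      unfolding grad_eqI[OF has_derivative_cone_integral_const[OF \<delta>0 \<psi>]]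
        grad_eqI[OF has_derivative_cone_integral[OF \<delta>0 \<psi> a_smooth \<delta>a]] ..
    also have "cone_integral (\<delta> k) (c - 1) (grad \<psi>) (u k) y
        = cone_integral (\<delta> k) (c - 1) (grad \<psi>) (a k y) y + integral {a k y..u k} (g y)"
      unfolding cone_integral_def g_def[symmetric]
      using a_le_u[OF y, of k] \<delta>a[of k y] gint[OF \<delta>0]
      by (intro Henstock_Kurzweil_Integration.integral_combine[symmetric]) auto
    finally show ?thesis by (simp add: grad_a)
  qed
  have a_pos: "0 < a k y" for k y using \<delta>0[of k] \<delta>a[of k y] by linarith
  have u_le: "u k \<le> 2" for k
    unfolding u_sqrt using e(2)[of k] by (intro real_le_lsqrt) auto
  have quot: "norm ((1 / t) *\<^sub>R y) \<le> 1" if "norm y \<le> t" "0 < t" for t and y :: "real^'n"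
    using that by (simp add: divide_le_eq)
  \<comment> \<open>A bound independent of \<open>k\<close> and \<open>y\<close>, for dominated
    convergence against \<open>|G|\<close>. It holds because \<open>|y| \<le> a k y\<close> keeps
    \<open>y / t\<close> in the closed unit ball.\<close>
  have gradW_bd: "norm (grad (W k) y) \<le> (2 powr (c - 1) * C) * 2 + 2 powr c * D" if y: "norm y < 1" for k y
  proof -
    have "norm (integral {a k y..u k} (g y)) \<le> (2 powr (c - 1) * C) * (u k - a k y)"
    proof (rule integral_bound[OF a_le_u[OF y] g_cont[OF a_pos]])
      fix t assume t: "t \<in> {a k y..u k}"
      then have "norm y \<le> t" "0 < t" using norm_a[of y k] a_pos[of k y] by auto
      then have "t powr (c - 1) * norm (grad \<psi> ((1 / t) *\<^sub>R y)) \<le> 2 powr (c - 1) * C"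
        using t u_le[of k] c C quot by (intro mult_mono powr_mono2) auto
      then show "norm (g y t) \<le> 2 powr (c - 1) * C" by (simp add: g_def)
    qed
    also have "\<dots> \<le> (2 powr (c - 1) * C) * 2"
      using C(1) u_le[of k] a_pos[of k y] by (intro mult_left_mono) auto
    finally have 1: "norm (integral {a k y..u k} (g y)) \<le> (2 powr (c - 1) * C) * 2" .
    have "norm ((a k y powr c * \<psi> ((1 / a k y) *\<^sub>R y)) *\<^sub>R ((1 / a k y) *\<^sub>R y))
        = (a k y powr c * norm (\<psi> ((1 / a k y) *\<^sub>R y))) * norm ((1 / a k y) *\<^sub>R y)"
      by (simp add: abs_mult)
    also have "\<dots> \<le> (2 powr c * D) * 1"
      using D quot[OF norm_a[of y k] a_pos[of k y]] a_le_u[OF y, of k] u_le[of k] a_pos[of k y] c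
      by (intro mult_mono powr_mono2) auto
    finally show ?thesis using 1 unfolding gradW[OF y]
      using norm_triangle_ineq4[of "integral {a k y..u k} (g y)" "(a k y powr c * \<psi> ((1 / a k y) *\<^sub>R y)) *\<^sub>R ((1 / a k y) *\<^sub>R y)"]
      by linarith
  qed
  have sgn: "sgn y = (1 / norm y) *\<^sub>R y" for y :: "real^'n" by (simp add: sgn_div_norm divide_inverse)
  have lim: "(\<lambda>k. grad (W k) y) \<longlonglongrightarrow> dual_field (c - 1) \<psi> y - (norm y powr c * \<psi> (sgn y)) *\<^sub>R sgn y"
    if y: "norm y < 1" "y \<noteq> 0" for y
  proof -
    define r where "r = norm y"
    have r: "0 < r" "r < 1" using y by (auto simp: r_def)
    have a_lim: "(\<lambda>k. a k y) \<longlonglongrightarrow> r"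
    proof -
      have "(\<lambda>k. sqrt ((norm y)\<^sup>2 + e k)) \<longlonglongrightarrow> sqrt ((norm y)\<^sup>2 + 0)"
        by (intro tendsto_intros e0)
      then show ?thesis by (simp add: a_sqrt r_def)
    qed
    have u_lim: "u \<longlonglongrightarrow> 1"
    proof -
      have "(\<lambda>k. sqrt (1 + e k)) \<longlonglongrightarrow> sqrt (1 + 0)"
        by (intro tendsto_intros e0)
      then show ?thesis by (simp add: u_sqrt[abs_def])
    qed
    \<comment> \<open>Continuity of one indefinite integral, started at \<open>r = |y| > 0\<close>,
      takes care of both moving limits.\<close>
    define \<Phi> where "\<Phi> s = integral {r..s} (g y)" for s
    have \<Phi>_cont: "continuous_on {r..2} \<Phi>"
      unfolding \<Phi>_def by (rule indefinite_integral_continuous_1[OF gint[OF r(1)]])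
    have ar: "a k y \<in> {r..2}" and ur: "u k \<in> {r..2}" for k
      using norm_a[of y k] a_le_u[OF y(1), of k] u_le[of k] by (auto simp: r_def)
    have "(\<lambda>k. \<Phi> (u k) - \<Phi> (a k y)) \<longlonglongrightarrow> \<Phi> 1 - \<Phi> r"
      by (intro tendsto_diff continuous_on_tendsto_compose[OF \<Phi>_cont] u_lim a_lim always_eventually allI ar ur)
        (use r in auto)
    moreover have "\<Phi> (u k) - \<Phi> (a k y) = integral {a k y..u k} (g y)" for k
    proof -
      have "integral {r..a k y} (g y) + integral {a k y..u k} (g y) = integral {r..u k} (g y)"
        by (rule Henstock_Kurzweil_Integration.integral_combine)
          (use ar[of k] a_le_u[OF y(1), of k] gint[OF r(1)] in auto)
      then show ?thesis by (simp add: \<Phi>_def algebra_simps)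
    qed
    moreover have "\<Phi> 1 - \<Phi> r = dual_field (c - 1) \<psi> y"
    proof -
      have "dual_field (c - 1) \<psi> y = (\<integral>t. indicator {0..1} t *\<^sub>R (indicator {t. norm y < t} t *\<^sub>R g y t) \<partial>lborel)"
        unfolding dual_field_def g_def by (simp add: integral_restrict_space)
      also have "\<dots> = (\<integral>t. indicator {r..1} t *\<^sub>R g y t \<partial>lborel)"
      proof (rule integral_cong_AE)
        note [measurable] = smooth_grad_measurable[OF \<psi>]
        show "(\<lambda>t. indicator {0..1} t *\<^sub>R (indicator {t. norm y < t} t *\<^sub>R g y t)) \<in> borel_measurable lborel"
          "(\<lambda>t. indicator {r..1} t *\<^sub>R g y t) \<in> borel_measurable lborel"
          unfolding g_def by measurable
        show "AE t in lborel. indicator {0..1} t *\<^sub>R (indicator {t. norm y < t} t *\<^sub>R g y t) = indicator {r..1} t *\<^sub>R g y t"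
          using AE_lborel_singleton[of r]
          by eventually_elim (use r in \<open>auto simp: r_def indicator_def intro: order_trans[OF norm_ge_zero]\<close>)
      qed
      also have "\<dots> = integral {r..1} (g y)"
        using set_borel_integral_eq_integral(2)[OF borel_integrable_atLeastAtMost'[OF g_cont[OF r(1)]]]
        by (simp add: set_lebesgue_integral_def)
      finally show ?thesis by (simp add: \<Phi>_def)
    qed
    ultimately have 1: "(\<lambda>k. integral {a k y..u k} (g y)) \<longlonglongrightarrow> dual_field (c - 1) \<psi> y" by simp
    have inv: "(\<lambda>k. (1 / a k y) *\<^sub>R y) \<longlonglongrightarrow> sgn y"
      unfolding sgn using a_lim r by (intro tendsto_intros) (auto simp: r_def)
    have "(\<lambda>k. \<psi> ((1 / a k y) *\<^sub>R y)) \<longlonglongrightarrow> \<psi> (sgn y)"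
      by (rule continuous_on_tendsto_compose[OF smooth_continuous[OF \<psi>, of UNIV] inv]) auto
    then have "(\<lambda>k. (a k y powr c * \<psi> ((1 / a k y) *\<^sub>R y)) *\<^sub>R ((1 / a k y) *\<^sub>R y)) \<longlonglongrightarrow> (r powr c * \<psi> (sgn y)) *\<^sub>R sgn y"
      using r by (intro tendsto_scaleR tendsto_mult tendsto_powr a_lim inv tendsto_const) auto
    from tendsto_diff[OF 1 this] show ?thesis unfolding gradW[OF y(1)] r_def .
  qed
  have Gm: "G \<in> borel_measurable ball_measure" by (rule L2_measurable[OF G])
  have Gint: "integrable ball_measure (\<lambda>x. norm (G x))"
  proof -
    have "(\<lambda>_. 1 :: real) \<in> L2 (ball_measure :: (real^'n) measure)"
      by (rule L2_bounded[OF finite_ball_measure, where C=1]) auto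
    from L2_integrable_norm_mult[OF G this] show ?thesis by simp
  qed
  define P where "P y = (norm y powr c * \<psi> (sgn y)) *\<^sub>R sgn y" for y
  have PL: "P \<in> L2 ball_measure"
  proof (rule L2_bounded[OF finite_ball_measure, where C=D])
    note [measurable] = smooth_measurable[OF \<psi>]
    show "P \<in> borel_measurable ball_measure"
      unfolding P_def by (rule measurable_ball_measure) measurable
    fix y :: "real^'n" assume "y \<in> space ball_measure"
    then have "norm y powr c * norm (\<psi> (sgn y)) \<le> 1 * D"
      using c D by (intro mult_mono powr_le1) (auto simp: norm_sgn)
    then have "(norm y powr c * norm (\<psi> (sgn y))) * norm (sgn y) \<le> D * 1"
      using D by (intro mult_mono) (auto simp: norm_sgn)
    then show "norm (P y) \<le> D" by (simp add: P_def abs_mult)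
  qed
  have DL: "dual_field (c - 1) \<psi> \<in> L2 ball_measure" using c by (intro dual_field_L2 \<psi>) simp
  have "(\<lambda>k. \<integral>y. G y \<bullet> grad (W k) y \<partial>ball_measure) \<longlonglongrightarrow> (\<integral>y. G y \<bullet> (dual_field (c - 1) \<psi> y - P y) \<partial>ball_measure)"
  proof (rule integral_dominated_convergence)
    let ?K = "(2 powr (c - 1) * C) * 2 + 2 powr c * D"
    show "integrable ball_measure (\<lambda>y. norm (G y) * ?K)" using Gint by simp
    show "(\<lambda>y. G y \<bullet> (dual_field (c - 1) \<psi> y - P y)) \<in> borel_measurable ball_measure"
      using Gm L2_measurable[OF PL] L2_measurable[OF DL] by measurable
    show "(\<lambda>y. G y \<bullet> grad (W k) y) \<in> borel_measurable ball_measure" for k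
      using Gm measurable_ball_measure[OF smooth_grad_measurable[OF W(1)[of k]]] by measurable
    show "AE y in ball_measure. norm (G y \<bullet> grad (W k) y) \<le> norm (G y) * ?K" for k
    proof (rule AE_I2)
      fix y :: "real^'n" assume "y \<in> space ball_measure"
      then have "norm (G y) * norm (grad (W k) y) \<le> norm (G y) * ?K"
        using gradW_bd[of y k] by (intro mult_left_mono) auto
      then show "norm (G y \<bullet> grad (W k) y) \<le> norm (G y) * ?K"
        unfolding real_norm_def using Cauchy_Schwarz_ineq2 order_trans by blast
    qed
    have nz: "AE y in ball_measure. y \<noteq> (0 :: real^'n)"
      using AE_lborel_singleton[of "0 :: real^'n"]
      by (subst AE_restrict_space_iff) (auto elim: eventually_mono)
    have inb: "AE y in ball_measure. norm (y :: real^'n) < 1" by (rule AE_I2) simp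
    show "AE y in ball_measure. (\<lambda>k. G y \<bullet> grad (W k) y) \<longlonglongrightarrow> G y \<bullet> (dual_field (c - 1) \<psi> y - P y)"
      using nz inb by eventually_elim (unfold P_def, intro tendsto_inner tendsto_const lim)
  qed
  then have "(\<integral>y. G y \<bullet> (dual_field (c - 1) \<psi> y - P y) \<partial>ball_measure) = 0"
    using orth[OF W] by (simp add: LIMSEQ_const_iff)
  then show ?thesis
    using L2_integrable_inner[OF G PL] L2_integrable_inner[OF G DL]
    by (simp add: inner_diff_right P_def)
qed

text \<open>The endpoint field sees \<open>\<psi>\<close> only through its values on the sphere. The
  factors \<open>|y|^c\<close> and \<open>|sgn y|\<close> are at most 1, and by the cone measure the
  squared sphere norm of \<open>\<psi>\<close> is \<open>n\<close> times the squared ball norm of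
  \<open>\<psi> (sgn y)\<close>.\<close>

lemma sphere_average_bound:
  fixes \<psi> :: "real^'n \<Rightarrow> real"
  assumes c: "0 \<le> c" and \<psi>: "smooth \<psi>" and G: "G \<in> L2 ball_measure"
  shows "\<bar>\<integral>y. G y \<bullet> ((norm y powr c * \<psi> (sgn y)) *\<^sub>R sgn y) \<partial>ball_measure\<bar>
    \<le> L2_norm ball_measure G * L2_norm sphere_measure \<psi>"
proof -
  define P where "P y = (norm y powr c * \<psi> (sgn y)) *\<^sub>R sgn y" for y
  obtain D where D: "0 \<le> D" "\<And>x. norm x \<le> 1 \<Longrightarrow> norm (\<psi> x) \<le> D"
    using continuous_bounded_cball[OF smooth_continuous[OF \<psi>]] by blast
  note [measurable] = smooth_measurable[OF \<psi>]
  have \<psi>L: "(\<lambda>y. \<psi> (sgn y)) \<in> L2 ball_measure"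
    using D by (intro L2_bounded[OF finite_ball_measure, where C=D] measurable_ball_measure) (auto simp: norm_sgn)
  have Pb: "norm (P y) \<le> 1 * norm (\<psi> (sgn y))" if "y \<in> space ball_measure" for y
  proof -
    have "norm y powr c * norm (\<psi> (sgn y)) \<le> 1 * norm (\<psi> (sgn y))"
      using that c by (intro mult_mono powr_le1) auto
    then have "(norm y powr c * norm (\<psi> (sgn y))) * norm (sgn y) \<le> (1 * norm (\<psi> (sgn y))) * 1"
      by (rule mult_mono) (simp_all add: norm_sgn)
    moreover have "norm (P y) = (norm y powr c * norm (\<psi> (sgn y))) * norm (sgn y)"
      by (simp add: P_def abs_mult)
    ultimately show ?thesis by linarith
  qed
  have Pm: "P \<in> borel_measurable ball_measure"
    unfolding P_def by (rule measurable_ball_measure) measurable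
  have PL: "P \<in> L2 ball_measure" by (rule L2_dominated[OF \<psi>L Pm Pb])
  have "\<bar>\<integral>y. G y \<bullet> P y \<partial>ball_measure\<bar> \<le> L2_norm ball_measure G * L2_norm ball_measure P"
    by (rule L2_inner_bound[OF G PL])
  also have "L2_norm ball_measure P \<le> 1 * L2_norm ball_measure (\<lambda>y. \<psi> (sgn y))"
    by (rule L2_norm_mono[OF \<psi>L PL Pb]) auto
  also have "L2_norm ball_measure (\<lambda>y. \<psi> (sgn y)) \<le> L2_norm sphere_measure \<psi>"
  proof (rule power2_le_imp_le)
    have "(L2_norm sphere_measure \<psi>)\<^sup>2 = real CARD('n) * (L2_norm ball_measure (\<lambda>y. \<psi> (sgn y)))\<^sup>2"
      unfolding L2_norm_power2 by (rule integral_sphere_measure) measurable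
    moreover have "1 \<le> real CARD('n)" by (simp add: Suc_leI)
    ultimately show "(L2_norm ball_measure (\<lambda>y. \<psi> (sgn y)))\<^sup>2 \<le> (L2_norm sphere_measure \<psi>)\<^sup>2"
      using mult_right_mono[of 1 "real CARD('n)" "(L2_norm ball_measure (\<lambda>y. \<psi> (sgn y)))\<^sup>2"] by simp
  qed simp
  finally show ?thesis unfolding P_def by (simp add: mult_left_mono)
qed

text \<open>\<open>h\<close> is the limit of the averages of smooth approximants of
  \<open>H\<close>, and the Euler identity passes to the limit. Tested with
  \<open>grad \<psi>\<close>, the gradient \<open>K\<close> becomes \<open>G\<close> tested with the
  dual field; harmonicity of \<open>H\<close> reduces this to the endpoint term, which is bounded by
  the boundary norm of \<open>\<psi>\<close>.\<close>

theorem harmonic_Robin_solution: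
  fixes H :: "real^'n \<Rightarrow> real"
  assumes b: "real CARD('n) \<le> b" and H: "sobolev_triple H G f"
    and harm: "\<And>v V. sobolev_triple v V (\<lambda>_. 0) \<Longrightarrow> (\<integral>x. G x \<bullet> V x \<partial>ball_measure) = 0"
  obtains h K a where "sobolev_triple h K a"
    "AE x in ball_measure. x \<bullet> K x + (b + 1) * h x = H x"
    "\<And>v V. sobolev_triple v V (\<lambda>_. 0) \<Longrightarrow> (\<integral>x. K x \<bullet> V x \<partial>ball_measure) = 0"
proof -
  have b0: "0 < b" using b by (smt (verit) of_nat_0_less_iff zero_less_card_finite)
  \<comment> \<open>Chosen so that \<open>c - 1\<close> is the exponent of the dual field.\<close>
  define c where "c = b + 2 - real CARD('n)"
  have c: "1 \<le> c" "c - 1 = b + 1 - real CARD('n)" using b by (auto simp: c_def)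
  obtain \<phi> where \<phi>: "\<And>k. smooth (\<phi> k)" "L2_tendsto ball_measure \<phi> H"
    "L2_tendsto ball_measure (\<lambda>k. grad (\<phi> k)) G"
    using sobolev_tripleE[OF H] by blast
  let ?T = "\<lambda>k. radial_avg b (\<phi> k)"
  have s: "smooth (?T k)" for k by (rule smooth_radial_avg[OF b0 \<phi>(1)])
  obtain h K a where hK: "L2_tendsto ball_measure ?T h"
    "L2_tendsto ball_measure (\<lambda>k. grad (?T k)) K" "L2_tendsto sphere_measure ?T a"
    using radial_avg_sobolev[OF b \<phi>] by blast
  have triple: "sobolev_triple h K a"
    unfolding sobolev_triple_def by (intro exI[of _ ?T] conjI allI s hK)
  have "L2_tendsto ball_measure (\<lambda>k x. x \<bullet> grad (?T k) x + (b + 1) *\<^sub>R ?T k x) (\<lambda>x. x \<bullet> K x + (b + 1) *\<^sub>R h x)"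
    by (intro L2_tendsto_add L2_tendsto_ball_inner[OF hK(2)] L2_tendsto_scaleR hK(1) continuous_on_id)
  then have "L2_tendsto ball_measure \<phi> (\<lambda>x. x \<bullet> K x + (b + 1) * h x)"
    using radial_avg_Euler[OF b0 \<phi>(1)] by simp
  from L2_tendsto_unique[OF this \<phi>(2)]
  have ae: "AE x in ball_measure. x \<bullet> K x + (b + 1) * h x = H x" .
  have GL: "G \<in> L2 ball_measure" by (rule L2_tendsto_L2(2)[OF \<phi>(3)])
  have orth: "(\<integral>x. G x \<bullet> grad W x \<partial>ball_measure) = 0"
    if "smooth W" "\<And>x. norm x = 1 \<Longrightarrow> W x = 0" for W
    by (rule harm[OF sobolev_triple_cong_sphere[OF sobolev_triple_smooth[OF that(1)]]]) (use that in auto)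
  have key: "\<bar>\<integral>x. K x \<bullet> grad \<psi> x \<partial>ball_measure\<bar> \<le> L2_norm ball_measure G * L2_norm sphere_measure \<psi>"
    if \<psi>: "smooth \<psi>" for \<psi>
  proof -
    have "(\<lambda>k. \<integral>x. grad (?T k) x \<bullet> grad \<psi> x \<partial>ball_measure) \<longlonglongrightarrow> (\<integral>x. K x \<bullet> grad \<psi> x \<partial>ball_measure)"
      by (intro L2_tendsto_inner hK(2) L2_tendsto_const smooth_grad_L2_ball \<psi>)
    moreover have "(\<lambda>k. \<integral>x. grad (\<phi> k) x \<bullet> dual_field (c - 1) \<psi> x \<partial>ball_measure)
        \<longlonglongrightarrow> (\<integral>x. G x \<bullet> dual_field (c - 1) \<psi> x \<partial>ball_measure)"
      using c by (intro L2_tendsto_inner \<phi>(3) L2_tendsto_const dual_field_L2 \<psi>) simp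
    ultimately have "(\<integral>x. K x \<bullet> grad \<psi> x \<partial>ball_measure) = (\<integral>x. G x \<bullet> dual_field (c - 1) \<psi> x \<partial>ball_measure)"
      unfolding radial_avg_dual[OF b \<phi>(1) \<psi>] c(2) by (rule LIMSEQ_unique)
    also have "\<dots> = (\<integral>y. G y \<bullet> ((norm y powr c * \<psi> (sgn y)) *\<^sub>R sgn y) \<partial>ball_measure)"
      by (rule dual_field_orthogonal[OF c(1) \<psi> GL orth])
    finally show ?thesis using sphere_average_bound[OF _ \<psi> GL, of c] c by simp
  qed
  \<comment> \<open>The approximants \<open>\<psi> k\<close> need not vanish on the sphere, but
    their boundary norms tend to 0, which is all that the estimate \<open>key\<close> asks
    for.\<close>
  have "(\<integral>x. K x \<bullet> V x \<partial>ball_measure) = 0" if V: "sobolev_triple v V (\<lambda>_. 0)" for v V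
  proof -
    obtain \<psi> where \<psi>: "\<And>k. smooth (\<psi> k)" "L2_tendsto ball_measure (\<lambda>k. grad (\<psi> k)) V"
      "L2_tendsto sphere_measure \<psi> (\<lambda>_. 0)"
      using sobolev_tripleE[OF V] by blast
    have 1: "(\<lambda>k. \<integral>x. K x \<bullet> grad (\<psi> k) x \<partial>ball_measure) \<longlonglongrightarrow> (\<integral>x. K x \<bullet> V x \<partial>ball_measure)"
      by (intro L2_tendsto_inner L2_tendsto_const L2_tendsto_L2(2)[OF hK(2)] \<psi>(2))
    have 2: "(\<lambda>k. L2_norm ball_measure G * L2_norm sphere_measure (\<psi> k)) \<longlonglongrightarrow> 0"
      using \<psi>(3) tendsto_mult_right_zero by (auto simp: L2_tendsto_def)
    have "(\<lambda>k. \<integral>x. K x \<bullet> grad (\<psi> k) x \<partial>ball_measure) \<longlonglongrightarrow> 0"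
      by (rule Lim_null_comparison[OF always_eventually 2]) (use key[OF \<psi>(1)] in simp)
    with 1 show ?thesis by (rule LIMSEQ_unique)
  qed
  with triple ae show thesis by (rule that)
qed

section \<open>From a pair of harmonic functions to Schroedinger solutions and their boundary
  forms\<close>

section \<open>The Dirichlet-to-Neumann map of a Darboux-transformed potential\<close>

lemma L2_ball_scaleR:
  fixes f :: "real^'n \<Rightarrow> 'b::euclidean_space"
  shows "f \<in> L2 ball_measure \<Longrightarrow> continuous_on UNIV c \<Longrightarrow> (\<lambda>x. c x *\<^sub>R f x) \<in> L2 ball_measure"
  using L2_tendsto_L2(2)[OF L2_tendsto_ball_scaleR[OF L2_tendsto_const]] by blast

lemma L2_ball_inner:
  fixes f :: "real^'n \<Rightarrow> 'b::euclidean_space"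
  shows "f \<in> L2 ball_measure \<Longrightarrow> continuous_on UNIV Y \<Longrightarrow> (\<lambda>x. Y x \<bullet> f x) \<in> L2 ball_measure"
  using L2_tendsto_L2(2)[OF L2_tendsto_ball_inner[OF L2_tendsto_const]] by blast

lemma schrodinger_form_cong:
  assumes "\<And>x. norm x < 1 \<Longrightarrow> q x = Q x"
  shows "schrodinger_form q = schrodinger_form Q"
  unfolding schrodinger_form_def
  by (intro ext Bochner_Integration.integral_cong) (use assms in auto)

text \<open>Forms and weak solutions integrate over the open ball only. This allows a potential with
  a pole outside the closed ball to be exchanged for a globally smooth one.\<close>

lemma DN_cong:
  assumes "\<And>x. norm x < 1 \<Longrightarrow> q x = Q x"
  shows "DN q = DN Q"
proof -
  have "dirichlet_solution q = dirichlet_solution Q"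
    by (intro ext) (simp add: dirichlet_solution_def schrodinger_form_cong[OF assms])
  then show ?thesis
    by (intro ext) (simp add: DN_def normal_derivative_def schrodinger_form_cong[OF assms])
qed

lemma schrodinger_form_integrable:
  assumes Q: "smooth Q" and u: "sobolev_triple u G f" and v: "sobolev_triple v K g"
  shows "integrable ball_measure (\<lambda>x. G x \<bullet> K x)" "integrable ball_measure (\<lambda>x. Q x * u x * v x)"
    "integrable ball_measure (\<lambda>x. G x \<bullet> K x + Q x * u x * v x)"
proof -
  show 1: "integrable ball_measure (\<lambda>x. G x \<bullet> K x)"
    by (intro L2_integrable_inner sobolev_triple_L2[OF u] sobolev_triple_L2[OF v])
  show 2: "integrable ball_measure (\<lambda>x. Q x * u x * v x)"
    using L2_integrable_mult[OF L2_ball_scaleR[OF sobolev_triple_L2(1)[OF u] smooth_continuous[OF Q]]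
        sobolev_triple_L2(1)[OF v]] by simp
  show "integrable ball_measure (\<lambda>x. G x \<bullet> K x + Q x * u x * v x)" using 1 2 by simp
qed

lemma schrodinger_form_smooth_eq:
  assumes "smooth Q" "sobolev_triple u G f" "sobolev_triple v K g"
  shows "schrodinger_form Q u v = (\<integral>x. G x \<bullet> K x + Q x * u x * v x \<partial>ball_measure)"
  by (rule schrodinger_form_eq[OF assms(2,3)]) (intro measurable_ball_measure smooth_measurable assms(1))

text \<open>The difference \<open>w\<close> has trace zero and may be used as its own test function:
  the integral of \<open>|W|^2 + Q w^2\<close> vanishes. As both terms are nonnegative,
  \<open>W\<close> and \<open>Q w\<close> are zero almost everywhere, and with them the form against
  any \<open>v\<close>.\<close>

lemma dirichlet_solution_form_unique:
  fixes Q :: "real^'n \<Rightarrow> real"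
  assumes Q: "smooth Q" "\<And>x. norm x < 1 \<Longrightarrow> 0 \<le> Q x"
    and u: "dirichlet_solution Q f u" and u': "dirichlet_solution Q f u'" and v: "has_trace v g"
  shows "schrodinger_form Q u v = schrodinger_form Q u' v"
proof -
  let ?D = "weak_grad (ball 0 1)"
  have tu: "sobolev_triple u (?D u) f" and tu': "sobolev_triple u' (?D u') f" and tv: "sobolev_triple v (?D v) g"
    using u u' v by (auto simp: dirichlet_solution_def has_trace_iff)
  define w W where "w x = u x - u' x" and "W x = ?D u x - ?D u' x" for x
  have tw: "sobolev_triple w W (\<lambda>_. 0)"
    using sobolev_triple_diff[OF tu tu'] by (simp add: w_def[abs_def] W_def[abs_def])
  have diff: "(\<integral>x. W x \<bullet> K x + Q x * w x * z x \<partial>ball_measure) = schrodinger_form Q u z - schrodinger_form Q u' z"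
    if z: "sobolev_triple z K h" for z K h
  proof -
    have "(\<integral>x. W x \<bullet> K x + Q x * w x * z x \<partial>ball_measure)
      = (\<integral>x. (?D u x \<bullet> K x + Q x * u x * z x) - (?D u' x \<bullet> K x + Q x * u' x * z x) \<partial>ball_measure)"
      by (rule Bochner_Integration.integral_cong) (auto simp: W_def w_def inner_diff_left algebra_simps)
    then show ?thesis
      using schrodinger_form_integrable(3)[OF Q(1) tu z] schrodinger_form_integrable(3)[OF Q(1) tu' z]
      by (simp add: schrodinger_form_smooth_eq[OF Q(1) tu z] schrodinger_form_smooth_eq[OF Q(1) tu' z])
  qed
  have "schrodinger_form Q u w = 0" "schrodinger_form Q u' w = 0"
    using u u' sobolev_triple_has_trace[OF tw] by (auto simp: dirichlet_solution_def)
  then have "(\<integral>x. W x \<bullet> W x + Q x * w x * w x \<partial>ball_measure) = 0" using diff[OF tw] by simp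
  then have "AE x in ball_measure. W x \<bullet> W x + Q x * w x * w x = 0"
    using Q(2) by (subst (asm) integral_nonneg_eq_0_iff_AE[OF schrodinger_form_integrable(3)[OF Q(1) tw tw]])
      (auto intro!: AE_I2 add_nonneg_nonneg simp: mult.assoc)
  moreover have "AE x in ball_measure. norm (x :: real^'n) < 1" by (rule AE_I2) simp
  ultimately have "AE x in ball_measure. W x \<bullet> ?D v x + Q x * w x * v x = 0"
  proof eventually_elim
    case (elim x)
    have "0 \<le> Q x * (w x * w x)" using Q(2)[OF elim(2)] by simp
    then have "W x \<bullet> W x = 0" "Q x * (w x * w x) = 0"
      using elim(1) inner_ge_zero[of "W x"] unfolding mult.assoc by linarith+
    then show ?case by auto
  qed
  then have "(\<integral>x. W x \<bullet> ?D v x + Q x * w x * v x \<partial>ball_measure) = 0"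
    by (rule integral_eq_zero_AE)
  then show ?thesis using diff[OF tv] by simp
qed

text \<open>Frees the map from the choice of the solution. The chosen extension of \<open>g\<close>
  remains, but it depends on \<open>g\<close> alone and is shared by all potentials.\<close>

lemma DN_eq_form:
  fixes Q :: "real^'n \<Rightarrow> real"
  assumes "smooth Q" "\<And>x. norm x < 1 \<Longrightarrow> 0 \<le> Q x" "dirichlet_solution Q f u" "g \<in> H_half"
  shows "DN Q f g = schrodinger_form Q u (SOME v. has_trace v g)"
proof -
  have "has_trace (SOME v. has_trace v g) g"
    using assms(4) someI_ex[of "\<lambda>v. has_trace v g"] by (simp add: H_half_def)
  moreover have "dirichlet_solution Q f (SOME u. dirichlet_solution Q f u)"
    using assms(3) by (rule someI[of "dirichlet_solution Q f"])
  ultimately show ?thesis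
    unfolding DN_def normal_derivative_def
    by (intro dirichlet_solution_form_unique[OF assms(1,2) _ assms(3)])
qed

text \<open>The Darboux transformation: \<open>H + W h = x \<bullet> \<nabla>h + (b + 1 + W) h\<close> solves the
  Schroedinger equation with potential \<open>Q\<close> for every harmonic \<open>h\<close>.\<close>
lemma darboux_solution_form:
  fixes Q W :: "real^'n \<Rightarrow> real"
  assumes Q: "smooth Q" and W: "smooth W"
    and gradW: "\<And>x. norm x < 1 \<Longrightarrow> grad W x = (Q x / 2) *\<^sub>R x"
    and eqn: "\<And>x. norm x < 1 \<Longrightarrow> real CARD('n) * Q x + x \<bullet> grad Q x = 2 * Q x * (W x + b + 1)"
    and bdry: "\<And>x. norm x = 1 \<Longrightarrow> W x = 0" "\<And>x. norm x = 1 \<Longrightarrow> Q x = 2 * c"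
    and H: "sobolev_triple H G f" and h: "sobolev_triple h K a"
    and rel: "AE x in ball_measure. x \<bullet> K x + (b + 1) * h x = H x"
    and harm: "\<And>v V. sobolev_triple v V (\<lambda>_. 0) \<Longrightarrow> (\<integral>x. K x \<bullet> V x \<partial>ball_measure) = 0"
  shows "sobolev_triple (\<lambda>x. H x + W x * h x) (\<lambda>x. G x + (W x *\<^sub>R K x + h x *\<^sub>R grad W x)) f"
    and "sobolev_triple v V g \<Longrightarrow> schrodinger_form Q (\<lambda>x. H x + W x * h x) v
      = (\<integral>x. G x \<bullet> V x \<partial>ball_measure) + c * (\<integral>x. a x * g x \<partial>sphere_measure)"
proof -
  have fm: "f \<in> borel_measurable sphere_measure" by (rule L2_measurable[OF sobolev_triple_L2(3)[OF H]])
  show U: "sobolev_triple (\<lambda>x. H x + W x * h x) (\<lambda>x. G x + (W x *\<^sub>R K x + h x *\<^sub>R grad W x)) f"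
    by (rule sobolev_triple_cong_sphere[OF sobolev_triple_add[OF H sobolev_triple_mult_smooth[OF W h]] _ fm])
      (simp add: bdry)
  assume v: "sobolev_triple v V g"
  \<comment> \<open>As \<open>W\<close> vanishes on the sphere, \<open>W v\<close> is an admissible
    test function for the harmonic \<open>h\<close>, whatever the trace of \<open>v\<close>.\<close>
  have "sobolev_triple (\<lambda>x. W x * v x) (\<lambda>x. W x *\<^sub>R V x + v x *\<^sub>R grad W x) (\<lambda>_. 0)"
    by (rule sobolev_triple_cong_sphere[OF sobolev_triple_mult_smooth[OF W v]]) (auto simp: bdry)
  note Wv = this
  note 0 = harm[OF Wv]
  define R where "R x = (real CARD('n) * Q x + x \<bullet> grad Q x) * h x * v x + Q x * (x \<bullet> K x) * v x
      + Q x * h x * (x \<bullet> V x)" for x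
  have R: "(\<integral>x. R x \<partial>ball_measure) = 2 * c * (\<integral>x. a x * g x \<partial>sphere_measure)"
  proof -
    have "(\<integral>x. R x \<partial>ball_measure) = (\<integral>x. Q x * a x * g x \<partial>sphere_measure)"
      unfolding R_def by (rule integral_radial_divergence_sobolev[OF Q h v])
    also have "\<dots> = (\<integral>x. 2 * c * (a x * g x) \<partial>sphere_measure)"
      by (rule Bochner_Integration.integral_cong) (auto simp: bdry)
    finally show ?thesis by simp
  qed
  note L = sobolev_triple_L2[OF h] sobolev_triple_L2[OF v] sobolev_triple_L2[OF H]
  have Rint: "integrable ball_measure R"
  proof -
    have cc: "continuous_on UNIV (\<lambda>x. real CARD('n) * Q x + x \<bullet> grad Q x)"
      by (intro continuous_intros smooth_continuous smooth_continuous_grad Q)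
    note Qc = smooth_continuous[OF Q, of UNIV]
    note i1 = L2_integrable_mult[OF L2_ball_scaleR[OF L(1) cc] L(4)]
    note i2 = L2_integrable_mult[OF L2_ball_scaleR[OF L2_ball_inner[OF L(2) continuous_on_id] Qc] L(4)]
    note i3 = L2_integrable_mult[OF L2_ball_scaleR[OF L(1) Qc] L2_ball_inner[OF L(5) continuous_on_id]]
    show ?thesis
      using Bochner_Integration.integrable_add[OF Bochner_Integration.integrable_add[OF i1 i2] i3]
      by (simp add: R_def[abs_def])
  qed
  have GV: "integrable ball_measure (\<lambda>x. G x \<bullet> V x)" by (rule L2_integrable_inner[OF L(8,5)])
  have KV: "integrable ball_measure (\<lambda>x. K x \<bullet> (W x *\<^sub>R V x + v x *\<^sub>R grad W x))"
    by (rule L2_integrable_inner[OF L(2) sobolev_triple_L2(2)[OF Wv]])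
  have "schrodinger_form Q (\<lambda>x. H x + W x * h x) v = (\<integral>x. (G x + (W x *\<^sub>R K x + h x *\<^sub>R grad W x)) \<bullet> V x
      + Q x * (H x + W x * h x) * v x \<partial>ball_measure)"
    by (rule schrodinger_form_smooth_eq[OF Q U v])
  \<comment> \<open>After inserting the equations for \<open>grad W\<close>, \<open>Q\<close> and
    \<open>H\<close>, the terms regroup into the unperturbed form, the harmonicity of
    \<open>h\<close> tested with \<open>W v\<close>, and half the divergence of the field
    \<open>Q h v x\<close>.\<close>
  also have "\<dots> = (\<integral>x. G x \<bullet> V x + K x \<bullet> (W x *\<^sub>R V x + v x *\<^sub>R grad W x) + (1/2) * R x \<partial>ball_measure)"
  proof (rule integral_cong_AE)
    show "(\<lambda>x. (G x + (W x *\<^sub>R K x + h x *\<^sub>R grad W x)) \<bullet> V x + Q x * (H x + W x * h x) * v x)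
        \<in> borel_measurable ball_measure"
      by (rule borel_measurable_integrable[OF schrodinger_form_integrable(3)[OF Q U v]])
    show "(\<lambda>x. G x \<bullet> V x + K x \<bullet> (W x *\<^sub>R V x + v x *\<^sub>R grad W x) + (1/2) * R x) \<in> borel_measurable ball_measure"
      using GV KV Rint by (intro borel_measurable_integrable) simp
    have inb: "AE x in ball_measure. norm (x :: real^'n) < 1" by (rule AE_I2) simp
    show "AE x in ball_measure. (G x + (W x *\<^sub>R K x + h x *\<^sub>R grad W x)) \<bullet> V x + Q x * (H x + W x * h x) * v x
        = G x \<bullet> V x + K x \<bullet> (W x *\<^sub>R V x + v x *\<^sub>R grad W x) + (1/2) * R x"
      using rel inb
    proof eventually_elim
      case (elim x)
      show ?case
        unfolding R_def eqn[OF elim(2)] gradW[OF elim(2)] elim(1)[symmetric]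
        by (simp add: inner_add_left inner_add_right inner_commute[of "K x" x] algebra_simps)
    qed
  qed
  also have "\<dots> = (\<integral>x. G x \<bullet> V x \<partial>ball_measure) + c * (\<integral>x. a x * g x \<partial>sphere_measure)"
    using GV KV Rint R 0 by simp
  finally show "schrodinger_form Q (\<lambda>x. H x + W x * h x) v
      = (\<integral>x. G x \<bullet> V x \<partial>ball_measure) + c * (\<integral>x. a x * g x \<partial>sphere_measure)" .
qed

text \<open>For \<open>k > 0\<close> the polynomial has a zero outside the ball, while
  \<open>smooth\<close> is a condition on the whole space. The subtracted term is switched off by a
  flat function that is 0 on the closed ball and makes the term nonpositive as soon as
  \<open>A |x|^(2k)\<close> reaches 1.\<close>

lemma positive_smooth_extension:
  assumes A: "0 < A" "A < 1"
  obtains D :: "real^'n \<Rightarrow> real" where "smooth D" "\<And>x. 0 < D x"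
    "\<And>x. norm x \<le> 1 \<Longrightarrow> D x = 1 - A * ((norm x)\<^sup>2) ^ k"
proof -
  define \<eta> where "\<eta> = 1 / A - 1"
  have \<eta>: "0 < \<eta>" using A by (simp add: \<eta>_def)
  define s where "s x = ((norm x)\<^sup>2) ^ k" for x :: "real^'n"
  have s: "smooth s" "0 \<le> s x" for x unfolding s_def by auto
  \<comment> \<open>\<open>\<eta>\<close> is the value of \<open>s - 1\<close> at which
    \<open>A s = 1\<close>; the factor \<open>exp (1 / \<eta>)\<close> makes the switch at least 1
    from there on.\<close>
  define D where "D x = 1 - A * s x * (1 - exp (1 / \<eta>) * flat 0 (s x - 1))" for x
  have "smooth D"
    unfolding D_def by (intro smooth_diff smooth_mult smooth_const smooth_flat s(1))
  moreover have "0 < D x" for x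
  proof (cases "A * s x < 1")
    case True
    have "A * s x * (1 - exp (1 / \<eta>) * flat 0 (s x - 1)) \<le> A * s x * 1"
      using A s(2)[of x] flat_0_bounds(1) by (intro mult_left_mono) auto
    with True show ?thesis by (simp add: D_def)
  next
    case False
    then have "\<eta> \<le> s x - 1" using A by (simp add: \<eta>_def field_simps)
    then have "exp (- (1 / \<eta>)) \<le> flat 0 (s x - 1)"
      using \<eta> by (auto simp: flat_0 intro!: divide_left_mono)
    then have "exp (1 / \<eta>) * exp (- (1 / \<eta>)) \<le> exp (1 / \<eta>) * flat 0 (s x - 1)"
      by (intro mult_left_mono) auto
    then have "1 - exp (1 / \<eta>) * flat 0 (s x - 1) \<le> 0" by (simp add: exp_minus)
    then have "A * s x * (1 - exp (1 / \<eta>) * flat 0 (s x - 1)) \<le> 0"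
      using A s(2)[of x] by (intro mult_nonneg_nonpos) auto
    then show ?thesis by (simp add: D_def)
  qed
  moreover have "D x = 1 - A * ((norm x)\<^sup>2) ^ k" if "norm x \<le> 1" for x
  proof -
    have "s x \<le> 1" unfolding s_def using that by (intro power_le_one) auto
    then show ?thesis by (simp add: D_def flat_0 s_def)
  qed
  ultimately show thesis by (rule that)
qed

lemma grad_radial:
  fixes F :: "real^'n \<Rightarrow> real"
  assumes "\<And>x. norm x < 1 \<Longrightarrow> F x = p ((norm x)\<^sup>2)" "(p has_real_derivative d) (at ((norm x)\<^sup>2))" "norm x < 1"
  shows "grad F x = (2 * d) *\<^sub>R x"
proof -
  have "((\<lambda>x. p ((norm x)\<^sup>2)) has_derivative (\<lambda>z. z \<bullet> (d *\<^sub>R grad (\<lambda>x. (norm x)\<^sup>2) x))) (at x)"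
    by (rule grad_compose_real[OF smooth_norm_power2 assms(2)])
  then have "(F has_derivative (\<lambda>z. z \<bullet> (d *\<^sub>R grad (\<lambda>x. (norm x)\<^sup>2) x))) (at x)"
    by (rule has_derivative_transform_within_open[of _ _ _ _ "ball 0 1"]) (use assms in auto)
  from grad_eqI[OF this] show ?thesis by (simp add: grad_norm_power2 mult.commute)
qed

text \<open>Radial functions are handled in the variable \<open>s = |x|^2\<close>. \<open>W\<close>
  is the Darboux factor minus its boundary value 8, hence zero on the sphere, and
  \<open>W + 15/2 + 1\<close> is that factor plus 1/2. One differential identity makes the potential
  a derivative of the factor, the other prescribes the logarithmic derivative of the
  potential.\<close>

lemma darboux_potential:
  fixes A :: real
  assumes A: "0 < A" "A < 1" and bdry: "real (Suc m) * (1 + A) = 8 * (1 - A)"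
  obtains Q W :: "real^3 \<Rightarrow> real" where "smooth Q" "smooth W"
    "\<And>x. norm x \<le> 1 \<Longrightarrow> Q x = 8 * (real (Suc m))\<^sup>2 * A * ((norm x)\<^sup>2) ^ m / (1 - A * ((norm x)\<^sup>2) ^ Suc m)\<^sup>2"
    "\<And>x. norm x < 1 \<Longrightarrow> 0 \<le> Q x"
    "\<And>x. norm x < 1 \<Longrightarrow> grad W x = (Q x / 2) *\<^sub>R x"
    "\<And>x. norm x < 1 \<Longrightarrow> real CARD(3) * Q x + x \<bullet> grad Q x = 2 * Q x * (W x + 15/2 + 1)"
    "\<And>x. norm x = 1 \<Longrightarrow> W x = 0"
    "\<And>x. norm x = 1 \<Longrightarrow> Q x = 2 * (4 * (real (Suc m))\<^sup>2 * A / (1 - A)\<^sup>2)"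
proof -
  let ?k = "real (Suc m)"
  obtain D :: "real^3 \<Rightarrow> real" where D: "smooth D" "\<And>x. 0 < D x"
    "\<And>x. norm x \<le> 1 \<Longrightarrow> D x = 1 - A * ((norm x)\<^sup>2) ^ Suc m"
    using positive_smooth_extension[OF A] by blast
  define Q where "Q x = 8 * ?k\<^sup>2 * A * ((norm x)\<^sup>2) ^ m / (D x)\<^sup>2" for x
  define W where "W x = ?k * (1 + A * ((norm x)\<^sup>2) ^ Suc m) / D x - 8" for x
  have D0: "D x \<noteq> 0" for x using D(2)[of x] by simp
  have sQ: "smooth Q" unfolding Q_def
    by (intro smooth_divide smooth_mult smooth_const smooth_power smooth_norm_power2 D(1)) (simp add: D0)
  have sW: "smooth W" unfolding W_def
    by (intro smooth_diff smooth_divide smooth_mult smooth_add smooth_const smooth_power smooth_norm_power2 D(1) D0)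
  define p where "p s = 8 * ?k\<^sup>2 * A * s ^ m / (1 - A * s ^ Suc m)\<^sup>2" for s
  define w where "w s = ?k * (1 + A * s ^ Suc m) / (1 - A * s ^ Suc m) - 8" for s
  have Qp: "Q x = p ((norm x)\<^sup>2)" and Ww: "W x = w ((norm x)\<^sup>2)" if "norm x \<le> 1" for x
    using D(3)[OF that] by (simp_all add: Q_def W_def p_def w_def)
  have dw: "(w has_real_derivative p s / 4) (at s)" if ne: "1 - A * s ^ Suc m \<noteq> 0" for s
  proof -
    have pw: "((\<lambda>s. s ^ Suc m) has_real_derivative ?k * s ^ m) (at s)"
      by (rule DERIV_cong[OF DERIV_pow]) simp
    have d1: "((\<lambda>s. 1 + A * s ^ Suc m) has_real_derivative A * (?k * s ^ m)) (at s)"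
      by (rule DERIV_cong[OF DERIV_add[OF DERIV_const DERIV_cmult[OF pw]]]) simp
    have d2: "((\<lambda>s. 1 - A * s ^ Suc m) has_real_derivative - (A * (?k * s ^ m))) (at s)"
      by (rule DERIV_cong[OF DERIV_diff[OF DERIV_const DERIV_cmult[OF pw]]]) simp
    have "(w has_real_derivative ((?k * (A * (?k * s ^ m))) * (1 - A * s ^ Suc m)
        - ?k * (1 + A * s ^ Suc m) * (- (A * (?k * s ^ m)))) / ((1 - A * s ^ Suc m) * (1 - A * s ^ Suc m)) - 0) (at s)"
      unfolding w_def
      by (intro DERIV_diff[OF DERIV_divide[OF DERIV_cmult[OF d1] d2 ne] DERIV_const])
    moreover have "((?k * (A * (?k * s ^ m))) * (1 - A * s ^ Suc m)
        - ?k * (1 + A * s ^ Suc m) * (- (A * (?k * s ^ m)))) / ((1 - A * s ^ Suc m) * (1 - A * s ^ Suc m)) - 0 = p s / 4"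
    proof -
      have "(?k * (A * (?k * s ^ m))) * (1 - z) - ?k * (1 + z) * (- (A * (?k * s ^ m))) = 2 * (?k\<^sup>2 * A * s ^ m)" for z
        by (simp add: power2_eq_square algebra_simps)
      then show ?thesis unfolding p_def by (simp add: power2_eq_square)
    qed
    ultimately show ?thesis by (rule DERIV_cong)
  qed
  have dp: "\<exists>d. (p has_real_derivative d) (at s) \<and> 3 * p s + 2 * (s * d) = 2 * p s * (w s + 15/2 + 1)"
    if ne: "1 - A * s ^ Suc m \<noteq> 0" for s
  proof (intro exI conjI)
    let ?E = "1 - A * s ^ Suc m"
    let ?d = "8 * ?k\<^sup>2 * A * ((real m * s ^ (m - 1)) * ?E\<^sup>2 - s ^ m * (2 * ?E * (- (A * (?k * s ^ m))))) / (?E\<^sup>2 * ?E\<^sup>2)"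
    have pw: "((\<lambda>s. s ^ Suc m) has_real_derivative ?k * s ^ m) (at s)"
      by (rule DERIV_cong[OF DERIV_pow]) simp
    have pm: "((\<lambda>s. s ^ m) has_real_derivative real m * s ^ (m - 1)) (at s)"
      by (rule DERIV_cong[OF DERIV_pow]) simp
    have dE: "((\<lambda>s. 1 - A * s ^ Suc m) has_real_derivative - (A * (?k * s ^ m))) (at s)"
      by (rule DERIV_cong[OF DERIV_diff[OF DERIV_const DERIV_cmult[OF pw]]]) simp
    have dE2: "((\<lambda>s. (1 - A * s ^ Suc m)\<^sup>2) has_real_derivative 2 * ?E * (- (A * (?k * s ^ m)))) (at s)"
      by (rule DERIV_cong[OF DERIV_power[OF dE]]) simp
    have "((\<lambda>s. (8 * ?k\<^sup>2 * A) * (s ^ m / (1 - A * s ^ Suc m)\<^sup>2)) has_real_derivative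
       (8 * ?k\<^sup>2 * A) * (((real m * s ^ (m - 1)) * ?E\<^sup>2 - s ^ m * (2 * ?E * (- (A * (?k * s ^ m))))) / (?E\<^sup>2 * ?E\<^sup>2))) (at s)"
      by (intro DERIV_cmult DERIV_divide pm dE2) (use ne in simp)
    then show "(p has_real_derivative ?d) (at s)"
      by (simp add: p_def[abs_def])
    \<comment> \<open>Valid also for \<open>m = 0\<close>, where \<open>m - 1\<close> is truncated
      subtraction.\<close>
    have sm: "s * (real m * s ^ (m - 1)) = real m * s ^ m" by (cases m) auto
    have "s * ?d = 8 * ?k\<^sup>2 * A * ((s * (real m * s ^ (m - 1))) * ?E\<^sup>2 + s ^ m * (2 * ?E * (A * (?k * s ^ Suc m)))) / (?E\<^sup>2 * ?E\<^sup>2)"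
      by (simp add: algebra_simps)
    also have "\<dots> = p s * (real m + 2 * ?k * (A * s ^ Suc m) / ?E)"
    proof -
      have "C * (M * z * E\<^sup>2 + z * (2 * E * (A * (k * S)))) / (E\<^sup>2 * E\<^sup>2) = C * z / E\<^sup>2 * (M + 2 * k * (A * S) / E)"
        if "E \<noteq> 0" for C M z E k S :: real
        using that by (simp add: field_simps power2_eq_square)
      from this[OF ne] show ?thesis unfolding sm p_def .
    qed
    finally have sd: "s * ?d = p s * (real m + 2 * ?k * (A * s ^ Suc m) / ?E)" .
    \<comment> \<open>Here dimension 3 and the shift by 1/2 fit together: with
      \<open>z = A s^(m+1)\<close> both sides equal
      \<open>1 + 2 ?k (1 + z) / (1 - z)\<close>.\<close>
    have "3 + 2 * (real m + 2 * ?k * (A * s ^ Suc m) / ?E) = 2 * (w s + 15/2 + 1)"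
    proof -
      have *: "3 + 2 * (real m + 2 * ?k * z / (1 - z)) = 2 * (?k * (1 + z) / (1 - z) - 8 + 15/2 + 1)"
        if "1 - z \<noteq> 0" for z :: real using that by (simp add: field_simps)
      show ?thesis unfolding w_def using *[OF ne] .
    qed
    moreover have "3 * P + 2 * (P * T) = 2 * P * R" if "3 + 2 * T = 2 * R" for P T R :: real
    proof -
      have "3 * P + 2 * (P * T) = P * (3 + 2 * T)" by (simp add: algebra_simps)
      then show ?thesis unfolding that by simp
    qed
    ultimately show "3 * p s + 2 * (s * ?d) = 2 * p s * (w s + 15/2 + 1)"
      unfolding sd by blast
  qed
  have ne: "1 - A * ((norm x)\<^sup>2) ^ Suc m \<noteq> 0" if "norm x \<le> 1" for x :: "real^3"
    using D(3)[OF that] D0[of x] by simp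
  show thesis
  proof (rule that[OF sQ sW])
    show "Q x = 8 * ?k\<^sup>2 * A * ((norm x)\<^sup>2) ^ m / (1 - A * ((norm x)\<^sup>2) ^ Suc m)\<^sup>2" if "norm x \<le> 1" for x
      using Qp[OF that] by (simp add: p_def)
    show "0 \<le> Q x" for x unfolding Q_def using A by (intro divide_nonneg_nonneg mult_nonneg_nonneg) auto
    show "grad W x = (Q x / 2) *\<^sub>R x" if x: "norm x < 1" for x
      using grad_radial[OF _ dw[OF ne], of W x] Ww Qp x by simp
    show "real CARD(3) * Q x + x \<bullet> grad Q x = 2 * Q x * (W x + 15/2 + 1)" if x: "norm x < 1" for x
    proof -
      obtain d where d: "(p has_real_derivative d) (at ((norm x)\<^sup>2))"
        "3 * p ((norm x)\<^sup>2) + 2 * ((norm x)\<^sup>2 * d) = 2 * p ((norm x)\<^sup>2) * (w ((norm x)\<^sup>2) + 15/2 + 1)"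
        using dp[OF ne[OF less_imp_le[OF x]]] by blast
      have "grad Q x = (2 * d) *\<^sub>R x" by (rule grad_radial[OF _ d(1) x]) (simp add: Qp)
      then have "x \<bullet> grad Q x = 2 * ((norm x)\<^sup>2 * d)" by (simp add: dot_square_norm)
      then show ?thesis using d(2) x by (simp add: Qp Ww)
    qed
    show "W x = 0" if "norm x = 1" for x
    proof -
      have "W x = ?k * (1 + A) / (1 - A) - 8" using Ww[of x] that by (simp add: w_def)
      moreover have "8 * (1 - A) / (1 - A) = 8" using A by (intro nonzero_mult_div_cancel_right) simp
      ultimately show ?thesis unfolding bdry by linarith
    qed
    show "Q x = 2 * (4 * ?k\<^sup>2 * A / (1 - A)\<^sup>2)" if "norm x = 1" for x
      using Qp[of x] that by (simp add: p_def)
  qed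
qed

text \<open>\<open>H\<close>, \<open>h\<close>, their gradients and the trace \<open>a\<close> are
  inputs fixed beforehand, so the potential enters the result only through the coefficient of the
  boundary integral.\<close>

lemma darboux_DN:
  fixes q :: "real^3 \<Rightarrow> real"
  assumes A: "0 < A" "A < 1" and bdry: "real (Suc m) * (1 + A) = 8 * (1 - A)"
    and q: "\<And>x. norm x < 1 \<Longrightarrow> q x = 8 * (real (Suc m))\<^sup>2 * A * ((norm x)\<^sup>2) ^ m / (1 - A * ((norm x)\<^sup>2) ^ Suc m)\<^sup>2"
    and H: "sobolev_triple H G f"
    and harmH: "\<And>v V. sobolev_triple v V (\<lambda>_. 0) \<Longrightarrow> (\<integral>x. G x \<bullet> V x \<partial>ball_measure) = 0"
    and h: "sobolev_triple h K a"
    and rel: "AE x in ball_measure. x \<bullet> K x + (15/2 + 1) * h x = H x"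
    and harm: "\<And>v V. sobolev_triple v V (\<lambda>_. 0) \<Longrightarrow> (\<integral>x. K x \<bullet> V x \<partial>ball_measure) = 0"
    and g: "g \<in> H_half"
  shows "DN q f g = (\<integral>x. G x \<bullet> weak_grad (ball 0 1) (SOME v. has_trace v g) x \<partial>ball_measure)
    + 4 * (real (Suc m))\<^sup>2 * A / (1 - A)\<^sup>2 * (\<integral>x. a x * g x \<partial>sphere_measure)"
proof -
  obtain Q W :: "real^3 \<Rightarrow> real" where Q: "smooth Q" and W: "smooth W"
    and Q_eq: "\<And>x. norm x \<le> 1 \<Longrightarrow> Q x = 8 * (real (Suc m))\<^sup>2 * A * ((norm x)\<^sup>2) ^ m / (1 - A * ((norm x)\<^sup>2) ^ Suc m)\<^sup>2"
    and Q0: "\<And>x. norm x < 1 \<Longrightarrow> 0 \<le> Q x"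
    and gW: "\<And>x. norm x < 1 \<Longrightarrow> grad W x = (Q x / 2) *\<^sub>R x"
    and eqn: "\<And>x. norm x < 1 \<Longrightarrow> real CARD(3) * Q x + x \<bullet> grad Q x = 2 * Q x * (W x + 15/2 + 1)"
    and W0: "\<And>x. norm x = 1 \<Longrightarrow> W x = 0"
    and Q1: "\<And>x. norm x = 1 \<Longrightarrow> Q x = 2 * (4 * (real (Suc m))\<^sup>2 * A / (1 - A)\<^sup>2)"
    using darboux_potential[OF A bdry] by blast
  let ?u = "\<lambda>x. H x + W x * h x"
  have sol1: "sobolev_triple ?u (\<lambda>x. G x + (W x *\<^sub>R K x + h x *\<^sub>R grad W x)) f"
    by (rule darboux_solution_form(1)[OF Q W _ _ _ _ H h rel]) (rule gW eqn W0 Q1 harm; assumption)+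
  have sol2: "schrodinger_form Q ?u v = (\<integral>x. G x \<bullet> V x \<partial>ball_measure)
      + 4 * (real (Suc m))\<^sup>2 * A / (1 - A)\<^sup>2 * (\<integral>x. a x * g' x \<partial>sphere_measure)"
    if v: "sobolev_triple v V g'" for v V g'
    by (rule darboux_solution_form(2)[OF Q W _ _ _ _ H h rel _ v]) (rule gW eqn W0 Q1 harm; assumption)+
  have "dirichlet_solution Q f ?u"
    unfolding dirichlet_solution_def
  proof (intro conjI allI impI)
    show "has_trace ?u f" by (rule sobolev_triple_has_trace[OF sol1])
    fix v :: "real^3 \<Rightarrow> real" assume "has_trace v (\<lambda>_. 0)"
    then have v: "sobolev_triple v (weak_grad (ball 0 1) v) (\<lambda>_. 0)" by (simp add: has_trace_iff)
    show "schrodinger_form Q ?u v = 0" using sol2[OF v] harmH[OF v] by simp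
  qed
  from DN_eq_form[OF Q Q0 this g]
  have "DN Q f g = schrodinger_form Q ?u (SOME v. has_trace v g)" .
  moreover have "has_trace (SOME v. has_trace v g) g"
    using g someI_ex[of "\<lambda>v. has_trace v g"] by (simp add: H_half_def)
  then have v: "sobolev_triple (SOME v. has_trace v g) (weak_grad (ball 0 1) (SOME v. has_trace v g)) g"
    by (simp add: has_trace_iff)
  moreover have "DN q = DN Q" by (rule DN_cong) (simp add: q Q_eq)
  ultimately show ?thesis using sol2[OF v] by simp
qed

section \<open>Unconditional power series of radial functions in several variables\<close>

section \<open>Real analyticity of the potentials\<close>

text \<open>Different indices may carry the same monomial, so the series is regrouped along the
  fibres of \<open>e\<close>. Summability of the coefficients in a fibre is read off at one point
  where all coordinates of \<open>x - p\<close> are equal and positive.\<close>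

lemma real_analyticI_monomials:
  fixes f :: "real^'n \<Rightarrow> real" and c :: "'w \<Rightarrow> real" and e :: "'w \<Rightarrow> 'n \<Rightarrow> nat"
  assumes r: "0 < r"
    and sum: "\<And>x. x \<in> ball p r \<Longrightarrow> ((\<lambda>w. c w * (\<Prod>i\<in>UNIV. (x $ i - p $ i) ^ e w i)) has_sum f x) UNIV"
  shows "\<exists>r>0. \<exists>a. \<forall>x\<in>ball p r. ((\<lambda>\<alpha>. a \<alpha> * (\<Prod>i\<in>UNIV. (x $ i - p $ i) ^ \<alpha> i)) has_sum f x) UNIV"
proof -
  \<comment> \<open>Small enough to keep \<open>p + t (1, ..., 1)\<close> inside the ball.\<close>
  define t where "t = r / (2 * (norm (1::real^'n) + 1))"
  have n1: "0 < norm (1::real^'n) + 1" by (rule add_nonneg_pos) auto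
  have t: "0 < t" using r n1 by (simp add: t_def)
  define x0 where "x0 = p + t *\<^sub>R (1::real^'n)"
  have "t * norm (1::real^'n) < t * (2 * (norm (1::real^'n) + 1))"
    using t n1 by (intro mult_strict_left_mono) auto
  also have "\<dots> = r" using n1 by (simp add: t_def)
  finally have "x0 \<in> ball p r" using t by (simp add: x0_def dist_norm)
  from sum[OF this] have "(\<lambda>w. c w * (\<Prod>i\<in>UNIV. t ^ e w i)) summable_on UNIV"
    by (auto simp: x0_def summable_on_def)
  then have fib: "(\<lambda>w. c w * (\<Prod>i\<in>UNIV. t ^ e w i)) summable_on {w. e w = \<alpha>}" for \<alpha>
    by (rule summable_on_subset_banach) simp
  have c_summable: "c summable_on {w. e w = \<alpha>}" for \<alpha>
  proof -
    have "(\<lambda>w. c w * (\<Prod>i\<in>UNIV. t ^ \<alpha> i)) summable_on {w. e w = \<alpha>}"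
      using fib[of \<alpha>] by (rule summable_on_cong[THEN iffD1, rotated]) auto
    then show ?thesis using t by (subst (asm) summable_on_cmult_left') auto
  qed
  define a where "a \<alpha> = infsum c {w. e w = \<alpha>}" for \<alpha>
  have "((\<lambda>\<alpha>. a \<alpha> * (\<Prod>i\<in>UNIV. (x $ i - p $ i) ^ \<alpha> i)) has_sum f x) UNIV" if x: "x \<in> ball p r" for x
  proof (rule has_sum_SigmaD)
    let ?F = "\<lambda>w. c w * (\<Prod>i\<in>UNIV. (x $ i - p $ i) ^ e w i)"
    have "bij_betw snd (SIGMA \<alpha>:UNIV. {w. e w = \<alpha>}) UNIV"
      by (rule bij_betwI[of _ _ _ "\<lambda>w. (e w, w)"]) auto
    from has_sum_reindex_bij_betw[OF this, of ?F "f x"] sum[OF x]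
    show "((\<lambda>z. ?F (snd z)) has_sum f x) (SIGMA \<alpha>:UNIV. {w. e w = \<alpha>})" by simp
    show "((\<lambda>w. ?F (snd (\<alpha>, w))) has_sum a \<alpha> * (\<Prod>i\<in>UNIV. (x $ i - p $ i) ^ \<alpha> i)) {w. e w = \<alpha>}" for \<alpha>
    proof -
      have "(c has_sum a \<alpha>) {w. e w = \<alpha>}" unfolding a_def by (rule has_sum_infsum[OF c_summable])
      from has_sum_cmult_left[OF this, of "\<Prod>i\<in>UNIV. (x $ i - p $ i) ^ \<alpha> i"]
      show ?thesis by (rule has_sum_cong[THEN iffD1, rotated]) auto
    qed
  qed
  with r show ?thesis by blast
qed

text \<open>The multinomial expansion before equal terms are collected; words in place of
  multinomial coefficients reduce the induction to prefixing a letter.\<close>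

lemma sum_power_words:
  fixes f :: "'j::finite \<Rightarrow> real"
  shows "(\<Sum>j\<in>UNIV. f j) ^ n = (\<Sum>w | length w = n. prod_list (map f w))"
proof (induction n)
  case (Suc n)
  have eq: "{w::'j list. length w = Suc n} = (\<lambda>(w, j). j # w) ` ({w. length w = n} \<times> UNIV)"
    using lists_length_Suc_eq[of "UNIV :: 'j set" n] by simp
  have "(\<Sum>w | length w = Suc n. prod_list (map f w)) = (\<Sum>(w, j)\<in>{w. length w = n} \<times> UNIV. f j * prod_list (map f w))"
    unfolding eq by (subst sum.reindex) (auto simp: inj_on_def case_prod_unfold)
  also have "\<dots> = (\<Sum>w | length w = n. \<Sum>j\<in>UNIV. f j * prod_list (map f w))"
    by (rule sum.cartesian_product[symmetric])
  also have "\<dots> = (\<Sum>j\<in>UNIV. f j) ^ Suc n"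
    by (simp add: Suc sum_distrib_left sum_distrib_right mult.commute)
  finally show ?case by simp
qed simp

lemma finite_words: "finite {w::'j::finite list. length w = n}"
  using finite_lists_length_eq[of "UNIV :: 'j set" n] by simp

text \<open>Replacing every \<open>m j\<close> and \<open>b n\<close> by its absolute value gives a
  convergent majorant, so the sum over lengths and words of each length may be merged into one
  unconditional sum.\<close>

lemma has_sum_words:
  fixes m :: "'j::finite \<Rightarrow> real" and b :: "nat \<Rightarrow> real"
  assumes "summable (\<lambda>n. \<bar>b n\<bar> * (\<Sum>j\<in>UNIV. \<bar>m j\<bar>) ^ n)"
  shows "((\<lambda>w. b (length w) * prod_list (map m w)) has_sum (\<Sum>n. b n * (\<Sum>j\<in>UNIV. m j) ^ n)) UNIV"
proof -
  let ?W = "SIGMA n:UNIV. {w::'j list. length w = n}"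
  have bij: "bij_betw snd ?W UNIV"
    by (rule bij_betwI[of _ _ _ "\<lambda>w. (length w, w)"]) auto
  have abs: "\<bar>prod_list (map m w)\<bar> = prod_list (map (\<lambda>j. \<bar>m j\<bar>) w)" for w
    by (induction w) (auto simp: abs_mult)
  have nonneg: "0 \<le> (\<Sum>j\<in>UNIV. \<bar>m j\<bar>)" by (simp add: sum_nonneg)
  have le: "\<bar>\<Sum>j\<in>UNIV. m j\<bar> \<le> (\<Sum>j\<in>UNIV. \<bar>m j\<bar>)" by (rule sum_abs)
  have summ: "(\<lambda>z. \<bar>b (length (snd z)) * prod_list (map m (snd z))\<bar>) summable_on ?W"
  proof (rule summable_on_SigmaI)
    show "((\<lambda>w. \<bar>b (length (snd (n, w))) * prod_list (map m (snd (n, w)))\<bar>) has_sum \<bar>b n\<bar> * (\<Sum>j\<in>UNIV. \<bar>m j\<bar>) ^ n)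
        {w. length w = n}" for n
      by (rule has_sum_finiteI[OF finite_words])
        (simp add: sum_power_words abs_mult abs sum_distrib_left)
    have "(\<lambda>n. \<bar>b n\<bar> * (\<Sum>j\<in>UNIV. \<bar>m j\<bar>) ^ n) summable_on UNIV"
      using norm_summable_imp_summable_on[of "\<lambda>n. \<bar>b n\<bar> * (\<Sum>j\<in>UNIV. \<bar>m j\<bar>) ^ n"] assms nonneg
      by (simp add: abs_mult)
    then show "(\<lambda>n. \<bar>b n\<bar> * (\<Sum>j\<in>UNIV. \<bar>m j\<bar>) ^ n) summable_on UNIV" .
  qed auto
  have "((\<lambda>z. b (length (snd z)) * prod_list (map m (snd z))) has_sum (\<Sum>n. b n * (\<Sum>j\<in>UNIV. m j) ^ n)) ?W"
  proof (rule has_sum_SigmaI)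
    show "((\<lambda>w. b (length (snd (n, w))) * prod_list (map m (snd (n, w)))) has_sum b n * (\<Sum>j\<in>UNIV. m j) ^ n)
        {w. length w = n}" for n
      by (rule has_sum_finiteI[OF finite_words]) (simp add: sum_power_words sum_distrib_left)
    have ns: "summable (\<lambda>n. norm (b n * (\<Sum>j\<in>UNIV. m j) ^ n))"
      by (rule summable_comparison_test'[OF assms, of 0])
        (use power_mono[OF le] in \<open>auto simp: abs_mult power_abs intro!: mult_left_mono\<close>)
    show "((\<lambda>n. b n * (\<Sum>j\<in>UNIV. m j) ^ n) has_sum (\<Sum>n. b n * (\<Sum>j\<in>UNIV. m j) ^ n)) UNIV"
      by (rule norm_summable_imp_has_sum[OF ns summable_sums[OF summable_norm_cancel[OF ns]]])
    show "(\<lambda>z. b (length (snd z)) * prod_list (map m (snd z))) summable_on ?W"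
      using summ by (subst summable_on_iff_abs_summable_on_real) simp
  qed
  then show ?thesis
    using has_sum_reindex_bij_betw[OF bij, of "\<lambda>w. b (length w) * prod_list (map m w)"] by simp
qed

text \<open>Expand \<open>p (\<bar>x\<bar>\<^sup>2)\<close> in powers of \<open>\<bar>x\<bar>\<^sup>2 - \<bar>x\<^sub>0\<bar>\<^sup>2 = \<Sum>\<^sub>i 2 x\<^sub>0\<^sub>i y\<^sub>i + y\<^sub>i\<^sup>2\<close>, where \<open>y = x - x\<^sub>0\<close>: the
  \<open>n\<close>-th power is a sum of monomials indexed by the words of length \<open>n\<close> in these summands.\<close>
lemma real_analytic_radial:
  fixes U :: "(real^'n) set" and p :: "real \<Rightarrow> real"
  assumes exp: "\<And>x0. x0 \<in> U \<Longrightarrow> \<exists>F. (\<lambda>\<tau>. p ((norm x0)\<^sup>2 + \<tau>)) has_fps_expansion F"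
  shows "(\<lambda>x. p ((norm x)\<^sup>2)) real_analytic_on U"
  unfolding real_analytic_on_def
proof
  fix x0 assume "x0 \<in> U"
  then obtain F where F: "(\<lambda>\<tau>. p ((norm x0)\<^sup>2 + \<tau>)) has_fps_expansion F" using exp by blast
  define b where "b = fps_nth F"
  obtain \<rho>1 where \<rho>1: "0 < \<rho>1" "ereal \<rho>1 < fps_conv_radius F"
    using F ereal_dense2[of 0 "fps_conv_radius F"] by (auto simp: has_fps_expansion_def zero_ereal_def)
  have "\<forall>\<^sub>F z in nhds 0. eval_fps F z = p ((norm x0)\<^sup>2 + z)"
    using F by (simp add: has_fps_expansion_def)
  then obtain \<rho>2 where \<rho>2: "0 < \<rho>2" "\<And>z. \<bar>z\<bar> < \<rho>2 \<Longrightarrow> eval_fps F z = p ((norm x0)\<^sup>2 + z)"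
    by (auto simp: eventually_nhds_metric dist_norm)
  define \<rho> where "\<rho> = min \<rho>1 \<rho>2"
  have \<rho>: "0 < \<rho>" using \<rho>1 \<rho>2 by (simp add: \<rho>_def)
  \<comment> \<open>For \<open>|y| < 1\<close> the absolute values of all summands add up to at most
    \<open>(M - 1) |y|\<close>; the extra 1 ensures \<open>M \<ge> 1\<close>.\<close>
  define M where "M = (\<Sum>i\<in>UNIV. 2 * \<bar>x0 $ i\<bar> + 1) + 1"
  have M: "1 \<le> M" unfolding M_def by (simp add: sum_nonneg)
  define r where "r = min 1 (\<rho> / M)"
  have r: "0 < r" using \<rho> M by (simp add: r_def)
  \<comment> \<open>The letter \<open>(i, False)\<close> stands for the summand
    \<open>2 x0_i y_i\<close>, the letter \<open>(i, True)\<close> for \<open>y_i^2\<close>;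
    \<open>d\<close> is its coefficient and \<open>E\<close> its exponent vector.\<close>
  define d :: "'n \<times> bool \<Rightarrow> real" where "d j = (if snd j then 1 else 2 * x0 $ fst j)" for j
  define E :: "'n \<times> bool \<Rightarrow> 'n \<Rightarrow> nat" where "E j i = (if i = fst j then if snd j then 2 else 1 else 0)" for j i
  define e where "e w i = sum_list (map (\<lambda>j. E j i) w)" for w i
  show "\<exists>r>0. \<exists>a. \<forall>x\<in>ball x0 r. ((\<lambda>\<alpha>. a \<alpha> * (\<Prod>i\<in>UNIV. (x $ i - x0 $ i) ^ \<alpha> i)) has_sum p ((norm x)\<^sup>2)) UNIV"
  proof (rule real_analyticI_monomials[OF r])
    fix x assume x: "x \<in> ball x0 r"
    define y where "y = x - x0"
    have y: "norm y < r" using x by (simp add: y_def dist_norm norm_minus_commute)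
    define m where "m j = d j * (\<Prod>i\<in>UNIV. (y $ i) ^ E j i)" for j
    have m_eq: "m (l, s) = (if s then (y $ l)\<^sup>2 else 2 * x0 $ l * y $ l)" for l s
    proof -
      have "(\<Prod>i\<in>UNIV. (y $ i) ^ E (l, s) i) = (\<Prod>i\<in>UNIV. if i = l then (y $ i) ^ (if s then 2 else 1) else 1)"
        by (rule prod.cong) (auto simp: E_def)
      then show ?thesis by (simp add: m_def d_def)
    qed
    have UN: "(\<Sum>j\<in>UNIV. g j) = (\<Sum>l\<in>UNIV. g (l, False) + g (l, True))" for g :: "'n \<times> bool \<Rightarrow> real"
    proof -
      have "(\<Sum>j\<in>UNIV. g j) = (\<Sum>l\<in>UNIV. \<Sum>s\<in>UNIV. g (l, s))"
        by (simp add: sum.cartesian_product flip: UNIV_Times_UNIV)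
      then show ?thesis by (simp add: UNIV_bool add.commute)
    qed
    have \<tau>: "(norm x0)\<^sup>2 + (\<Sum>j\<in>UNIV. m j) = (norm x)\<^sup>2"
    proof -
      have "(norm x)\<^sup>2 = (\<Sum>l\<in>UNIV. (x0 $ l)\<^sup>2 + (2 * x0 $ l * y $ l + (y $ l)\<^sup>2))"
        unfolding power2_norm_eq_inner inner_vec_def inner_real_def
        by (rule sum.cong) (auto simp: y_def power2_eq_square algebra_simps)
      also have "\<dots> = (norm x0)\<^sup>2 + (\<Sum>j\<in>UNIV. m j)"
        unfolding UN m_eq power2_norm_eq_inner inner_vec_def inner_real_def
        by (simp add: sum.distrib power2_eq_square)
      finally show ?thesis by simp
    qed
    have small: "(\<Sum>j\<in>UNIV. \<bar>m j\<bar>) < \<rho>"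
    proof -
      have "(\<Sum>j\<in>UNIV. \<bar>m j\<bar>) \<le> (\<Sum>l\<in>UNIV. (2 * \<bar>x0 $ l\<bar> + 1) * norm y)"
        unfolding UN
      proof (rule sum_mono)
        fix l
        have "\<bar>y $ l\<bar> \<le> norm y" by (rule component_le_norm_cart)
        moreover have "\<bar>y $ l\<bar> * \<bar>y $ l\<bar> \<le> 1 * norm y"
          using calculation y by (intro mult_mono) (auto simp: r_def)
        ultimately show "\<bar>m (l, False)\<bar> + \<bar>m (l, True)\<bar> \<le> (2 * \<bar>x0 $ l\<bar> + 1) * norm y"
          using mult_left_mono[of "\<bar>y $ l\<bar>" "norm y" "2 * \<bar>x0 $ l\<bar>"]
          by (simp add: m_eq abs_mult power2_eq_square distrib_right)
      qed
      also have "\<dots> = (M - 1) * norm y" by (simp add: M_def sum_distrib_right)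
      also have "\<dots> \<le> M * norm y" by (intro mult_right_mono) auto
      also have "\<dots> < M * r" using M y by (intro mult_strict_left_mono) auto
      also have "\<dots> \<le> M * (\<rho> / M)" using M by (intro mult_left_mono) (auto simp: r_def)
      also have "\<dots> = \<rho>" using M by simp
      finally show ?thesis .
    qed
    have nn: "0 \<le> (\<Sum>j\<in>UNIV. \<bar>m j\<bar>)" by (simp add: sum_nonneg)
    have "summable (\<lambda>n. norm (fps_nth F n * (\<Sum>j\<in>UNIV. \<bar>m j\<bar>) ^ n))"
    proof (rule norm_summable_fps)
      have "ereal (norm (\<Sum>j\<in>UNIV. \<bar>m j\<bar>)) < ereal \<rho>1" using small nn by (simp add: \<rho>_def)
      then show "ereal (norm (\<Sum>j\<in>UNIV. \<bar>m j\<bar>)) < fps_conv_radius F" using \<rho>1(2) by (rule less_trans)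
    qed
    then have "summable (\<lambda>n. \<bar>b n\<bar> * (\<Sum>j\<in>UNIV. \<bar>m j\<bar>) ^ n)"
      using nn by (simp add: b_def abs_mult)
    from has_sum_words[OF this]
    have "((\<lambda>w. b (length w) * prod_list (map m w)) has_sum (\<Sum>n. b n * (\<Sum>j\<in>UNIV. m j) ^ n)) UNIV" .
    moreover have "(\<Sum>n. b n * (\<Sum>j\<in>UNIV. m j) ^ n) = p ((norm x)\<^sup>2)"
    proof -
      have "\<bar>\<Sum>j\<in>UNIV. m j\<bar> < \<rho>2"
        using le_less_trans[OF sum_abs[of m UNIV] small] by (simp add: \<rho>_def)
      from \<rho>2(2)[OF this] show ?thesis by (simp add: eval_fps_def b_def \<tau>)
    qed
    moreover have "prod_list (map m w) = prod_list (map d w) * (\<Prod>i\<in>UNIV. (y $ i) ^ e w i)" for w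
      by (induction w) (auto simp: e_def m_def power_add prod.distrib)
    ultimately show "((\<lambda>w. (b (length w) * prod_list (map d w)) * (\<Prod>i\<in>UNIV. (x $ i - x0 $ i) ^ e w i)) has_sum p ((norm x)\<^sup>2)) UNIV"
      by (simp add: y_def mult.assoc)
  qed
qed

lemma has_fps_expansion_realpow:
  fixes f :: "real \<Rightarrow> real"
  assumes "f has_fps_expansion F"
  shows "(\<lambda>x. f x ^ k) has_fps_expansion F ^ k"
proof (induction k)
  case (Suc k)
  show ?case using has_fps_expansion_mult[OF assms Suc] by simp
qed (use has_fps_expansion_const[of "1::real"] in simp)

text \<open>\<open>U\<close> consists of the points strictly inside the pole. Around each of them
  the potential is, in the variable \<open>|x|^2\<close>, a quotient of polynomials whose
  denominator has non-zero constant term.\<close>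

lemma real_analytic_potential:
  fixes q :: "real^'n \<Rightarrow> real"
  assumes A: "0 < A" "A < 1" and C: "0 \<le> C"
    and q: "\<And>x. q x = C * (((norm x)\<^sup>2) ^ m / (1 - A * ((norm x)\<^sup>2) ^ k)\<^sup>2)"
  shows "\<exists>U. open U \<and> cball 0 1 \<subseteq> U \<and> q real_analytic_on U \<and> (\<forall>x\<in>U. 0 \<le> q x)"
proof (intro exI conjI)
  let ?U = "{x :: real^'n. A * ((norm x)\<^sup>2) ^ k < 1}"
  show "open ?U" by (intro open_Collect_less continuous_intros)
  show "cball 0 1 \<subseteq> ?U"
  proof
    fix x :: "real^'n" assume "x \<in> cball 0 1"
    then have "((norm x)\<^sup>2) ^ k \<le> 1" by (intro power_le_one) auto
    then have "A * ((norm x)\<^sup>2) ^ k \<le> A * 1" using A by (intro mult_left_mono) auto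
    then have "A * ((norm x)\<^sup>2) ^ k < 1" using A by linarith
    then show "x \<in> ?U" by simp
  qed
  show "\<forall>x\<in>?U. 0 \<le> q x" using C by (auto simp: q)
  define p where "p s = C * (s ^ m / (1 - A * s ^ k)\<^sup>2)" for s
  have "(\<lambda>x. p ((norm x)\<^sup>2)) real_analytic_on ?U"
  proof (rule real_analytic_radial)
    fix x0 :: "real^'n" assume x0: "x0 \<in> ?U"
    let ?s = "(norm x0)\<^sup>2"
    have s: "(\<lambda>\<tau>. ?s + \<tau>) has_fps_expansion fps_const ?s + fps_X"
      by (intro has_fps_expansion_add has_fps_expansion_const has_fps_expansion_fps_X)
    let ?D = "(fps_const 1 - fps_const A * (fps_const ?s + fps_X) ^ k) ^ 2"
    have D: "(\<lambda>\<tau>. (1 - A * (?s + \<tau>) ^ k) ^ 2) has_fps_expansion ?D"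
      by (intro has_fps_expansion_realpow has_fps_expansion_diff has_fps_expansion_mult
          has_fps_expansion_const s)
    have "fps_nth ?D 0 = (1 - A * ?s ^ k) ^ 2"
      using D by (auto simp: has_fps_expansion_def eval_fps_at_0 dest: eventually_nhds_x_imp_x)
    then have "fps_nth ?D 0 \<noteq> 0" using x0 by simp
    from has_fps_expansion_mult[OF has_fps_expansion_const has_fps_expansion_divide'[OF has_fps_expansion_realpow[OF s] D this]]
    show "\<exists>F. (\<lambda>\<tau>. p (?s + \<tau>)) has_fps_expansion F" unfolding p_def by blast
  qed
  then show "q real_analytic_on ?U" by (simp add: p_def q[abs_def])
qed

theorem proposition3p2:
  fixes q q\<^sub>1 q\<^sub>2 :: "real^3 \<Rightarrow> real"
  assumes "\<And>x. q\<^sub>1 x = (56/9) / (1 - 7/9 * norm x ^ 2) ^ 2"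
    and "\<And>x. q x = 600/13 * (norm x ^ 8 / (1 - 3/13 * norm x ^ 10) ^ 2)"
    and "\<And>x. q\<^sub>2 x = 392/15 * (norm x ^ 12 / (1 - 1/15 * norm x ^ 14) ^ 2)"
  shows "(\<forall>p\<in>{q, q\<^sub>1, q\<^sub>2}. \<exists>U. open U \<and> cball 0 1 \<subseteq> U \<and>
             p real_analytic_on U \<and> (\<forall>x\<in>U. 0 \<le> p x))
       \<and> (\<exists>x\<in>ball 0 1. q x \<noteq> q\<^sub>1 x) \<and> (\<exists>x\<in>ball 0 1. q x \<noteq> q\<^sub>2 x)
       \<and> (\<exists>x\<in>ball 0 1. q\<^sub>1 x \<noteq> q\<^sub>2 x)
       \<and> (\<forall>f\<in>H_half. \<forall>g\<in>H_half. DN q f g = 1/2 * DN q\<^sub>1 f g + 1/2 * DN q\<^sub>2 f g)"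
proof -
  \<comment> \<open>In terms of \<open>|x|^2\<close> the numerators have degree
    \<open>m = 0, 4, 6\<close>, and \<kappa> is \<open>Suc m\<close>.\<close>
  have A1: "real (Suc 0) * (1 + 7/9) = 8 * (1 - 7/9 :: real)" and A2: "real (Suc 4) * (1 + 3/13) = 8 * (1 - 3/13 :: real)"
    and A3: "real (Suc 6) * (1 + 1/15) = 8 * (1 - 1/15 :: real)" by simp_all
  have q1: "q\<^sub>1 x = 56/9 * (((norm x)\<^sup>2) ^ 0 / (1 - 7/9 * ((norm x)\<^sup>2) ^ Suc 0)\<^sup>2)"
    and q: "q x = 600/13 * (((norm x)\<^sup>2) ^ 4 / (1 - 3/13 * ((norm x)\<^sup>2) ^ Suc 4)\<^sup>2)"
    and q2: "q\<^sub>2 x = 392/15 * (((norm x)\<^sup>2) ^ 6 / (1 - 1/15 * ((norm x)\<^sup>2) ^ Suc 6)\<^sup>2)" for x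
    unfolding assms power_mult[symmetric] by simp_all
  have "\<forall>p\<in>{q, q\<^sub>1, q\<^sub>2}. \<exists>U. open U \<and> cball 0 1 \<subseteq> U \<and> p real_analytic_on U \<and> (\<forall>x\<in>U. 0 \<le> p x)"
    using real_analytic_potential[OF _ _ _ q] real_analytic_potential[OF _ _ _ q1]
      real_analytic_potential[OF _ _ _ q2] by simp
  \<comment> \<open>At the origin \<open>q\<^sub>1\<close> equals 56/9 and the other two
    vanish.\<close>
  moreover have "\<exists>x\<in>ball 0 1. q x \<noteq> q\<^sub>1 x" "\<exists>x\<in>ball 0 1. q\<^sub>1 x \<noteq> q\<^sub>2 x"
    by (rule bexI[of _ 0]; simp add: assms)+
  \<comment> \<open>Both vanish at the origin, so they are compared at distance 1/2 from it.\<close>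
  moreover have "\<exists>x\<in>ball 0 1. q x \<noteq> q\<^sub>2 x"
    by (rule bexI[of _ "(1/2) *\<^sub>R axis 1 1"]) (simp_all add: assms norm_axis_1 power_divide power2_eq_square)
  moreover have "DN q f g = 1/2 * DN q\<^sub>1 f g + 1/2 * DN q\<^sub>2 f g" if f: "f \<in> H_half" and g: "g \<in> H_half" for f g
  proof -
    obtain u where "sobolev_triple u (weak_grad (ball 0 1) u) f"
      using f by (auto simp: H_half_def has_trace_iff)
    then obtain H G where H: "sobolev_triple H G f"
      and harmH: "\<And>v V. sobolev_triple v V (\<lambda>_. 0) \<Longrightarrow> (\<integral>x. G x \<bullet> V x \<partial>ball_measure) = 0"
      using harmonic_extension_exists by blast
    \<comment> \<open>The exponent \<open>b = 15/2\<close> makes \<open>b + 1\<close> the boundary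
      value 8 plus 1/2, and it satisfies the contraction condition \<open>b \<ge> n\<close>.\<close>
    have n: "real CARD(3) \<le> 15/2" by simp
    obtain h K a where h: "sobolev_triple h K a"
      and rel: "AE x in ball_measure. x \<bullet> K x + (15/2 + 1) * h x = H x"
      and harm: "\<And>v V. sobolev_triple v V (\<lambda>_. 0) \<Longrightarrow> (\<integral>x. K x \<bullet> V x \<partial>ball_measure) = 0"
      by (rule harmonic_Robin_solution[OF n H harmH]) (assumption | rule that | blast)+
    \<comment> \<open>Common to all three potentials; the coefficients of \<open>Y\<close> below are
      the numbers 64 - \<kappa>^2.\<close>
    define X where "X = (\<integral>x. G x \<bullet> weak_grad (ball 0 1) (SOME v. has_trace v g) x \<partial>ball_measure)"
    define Y where "Y = (\<integral>x. a x * g x \<partial>sphere_measure)"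
    have "DN q\<^sub>1 f g = X + 4 * (real (Suc 0))\<^sup>2 * (7/9) / (1 - 7/9)\<^sup>2 * Y"
      unfolding X_def Y_def
      by (rule darboux_DN[OF _ _ A1 _ H harmH h rel harm g]) (simp_all add: q1)
    moreover have "DN q f g = X + 4 * (real (Suc 4))\<^sup>2 * (3/13) / (1 - 3/13)\<^sup>2 * Y"
      unfolding X_def Y_def
      by (rule darboux_DN[OF _ _ A2 _ H harmH h rel harm g]) (simp_all add: q)
    moreover have "DN q\<^sub>2 f g = X + 4 * (real (Suc 6))\<^sup>2 * (1/15) / (1 - 1/15)\<^sup>2 * Y"
      unfolding X_def Y_def
      by (rule darboux_DN[OF _ _ A3 _ H harmH h rel harm g]) (simp_all add: q2)
    ultimately show ?thesis by (simp add: power2_eq_square field_simps)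
  qed
  ultimately show ?thesis by blast
qed

end
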